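(* Let $Y_1,\dots,Y_q$ be locally Lipschitz continuous vector fields on $\mathbb{R}^n$, $Y_j=g_j\cdot\nabla$, satisfying condition (H): for every bounded open set $\Omega\subset\mathbb{R}^n$ there is a constant $C_\Omega>0$ such that $$[Y_j,Y_k]_x:=\big(Y_jg_k(x)-Y_kg_j(x)\big)\cdot\nabla\in P_x^{C_\Omega}\quad\text{for a.e. }x\in\Omega\text{ and all }j,k\in\{1,\dots,q\}.$$ Then for every $x\in\mathbb{R}^n$ the orbit $\mathcal{O}^x$, endowed with the topology $\tau_d$, has the structure of a connected $C^{1,1}$ immersed submanifold of $\mathbb{R}^n$ with $T_y\mathcal{O}^x=P_y$ for all $y\in\mathcal{O}^x$.
   Context: Vector fields are identified with maps $g_j=(g_j^1,\dots,g_j^n):\mathbb{R}^n\to\mathbb{R}^n$, $Y_j=\sum_{\alpha=1}^n g_j^\alpha\partial_\alpha$; $Y_j(x)$ or $Y_{j,x}$ denotes the value at $x$. For a.e. $x$ (by Rademacher's theorem) $Y_jg_k(x):=Dg_k(x)\,g_j(x)$. Notation: $P_x:=\mathrm{Span}\{Y_{1,x},\dots,Y_{q,x}\}$, $p_x:=\dim P_x$, and for $r>0$, $P_x^r:=\{\sum_{j=1}^q c_jY_{j,x}: c\in\mathbb{R}^q,\ |c|\le r\}$. A path $\gamma:[0,T]\to\mathbb{R}^n$ is subunit if it is Lipschitz and $\dot\gamma(t)=\sum_{j=1}^q u_j(t)Y_j(\gamma(t))$ for a.e. $t$, for some $u\in L^\infty((0,T),\mathbb{R}^q)$ with $|u(t)|\le1$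 a.e. The Carnot–Carathéodory distance is $d(x,y):=\inf\{T\ge0:\exists\ \gamma$ subunit on $[0,T]$ with $\gamma(0)=x,\gamma(T)=y\}$, with $d(x,y)=\infty$ if no such path exists. The orbit of $x$ is $\mathcal{O}^x:=\{y\in\mathbb{R}^n: d(x,y)<\infty\}$, and $\tau_d$ is the topology on $\mathcal{O}^x$ induced by $d$. *)

theory Defs
  imports "HOL-Analysis.Analysis"
begin

text \<open>Vector fields Y_j (j < q) on the Euclidean space 'a are given by g j :: 'a => 'a.\<close>

definition locally_lipschitz :: "('a::metric_space \<Rightarrow> 'b::metric_space) \<Rightarrow> bool" where
  "locally_lipschitz f \<longleftrightarrow> (\<forall>x. \<exists>r>0. \<exists>K. lipschitz_on K (ball x r) f)"

definition lie_bracket :: "(nat \<Rightarrow> 'a::euclidean_space \<Rightarrow> 'a) \<Rightarrow> nat \<Rightarrow> nat \<Rightarrow> 'a \<Rightarrow> 'a" where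
  "lie_bracket g j k x =
     frechet_derivative (g k) (at x) (g j x) - frechet_derivative (g j) (at x) (g k x)"

definition Pball :: "(nat \<Rightarrow> 'a::euclidean_space \<Rightarrow> 'a) \<Rightarrow> nat \<Rightarrow> real \<Rightarrow> 'a \<Rightarrow> 'a set" where
  "Pball g q r x = {(\<Sum>j<q. c j *\<^sub>R g j x) | c. sqrt (\<Sum>j<q. (c j)\<^sup>2) \<le> r}"

definition Pspace :: "(nat \<Rightarrow> 'a::euclidean_space \<Rightarrow> 'a) \<Rightarrow> nat \<Rightarrow> 'a \<Rightarrow> 'a set" where
  "Pspace g q x = span {g j x | j. j < q}"

definition subunit :: "(nat \<Rightarrow> 'a::euclidean_space \<Rightarrow> 'a) \<Rightarrow> nat \<Rightarrow> real \<Rightarrow> (real \<Rightarrow> 'a) \<Rightarrow> bool" where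
  "subunit g q T \<gamma> \<longleftrightarrow> T \<ge> 0 \<and> (\<exists>K. lipschitz_on K {0..T} \<gamma>) \<and>
     (\<exists>u :: real \<Rightarrow> nat \<Rightarrow> real.
        (\<forall>j<q. (\<lambda>t. u t j) \<in> borel_measurable (lebesgue_on {0..T})) \<and>
        (AE t in lebesgue_on {0..T}.
            sqrt (\<Sum>j<q. (u t j)\<^sup>2) \<le> 1 \<and>
            (\<gamma> has_vector_derivative (\<Sum>j<q. u t j *\<^sub>R g j (\<gamma> t))) (at t)))"

text \<open>Carnot-Caratheodory distance (value \<infinity> if no subunit path exists).\<close>
definition cc_dist :: "(nat \<Rightarrow> 'a::euclidean_space \<Rightarrow> 'a) \<Rightarrow> nat \<Rightarrow> 'a \<Rightarrow> 'a \<Rightarrow> ereal" where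
  "cc_dist g q x y = Inf {ereal T | T. \<exists>\<gamma>. subunit g q T \<gamma> \<and> \<gamma> 0 = x \<and> \<gamma> T = y}"

definition orbit :: "(nat \<Rightarrow> 'a::euclidean_space \<Rightarrow> 'a) \<Rightarrow> nat \<Rightarrow> 'a \<Rightarrow> 'a set" where
  "orbit g q x = {y. cc_dist g q x y < \<infinity>}"

definition cc_topology :: "(nat \<Rightarrow> 'a::euclidean_space \<Rightarrow> 'a) \<Rightarrow> nat \<Rightarrow> 'a \<Rightarrow> 'a topology" where
  "cc_topology g q x = topology (\<lambda>U. U \<subseteq> orbit g q x \<and>
      (\<forall>y\<in>U. \<exists>r>0. {z \<in> orbit g q x. cc_dist g q y z < ereal r} \<subseteq> U))"

text \<open>C^{1,1} maps defined on a relatively open subset V of a linear subspace L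
  (a copy of R^m): differentiable with derivative Df that is locally Lipschitz
  in operator norm (on L).\<close>
definition C11_deriv_on :: "'a::euclidean_space set \<Rightarrow> 'a set \<Rightarrow> ('a \<Rightarrow> 'b::real_normed_vector)
    \<Rightarrow> ('a \<Rightarrow> 'a \<Rightarrow> 'b) \<Rightarrow> bool" where
  "C11_deriv_on L V f Df \<longleftrightarrow>
     (\<forall>v\<in>V. (f has_derivative Df v) (at v within V)) \<and>
     (\<forall>v\<in>V. \<exists>r>0. \<exists>K. \<forall>a\<in>V \<inter> ball v r. \<forall>b\<in>V \<inter> ball v r. \<forall>h\<in>L.
         norm (Df a h - Df b h) \<le> K * dist a b * norm h)"

definition C11_on :: "'a::euclidean_space set \<Rightarrow> 'a set \<Rightarrow> ('a \<Rightarrow> 'b::real_normed_vector) \<Rightarrow> bool" where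
  "C11_on L V f \<longleftrightarrow> (\<exists>Df. C11_deriv_on L V f Df)"

definition C11_chart :: "'a::euclidean_space topology \<Rightarrow> ('a \<Rightarrow> 'a set) \<Rightarrow> 'a set \<Rightarrow> 'a set
    \<Rightarrow> ('a \<Rightarrow> 'a) \<Rightarrow> bool" where
  "C11_chart X T L V \<phi> \<longleftrightarrow>
     subspace L \<and> openin (top_of_set L) V \<and>
     openin X (\<phi> ` V) \<and>
     homeomorphic_map (top_of_set V) (subtopology X (\<phi> ` V)) \<phi> \<and>
     (\<exists>Df. C11_deriv_on L V \<phi> Df \<and>
        (\<forall>v\<in>V. inj_on (Df v) L \<and> Df v ` L = T (\<phi> v)))"

definition C11_compatible ::
  "'a::euclidean_space set \<times> 'a set \<times> ('a \<Rightarrow> 'a) \<Rightarrow> 'a set \<times> 'a set \<times> ('a \<Rightarrow> 'a) \<Rightarrow> bool" where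
  "C11_compatible c1 c2 \<longleftrightarrow>
     (case c1 of (L1, V1, \<phi>1) \<Rightarrow> case c2 of (L2, V2, \<phi>2) \<Rightarrow>
        C11_on L1 {v \<in> V1. \<phi>1 v \<in> \<phi>2 ` V2} (inv_into V2 \<phi>2 \<circ> \<phi>1))"

definition C11_immersed_submanifold :: "'a::euclidean_space topology \<Rightarrow> ('a \<Rightarrow> 'a set) \<Rightarrow> bool" where
  "C11_immersed_submanifold X T \<longleftrightarrow>
     Hausdorff_space X \<and>
     (\<exists>m A. (\<forall>(L, V, \<phi>) \<in> A. C11_chart X T L V \<phi> \<and> dim L = m) \<and>
            topspace X = (\<Union>(L, V, \<phi>) \<in> A. \<phi> ` V) \<and>
            (\<forall>c1\<in>A. \<forall>c2\<in>A. C11_compatible c1 c2))"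

end

theory Submission
  imports Defs
begin

text \<open>
  Fix a point \<open>x0\<close>, let \<open>P\<close> be the orthogonal projection onto the span of the fields at \<open>x0\<close>, and
  normalise: near \<open>x0\<close> there are Lipschitz coefficients such that the combinations \<open>Z x v\<close> of the
  fields at \<open>x\<close> satisfy \<open>P (Z x v) = P v\<close>. The remainders \<open>W l x = g l x - Z x (g l x)\<close> are vertical and
  vanish at \<open>x0\<close>. Because brackets of fields with constant horizontal part are vertical, condition (H)
  bounds, at almost every point, both \<open>[Z v, Z w]\<close> and the derivative of \<open>W l\<close> along \<open>Z v\<close> by a multiple of
  the total size of the remainders.

  Let \<open>\<Phi>(v, z)\<close> be the time-one flow of \<open>Z v\<close> started at \<open>z\<close>. By Rademacher's theorem and Fubini, for almost
  every pair \<open>(v, z)\<close> almost every point of the trajectory is a point where these bounds hold, so Gronwall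
  type estimates give that the remainders stay comparable to their value at \<open>z\<close> and that
  \<open>\<Phi>(v + w, z) - \<Phi>(v, z) - Z w\<close> is controlled by the same quantity, up to second order in \<open>w\<close>. Both inequalities are
  stable under limits and hence hold for \<open>z = x0\<close>, where the right-hand side vanishes. Thus
  \<open>\<phi> v = \<Phi>(v, x0)\<close> is a \<open>C\<^sup>1\<^sup>,\<^sup>1\<close> surface tangent to the fields. A subunit path which starts on that
  surface stays there for a short time, by another Gronwall estimate for its distance to the surface, so the
  surfaces are the charts of the orbit; the projection \<open>P\<close> inverts \<open>\<phi>\<close>, which makes the charts compatible.
\<close>

section \<open>Lipschitz functions of one variable\<close>

text \<open>Derivatives of the fields, and condition (H), are available only almost everywhere,
  while the orbit of \<open>x0\<close> may be a null set, on which nothing is known directly. The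
  rank may also jump off the orbit, so the remainders \<open>W l\<close> need not vanish near
  \<open>x0\<close>. Hence every estimate is stated on a full neighbourhood, with an error
  proportional to the remainders at the starting point, a continuous quantity that is zero at
  \<open>x0\<close>.

  The normalisation \<open>P (Z x v) = P v\<close> makes brackets vertical because a map with
  constant \<open>P\<close>-part has derivatives in the kernel of \<open>P\<close>; and a
  combination of the fields lying in that kernel equals the same combination of the remainders. It
  also gives the flow a constant horizontal velocity, so \<open>P\<close> reads off the parameter.

  Gronwall's inequality appears in absorbed form: time and parameters are so small that the maximum
  of the unknown is bounded by a proper fraction of itself plus the error. The C^{1,1} regularity
  comes from the derivative of \<open>\<phi>\<close> at \<open>v\<close> being
  \<open>Z (\<phi> v)\<close>, a composition of Lipschitz maps.\<close>

lemma negligible_lipschitz_image: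
  fixes f :: "'a::euclidean_space \<Rightarrow> 'a"
  assumes "negligible S" "K-lipschitz_on S f"
  shows "negligible (f ` S)"
proof (rule negligible_locally_Lipschitz_image)
  show "\<exists>T B. open T \<and> x \<in> T \<and> (\<forall>y\<in>S \<inter> T. norm (f y - f x) \<le> B * norm (y - x))" if "x \<in> S" for x
    using lipschitz_onD[OF assms(2)] that by (intro exI[of _ UNIV] exI[of _ K]) (auto simp: dist_norm)
qed (use assms in auto)

text \<open>If \<open>f a < f b\<close>, some level \<open>y\<close> strictly between the two values
  is missed by the null image of \<open>N\<close>. The last time at which \<open>f\<close> is at
  most \<open>y\<close> has value exactly \<open>y\<close>, so it lies outside \<open>N\<close>, and
  \<open>step\<close> produces a later such time. Nullity is asked of the image because levels, not
  times, have to be avoided; a Lipschitz map supplies it from a null \<open>N\<close>.\<close>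

lemma Dini_nonincreasing:
  fixes f :: "real \<Rightarrow> real"
  assumes "a \<le> b" and cont: "continuous_on {a..b} f" and N: "negligible (f ` N)"
    and step: "\<And>t. t \<in> {a..<b} \<Longrightarrow> t \<notin> N \<Longrightarrow> \<exists>h>0. t + h \<le> b \<and> f (t + h) \<le> f t"
  shows "f b \<le> f a"
proof (rule ccontr)
  assume "\<not> f b \<le> f a"
  then have lt: "f a < f b" by simp
  have "\<not> {f a<..<f b} \<subseteq> f ` N"
  proof
    assume "{f a<..<f b} \<subseteq> f ` N"
    then have "negligible {f a<..<f b}" using N negligible_subset by blast
    then have "box (f a) (f b) = {}" using negligible_interval(2)[of "f a" "f b"] by (simp only: box_real)
    then show False using lt by (simp add: box_real)
  qed
  then obtain y where y: "f a < y" "y < f b" "y \<notin> f ` N"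
    by (meson greaterThanLessThan_iff subsetI)
  define S where "S = {a..b} \<inter> f -` {..y}"
  have "closed S" unfolding S_def
    by (rule continuous_closed_preimage[OF cont]) auto
  moreover have "bounded S" unfolding S_def by (rule bounded_subset[of "{a..b}"]) auto
  ultimately have "compact S" by (simp add: compact_eq_bounded_closed)
  moreover have "a \<in> S" using \<open>a \<le> b\<close> y by (auto simp: S_def)
  ultimately obtain t where t: "t \<in> S" "\<And>s. s \<in> S \<Longrightarrow> s \<le> t"
    using compact_attains_sup[of S] by (metis empty_iff)
  have tab: "t \<in> {a..b}" "f t \<le> y" using t by (auto simp: S_def)
  then have "t < b" using y by (cases "t = b") auto
  have "f t = y"
  proof (rule ccontr)
    assume "f t \<noteq> y"
    then have "f t < y" using tab by simp
    moreover have "continuous_on {t..b} f" using cont by (rule continuous_on_subset) (use tab in auto)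
    ultimately obtain s where s: "t \<le> s" "s \<le> b" "f s = y" using IVT'[of f t y b] y \<open>t < b\<close> by auto
    then have "s \<in> S" using tab by (auto simp: S_def)
    then have "s = t" using t s by force
    then show False using \<open>f t < y\<close> s by simp
  qed
  then have "t \<notin> N" using y by auto
  then obtain h where "h > 0" "t + h \<le> b" "f (t + h) \<le> f t" using step \<open>t < b\<close> tab by auto
  then have "t + h \<in> S" using \<open>f t = y\<close> tab by (auto simp: S_def)
  then show False using t(2)[of "t+h"] \<open>h > 0\<close> by simp
qed

text \<open>\<open>Dini_nonincreasing\<close> applied to
  \<open>norm (f t - f a) - (c + e) * (t - a)\<close>. Only one admissible \<open>h\<close> is asked
  for at each time, that is, a bound on a lower derivative; the first order estimate for the flow
  provides no more than that.\<close>

lemma lipschitz_increment_le: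
  fixes f :: "real \<Rightarrow> 'b::real_normed_vector"
  assumes "a \<le> b" and lip: "K-lipschitz_on {a..b} f" and N: "negligible N"
    and step: "\<And>t e. t \<in> {a..<b} \<Longrightarrow> t \<notin> N \<Longrightarrow> e > 0 \<Longrightarrow>
       \<exists>h>0. t + h \<le> b \<and> norm (f (t + h) - f t) \<le> (c + e) * h"
  shows "norm (f b - f a) \<le> c * (b - a)"
proof -
  have "norm (f b - f a) \<le> c * (b - a) + e * (b - a)" if e: "e > 0" for e
  proof -
    define \<psi> where "\<psi> t = norm (f t - f a) - (c + e) * (t - a)" for t
    have L: "(K + \<bar>c + e\<bar>)-lipschitz_on {a..b} \<psi>"
    proof (rule lipschitz_onI)
      fix s t assume st: "s \<in> {a..b}" "t \<in> {a..b}"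
      have "\<bar>norm (f s - f a) - norm (f t - f a)\<bar> \<le> norm (f s - f t)"
        using norm_triangle_ineq3[of "f s - f a" "f t - f a"] by simp
      also have "\<dots> \<le> K * \<bar>s - t\<bar>" using lipschitz_onD[OF lip st] by (simp add: dist_norm)
      moreover have "\<bar>(c+e)*(s-a) - (c+e)*(t-a)\<bar> = \<bar>c+e\<bar> * \<bar>s-t\<bar>"
        by (simp add: abs_mult[symmetric] algebra_simps)
      ultimately show "dist (\<psi> s) (\<psi> t) \<le> (K + \<bar>c + e\<bar>) * dist s t"
        unfolding \<psi>_def dist_real_def distrib_right by linarith
    qed (use lipschitz_on_nonneg[OF lip] in auto)
    have "\<psi> b \<le> \<psi> a"
    proof (rule Dini_nonincreasing[OF \<open>a \<le> b\<close> lipschitz_on_continuous_on[OF L], of "N \<inter> {a..b}"])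
      show "negligible (\<psi> ` (N \<inter> {a..b}))"
        by (rule negligible_lipschitz_image[OF _ lipschitz_on_subset[OF L]]) (use N negligible_Int in auto)
      fix t assume t: "t \<in> {a..<b}" "t \<notin> N \<inter> {a..b}"
      then have "t \<notin> N" by auto
      then obtain h where h: "h > 0" "t + h \<le> b" "norm (f (t + h) - f t) \<le> (c + e) * h" using step t e by blast
      have "norm (f (t+h) - f a) \<le> norm (f (t + h) - f t) + norm (f t - f a)"
        using norm_triangle_ineq[of "f (t+h) - f t" "f t - f a"] by simp
      then have "\<psi> (t+h) \<le> \<psi> t" using h(3) unfolding \<psi>_def by (simp add: algebra_simps)
      then show "\<exists>h>0. t + h \<le> b \<and> \<psi> (t + h) \<le> \<psi> t" using h by blast
    qed
    then show ?thesis by (simp add: \<psi>_def algebra_simps)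
  qed
  note * = this
  show ?thesis
  proof (cases "a = b")
    case False
    then have "b - a > 0" using \<open>a \<le> b\<close> by simp
    show ?thesis
    proof (rule field_le_epsilon)
      fix e :: real assume "e > 0"
      then show "norm (f b - f a) \<le> c * (b - a) + e"
        using *[of "e / (b - a)"] \<open>b - a > 0\<close> by simp
    qed
  qed simp
qed

lemma lipschitz_AE_deriv_bound:
  fixes f :: "real \<Rightarrow> 'b::real_normed_vector"
  assumes "a \<le> b" and lip: "K-lipschitz_on {a..b} f" and N: "negligible N"
    and deriv: "\<And>t. t \<in> {a<..<b} \<Longrightarrow> t \<notin> N \<Longrightarrow> \<exists>D. (f has_vector_derivative D) (at t) \<and> norm D \<le> c"
  shows "norm (f b - f a) \<le> c * (b - a)"
proof (rule lipschitz_increment_le[OF assms(1,2), of "insert a N"])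
  fix t e :: real assume t: "t \<in> {a..<b}" "t \<notin> insert a N" "e > 0"
  then obtain D where D: "(f has_vector_derivative D) (at t)" "norm D \<le> c" using deriv[of t] by auto
  then obtain d where d: "d > 0" "\<And>y. norm (y - t) < d \<Longrightarrow> norm (f y - f t - (y - t) *\<^sub>R D) \<le> e * norm (y - t)"
    using \<open>e > 0\<close> unfolding has_vector_derivative_def has_derivative_at_alt by blast
  define h where "h = min (d/2) (b - t)"
  have h: "h > 0" "h < d" "t + h \<le> b" using d t by (auto simp: h_def)
  have "norm (f (t+h) - f t - h *\<^sub>R D) \<le> e * h" using d(2)[of "t+h"] h by simp
  moreover have "norm (f (t+h) - f t) \<le> norm (f (t+h) - f t - h *\<^sub>R D) + norm (h *\<^sub>R D)"
    using norm_triangle_ineq[of "f (t+h) - f t - h *\<^sub>R D" "h *\<^sub>R D"] by simp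
  moreover have "norm (h *\<^sub>R D) \<le> c * h" using D(2) h by (simp add: mult.commute)
  ultimately have "norm (f (t + h) - f t) \<le> (c + e) * h"
    unfolding distrib_right by linarith
  then show "\<exists>h>0. t + h \<le> b \<and> norm (f (t + h) - f t) \<le> (c + e) * h"
    using h by blast
qed (use N in auto)

section \<open>Null sets along one-parameter families of maps\<close>

lemma negligible_borel_superset:
  assumes "negligible (N :: 'a::euclidean_space set)"
  obtains N' where "N \<subseteq> N'" "N' \<in> sets borel" "negligible N'" "N' \<in> null_sets lborel"
proof -
  have "N \<in> null_sets (completion lborel)" using assms by (simp add: negligible_iff_null_sets)
  then obtain N' where "N' \<in> null_sets lborel" "N \<subseteq> N'" unfolding null_sets_completion_iff2 by auto
  then show ?thesis using that[of N'] null_sets_completionI[of N' lborel]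
    by (auto simp: negligible_iff_null_sets null_sets_def)
qed

text \<open>Fubini on the pairs \<open>(t, x)\<close>: each time slice is null by
  \<open>pre\<close>, hence almost every section in \<open>t\<close> is null. The set
  \<open>N\<close> is first enlarged to a Borel null set because the exchange needs joint
  measurability. Only \<open>t > 0\<close> is considered since the rays used later collapse at
  \<open>t = 0\<close>.\<close>

lemma AE_negligible_family:
  fixes T :: "real \<Rightarrow> 'a::euclidean_space \<Rightarrow> 'a"
  assumes N: "negligible N" and meas: "(\<lambda>(t, x). T t x) \<in> borel_measurable (borel \<Otimes>\<^sub>M borel)"
    and pre: "\<And>t N'. negligible N' \<Longrightarrow> t > 0 \<Longrightarrow> negligible {x. T t x \<in> N'}"
  shows "AE x in lborel. negligible {t. t > 0 \<and> T t x \<in> N}"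
proof -
  obtain N' where N': "N \<subseteq> N'" "N' \<in> sets borel" "negligible N'"
    using negligible_borel_superset[OF N] by metis
  have m: "Measurable.pred (lborel \<Otimes>\<^sub>M lborel) (\<lambda>z. \<not> (fst z > (0::real) \<and> T (fst z) (snd z) \<in> N'))"
  proof -
    have "(\<lambda>z. T (fst z) (snd z)) \<in> borel_measurable (lborel \<Otimes>\<^sub>M lborel)"
      using meas by (simp add: case_prod_beta' cong: measurable_cong_sets sets_pair_measure_cong)
    moreover have "Measurable.pred borel (\<lambda>x. x \<in> N')" using N' by simp
    ultimately have "Measurable.pred (lborel \<Otimes>\<^sub>M lborel) (\<lambda>z. T (fst z) (snd z) \<in> N')"
      by (rule measurable_compose)
    then show ?thesis by measurable
  qed
  have "AE t in lborel. AE x in lborel. \<not> (t > (0::real) \<and> T t x \<in> N')"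
  proof (rule AE_I2)
    fix t :: real
    have "negligible {x. t > 0 \<and> T t x \<in> N'}" using pre[OF N'(3), of t] by (cases "t > 0") auto
    then have "AE x in lebesgue. \<not> (t > (0::real) \<and> T t x \<in> N')"
      by (auto simp: negligible_iff_null_sets intro: AE_I')
    then show "AE x in lborel. \<not> (t > (0::real) \<and> T t x \<in> N')" by (simp add: AE_completion_iff)
  qed
  then have "AE x in lborel. AE t in lborel. \<not> (t > (0::real) \<and> T t x \<in> N')"
    using lborel_pair.AE_commute[of "\<lambda>t x. \<not> (t > (0::real) \<and> T t x \<in> N')"] m by (simp add: pred_def)
  then show ?thesis
  proof (rule AE_mp, intro AE_I2 impI)
    fix x assume "AE t in lborel. \<not> (t > (0::real) \<and> T t x \<in> N')"
    then have "AE t in lebesgue. \<not> (t > (0::real) \<and> T t x \<in> N')" by (rule AE_completion)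
    then have "negligible {t. t > (0::real) \<and> T t x \<in> N'}"
      by (auto simp: negligible_iff_null_sets eventually_ae_filter intro: null_sets_completion_subset)
    then show "negligible {t. t > (0::real) \<and> T t x \<in> N}" by (rule negligible_subset) (use N' in auto)
  qed
qed

section \<open>Almost everywhere differentiability on the line\<close>

text \<open>Intervals on which \<open>\<nu>\<close> is at most \<open>c\<close> times
  \<open>\<mu>\<close> form a Vitali cover of \<open>E\<close> inside an open \<open>U\<close> of
  nearly the same \<open>\<mu>\<close>-measure. Countably many disjoint ones exhaust
  \<open>E\<close> up to a Lebesgue null set, which \<open>\<nu>\<close> ignores by
  \<open>ac\<close>, and the inequality is summed over them.\<close>

lemma emeasure_le_Vitali:
  fixes \<mu> \<nu> :: "real measure"
  assumes sets: "sets \<mu> = sets borel" "sets \<nu> = sets borel"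
    and ac: "\<And>N. N \<in> null_sets lborel \<Longrightarrow> emeasure \<nu> N = 0"
    and E: "E \<in> sets borel"
    and outer: "\<And>e. e > 0 \<Longrightarrow> \<exists>U. open U \<and> E \<subseteq> U \<and> emeasure \<mu> U \<le> emeasure \<mu> E + ennreal e"
    and c: "c \<ge> 0"
    and fine: "\<And>x d. x \<in> E \<Longrightarrow> d > 0 \<Longrightarrow>
      \<exists>a b. a < b \<and> x \<in> {a..b} \<and> b - a < d \<and> emeasure \<nu> {a..b} \<le> ennreal c * emeasure \<mu> {a..b}"
  shows "emeasure \<nu> E \<le> ennreal c * emeasure \<mu> E"
proof (rule ennreal_le_epsilon)
  fix e :: real assume "e > 0"
  \<comment> \<open>Dividing by \<open>c + 1\<close> rather than \<open>c\<close> covers the case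
    \<open>c = 0\<close>.\<close>
  then have e': "e / (c + 1) > 0" using c by simp
  obtain U where U: "open U" "E \<subseteq> U" "emeasure \<mu> U \<le> emeasure \<mu> E + ennreal (e / (c + 1))"
    using outer[OF e'] by auto
  define I where "I i = {fst i..snd i}" for i :: "real \<times> real"
  define K where "K = {i. fst i < snd i \<and> I i \<subseteq> U \<and> emeasure \<nu> (I i) \<le> ennreal c * emeasure \<mu> (I i)}"
  define ctr where "ctr i = (fst i + snd i) / 2" for i :: "real \<times> real"
  define rad where "rad i = (snd i - fst i) / 2" for i :: "real \<times> real"
  have cball: "cball (ctr i) (rad i) = I i" for i
    by (auto simp: cball_eq_atLeastAtMost ctr_def rad_def I_def field_simps)
  have r: "0 < rad i" if "i \<in> K" for i using that by (simp add: K_def rad_def)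
  have S: "\<exists>i. i \<in> K \<and> x \<in> cball (ctr i) (rad i) \<and> rad i < d" if x: "x \<in> E" and d: "d > 0" for x d
  proof -
    obtain d' where d': "d' > 0" "ball x d' \<subseteq> U" using U x open_contains_ball by blast
    obtain a b where ab: "a < b" "x \<in> {a..b}" "b - a < min d d'" "emeasure \<nu> {a..b} \<le> ennreal c * emeasure \<mu> {a..b}"
      using fine[OF x, of "min d d'"] d d' by auto
    have "{a..b} \<subseteq> ball x d'" using ab by (auto simp: dist_real_def)
    then have "(a, b) \<in> K" using ab d' by (auto simp: K_def I_def)
    moreover have "x \<in> I (a, b)" using ab by (simp add: I_def)
    moreover have "rad (a, b) < d" using ab by (auto simp: rad_def)
    ultimately show ?thesis unfolding cball by blast
  qed
  obtain C where C: "countable C" "C \<subseteq> K"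
     "pairwise (\<lambda>i j. disjnt (cball (ctr i) (rad i)) (cball (ctr j) (rad j))) C"
     "negligible (E - (\<Union>i \<in> C. cball (ctr i) (rad i)))"
    using Vitali_covering_theorem_cballs[OF r S] by blast
  have Im: "I i \<in> sets borel" for i by (simp add: I_def)
  define A where "A = (\<Union>i\<in>C. I i)"
  have A: "A \<in> sets borel" unfolding A_def by (intro sets.countable_UN' C) (auto simp: I_def)
  have disj: "disjoint_family_on I C"
    using C(3) unfolding cball by (auto simp: disjoint_family_on_def pairwise_def disjnt_def)
  have neg: "negligible (E - A)" using C(4) unfolding cball A_def .
  then have "E - A \<in> null_sets lborel"
    using A E null_sets_completion_iff[of "E - A" lborel] by (simp add: negligible_iff_null_sets)
  then have 0: "emeasure \<nu> (E - A) = 0" by (rule ac)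
  have "emeasure \<nu> E \<le> emeasure \<nu> ((E - A) \<union> A)"
    by (rule emeasure_mono) (use A E sets in auto)
  also have "\<dots> \<le> emeasure \<nu> (E - A) + emeasure \<nu> A"
    by (rule emeasure_subadditive) (use A E sets in auto)
  also have "\<dots> = emeasure \<nu> A" using 0 by simp
  also have "\<dots> = (\<integral>\<^sup>+i. emeasure \<nu> (I i) \<partial>count_space C)"
    unfolding A_def by (rule emeasure_UN_countable) (use C disj sets Im in auto)
  also have "\<dots> \<le> (\<integral>\<^sup>+i. ennreal c * emeasure \<mu> (I i) \<partial>count_space C)"
    by (rule nn_integral_mono) (use C(2) in \<open>auto simp: K_def\<close>)
  also have "\<dots> = ennreal c * (\<integral>\<^sup>+i. emeasure \<mu> (I i) \<partial>count_space C)"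
    by (rule nn_integral_cmult) auto
  also have "(\<integral>\<^sup>+i. emeasure \<mu> (I i) \<partial>count_space C) = emeasure \<mu> A"
    unfolding A_def by (rule emeasure_UN_countable[symmetric]) (use C disj sets Im in auto)
  also have "emeasure \<mu> A \<le> emeasure \<mu> U"
    by (rule emeasure_mono) (use C(2) U sets in \<open>auto simp: A_def K_def\<close>)
  also have "emeasure \<mu> U \<le> emeasure \<mu> E + ennreal (e / (c + 1))" by (rule U(3))
  finally have "emeasure \<nu> E \<le> ennreal c * (emeasure \<mu> E + ennreal (e / (c + 1)))"
    by (simp add: mult_left_mono)
  also have "\<dots> = ennreal c * emeasure \<mu> E + ennreal (c * (e / (c + 1)))"
    using c \<open>e > 0\<close> by (simp add: distrib_left ennreal_mult[symmetric])
  also have "\<dots> \<le> ennreal c * emeasure \<mu> E + ennreal e"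
    using c \<open>e > 0\<close> by (intro add_left_mono ennreal_leI) (simp add: field_simps)
  finally show "emeasure \<nu> E \<le> ennreal c * emeasure \<mu> E + ennreal e" .
qed

lemma lborel_outer_open:
  fixes E :: "'a::euclidean_space set"
  assumes "E \<in> sets borel" "e > 0"
  obtains U where "open U" "E \<subseteq> U" "emeasure lborel (U - E) < ennreal e"
proof -
  have "E \<in> sets lebesgue" using assms by auto
  then obtain U where "open U" "E \<subseteq> U" "emeasure lebesgue (U - E) < ennreal e"
    using sets_lebesgue_outer_open assms(2) by metis
  then show ?thesis using that assms by simp
qed

text \<open>A chord of slope below \<open>p\<close> with one end at \<open>x\<close> keeps that
  bound when the end is pushed slightly past \<open>x\<close>. Having \<open>x\<close> strictly
  inside turns the set of points with such chords into a union of open intervals, which settles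
  measurability.\<close>

lemma isCont_straddle:
  fixes f :: "real \<Rightarrow> real"
  assumes "isCont f x" "h \<noteq> 0" "\<bar>h\<bar> < d" "(f (x + h) - f x) / h < p"
  shows "\<exists>a b. a < x \<and> x < b \<and> b - a < d \<and> f b - f a < p * (b - a)"
proof (cases "h > 0")
  case True
  have "((\<lambda>a. f (x + h) - f a - p * (x + h - a)) \<longlongrightarrow> f (x + h) - f x - p * (x + h - x)) (at_left x)"
    using assms(1) unfolding isCont_def by (intro tendsto_intros) (auto intro: filterlim_at_split[THEN iffD1, THEN conjunct1])
  moreover have "f (x + h) - f x - p * (x + h - x) < 0" using assms(4) True by (simp add: field_simps)
  ultimately have "\<forall>\<^sub>F a in at_left x. f (x + h) - f a - p * (x + h - a) < 0" by (rule order_tendstoD)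
  moreover have "\<forall>\<^sub>F a in at_left x. a \<in> {x + h - d<..<x}"
    by (rule eventually_at_leftI[of "x + h - d"]) (use assms True in auto)
  ultimately have "\<forall>\<^sub>F a in at_left x. f (x + h) - f a - p * (x + h - a) < 0 \<and> a \<in> {x + h - d<..<x}"
    by (rule eventually_conj)
  then obtain a where "f (x + h) - f a - p * (x + h - a) < 0" "a \<in> {x + h - d<..<x}"
    using eventually_happens'[of "at_left x"] by (metis (no_types, lifting) trivial_limit_at_left_real)
  then show ?thesis using True by (intro exI[of _ a] exI[of _ "x + h"]) auto
next
  case False
  then have h: "h < 0" using assms by simp
  have "((\<lambda>b. f b - f (x + h) - p * (b - (x + h))) \<longlongrightarrow> f x - f (x + h) - p * (x - (x + h))) (at_right x)"
    using assms(1) unfolding isCont_def by (intro tendsto_intros) (auto intro: filterlim_at_split[THEN iffD1, THEN conjunct2])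
  moreover have "f x - f (x + h) - p * (x - (x + h)) < 0" using assms(4) h by (simp add: field_simps)
  ultimately have "\<forall>\<^sub>F b in at_right x. f b - f (x + h) - p * (b - (x + h)) < 0" by (rule order_tendstoD)
  moreover have "\<forall>\<^sub>F b in at_right x. b \<in> {x<..<x + h + d}"
    by (rule eventually_at_rightI[of _ "x + h + d"]) (use assms h in auto)
  ultimately have "\<forall>\<^sub>F b in at_right x. f b - f (x + h) - p * (b - (x + h)) < 0 \<and> b \<in> {x<..<x + h + d}"
    by (rule eventually_conj)
  then obtain b where "f b - f (x + h) - p * (b - (x + h)) < 0" "b \<in> {x<..<x + h + d}"
    using eventually_happens'[of "at_right x"] by (metis (no_types, lifting) trivial_limit_at_right_real)
  then show ?thesis using h by (intro exI[of _ "x + h"] exI[of _ b]) auto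
qed

text \<open>Were the lower limit of the slopes below the upper one, two rationals strictly between
  them would contradict \<open>sep\<close>; boundedness makes the common limit finite. With rational
  thresholds only countably many exceptional sets arise later.\<close>

lemma bounded_slopes_differentiable:
  fixes f :: "real \<Rightarrow> real"
  assumes bd: "\<And>h. h \<noteq> 0 \<Longrightarrow> \<bar>(f (x + h) - f x) / h\<bar> \<le> M"
    and sep: "\<And>p q. p \<in> \<rat> \<Longrightarrow> q \<in> \<rat> \<Longrightarrow> p < q \<Longrightarrow>
      \<exists>d>0. (\<forall>h. h \<noteq> 0 \<longrightarrow> \<bar>h\<bar> < d \<longrightarrow> (f (x + h) - f x) / h \<ge> p) \<or>
            (\<forall>h. h \<noteq> 0 \<longrightarrow> \<bar>h\<bar> < d \<longrightarrow> (f (x + h) - f x) / h \<le> q)"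
  shows "f differentiable (at x)"
proof -
  define s where "s h = (f (x + h) - f x) / h" for h
  define l where "l = Liminf (at 0) (\<lambda>h. ereal (s h))"
  define u where "u = Limsup (at 0) (\<lambda>h. ereal (s h))"
  have nt: "at (0::real) \<noteq> bot" by simp
  have sM: "\<forall>\<^sub>F h in at 0. \<bar>s h\<bar> \<le> M"
    unfolding eventually_at s_def using bd by (intro exI[of _ 1]) simp
  have lM: "ereal (-M) \<le> l"
    unfolding l_def by (rule Liminf_bounded, rule eventually_mono[OF sM]) (simp add: abs_le_iff)
  have uM: "u \<le> ereal M"
    unfolding u_def by (rule Limsup_bounded, rule eventually_mono[OF sM]) (simp add: abs_le_iff)
  have lu: "l \<le> u" unfolding l_def u_def by (rule Liminf_le_Limsup[OF nt])
  have "\<not> l < u"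
  proof
    assume "l < u"
    then obtain m where m: "l < ereal m" "ereal m < u" using ereal_dense2 by blast
    obtain q0 where q0: "ereal m < ereal q0" "ereal q0 < u" using ereal_dense2[OF m(2)] by blast
    obtain p0 where p0: "l < ereal p0" "ereal p0 < ereal m" using ereal_dense2[OF m(1)] by blast
    obtain p where p: "p \<in> \<rat>" "p0 < p" "p < m" using Rats_dense_in_real[of p0 m] p0 by auto
    obtain q where q: "q \<in> \<rat>" "m < q" "q < q0" using Rats_dense_in_real[of m q0] q0 by auto
    obtain d where "d > 0" and d: "(\<forall>h. h \<noteq> 0 \<longrightarrow> \<bar>h\<bar> < d \<longrightarrow> s h \<ge> p) \<or>
            (\<forall>h. h \<noteq> 0 \<longrightarrow> \<bar>h\<bar> < d \<longrightarrow> s h \<le> q)"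
      using sep[OF p(1) q(1)] p q unfolding s_def by auto
    from d show False
    proof
      assume "\<forall>h. h \<noteq> 0 \<longrightarrow> \<bar>h\<bar> < d \<longrightarrow> s h \<ge> p"
      then have "\<forall>\<^sub>F h in at 0. ereal p \<le> ereal (s h)"
        using \<open>d > 0\<close> by (auto simp: eventually_at dist_real_def)
      then have "ereal p \<le> l" unfolding l_def by (rule Liminf_bounded)
      then have "ereal p < ereal p0" using p0(1) by (rule le_less_trans)
      then show False using p by simp
    next
      assume "\<forall>h. h \<noteq> 0 \<longrightarrow> \<bar>h\<bar> < d \<longrightarrow> s h \<le> q"
      then have "\<forall>\<^sub>F h in at 0. ereal (s h) \<le> ereal q"
        using \<open>d > 0\<close> by (auto simp: eventually_at dist_real_def)
      then have "u \<le> ereal q" unfolding u_def by (rule Limsup_bounded)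
      with q0(2) have "ereal q0 < ereal q" by (rule less_le_trans)
      then show False using q by simp
    qed
  qed
  then have eq: "l = u" using lu by simp
  have "\<bar>l\<bar> \<noteq> \<infinity>" using lM uM eq by (cases l) auto
  then obtain D where D: "l = ereal D" by (cases l) auto
  have "((\<lambda>h. ereal (s h)) \<longlongrightarrow> ereal D) (at 0)"
    using eq D unfolding l_def u_def by (intro Liminf_eq_Limsup) auto
  then have "(s \<longlongrightarrow> D) (at 0)" by simp
  then have "DERIV f x :> D" unfolding DERIV_def s_def .
  then show ?thesis by (auto simp: real_differentiable_def)
qed

lemma lborel_outer_open_density:
  assumes sets: "sets \<mu> = sets borel" and M: "M > 0"
    and le: "\<And>A. A \<in> sets borel \<Longrightarrow> emeasure \<mu> A \<le> ennreal M * emeasure lborel A"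
    and E: "E \<in> sets borel" and "e > 0"
  shows "\<exists>U. open U \<and> E \<subseteq> U \<and> emeasure \<mu> U \<le> emeasure \<mu> E + ennreal e"
proof -
  obtain U where U: "open U" "E \<subseteq> U" "emeasure lborel (U - E) < ennreal (e / M)"
    using lborel_outer_open[OF E, of "e / M"] M \<open>e > 0\<close> by auto
  have "emeasure \<mu> (U - E) \<le> ennreal M * emeasure lborel (U - E)" by (rule le) (use U E in auto)
  also have "\<dots> \<le> ennreal M * ennreal (e / M)" using U by (intro mult_left_mono) auto
  also have "\<dots> = ennreal e" using M \<open>e > 0\<close> by (simp add: ennreal_mult[symmetric])
  finally have "emeasure \<mu> (U - E) \<le> ennreal e" .
  moreover have "emeasure \<mu> U \<le> emeasure \<mu> E + emeasure \<mu> (U - E)"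
    using emeasure_subadditive[of E \<mu> "U - E"] U E sets by (auto simp: Un_absorb1)
  ultimately have "emeasure \<mu> U \<le> emeasure \<mu> E + ennreal e"
    by (meson add_left_mono order_trans)
  then show ?thesis using U by blast
qed

text \<open>Lebesgue's argument with the Stieltjes measure \<open>\<nu>\<close> of \<open>f\<close>.
  On a set \<open>E\<close> where arbitrarily short chords of slope below \<open>p\<close> and above
  \<open>q > p\<close> both occur, Vitali gives \<open>\<nu>(E) <= p |E|\<close> and
  \<open>|E| <= \<nu>(E) / q\<close>, so \<open>|E| <= (p / q) |E|\<close> and \<open>E\<close> is
  null. Slopes of at least one make \<open>f\<close> invertible, so that \<open>\<nu>\<close> is
  simply an image of Lebesgue measure.\<close>

lemma bilipschitz_increasing_AE_differentiable:
  fixes f :: "real \<Rightarrow> real"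
  assumes lower: "\<And>x y. x < y \<Longrightarrow> y - x \<le> f y - f x"
    and upper: "\<And>x y. x < y \<Longrightarrow> f y - f x \<le> M * (y - x)"
  shows "negligible {x. \<not> f differentiable (at x)}"
proof -
  have M: "M \<ge> 1" using lower[of 0 1] upper[of 0 1] by simp
  have lipf: "M-lipschitz_on UNIV f"
  proof (rule lipschitz_onI)
    fix x y :: real
    show "dist (f x) (f y) \<le> M * dist x y"
      using lower[of x y] upper[of x y] lower[of y x] upper[of y x]
      by (cases x y rule: linorder_cases) (auto simp: dist_real_def)
  qed (use M in auto)
  have contf: "isCont f x" for x
    using lipschitz_on_continuous_on[OF lipf] by (simp add: continuous_on_eq_continuous_at)
  have inj: "inj f"
    by (rule linorder_injI) (use lower in force)
  have le_iff: "f x \<le> f y \<longleftrightarrow> x \<le> y" for x y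
    using lower[of x y] lower[of y x] by (cases x y rule: linorder_cases) auto
  have surj: "\<exists>x. f x = y" for y
  proof -
    define k where "k = \<bar>y - f 0\<bar> + 1"
    have "k > 0" by (simp add: k_def)
    have "f (-k) \<le> y" using lower[of "-k" 0] \<open>k > 0\<close> by (simp add: k_def)
    moreover have "y \<le> f k" using lower[of 0 k] \<open>k > 0\<close> by (simp add: k_def)
    ultimately show ?thesis
      using IVT'[of f "-k" y k] \<open>k > 0\<close> contf by (auto simp: continuous_at_imp_continuous_on)
  qed
  define g where "g = inv f"
  have fg: "f (g y) = y" for y unfolding g_def by (metis surj f_inv_into_f rangeI)
  have gf: "g (f x) = x" for x unfolding g_def using inj by simp
  have img: "g -` A = f ` A" for A by (auto simp: image_iff gf) (metis fg)
  have "mono g" by (rule monoI) (metis fg le_iff)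
  then have gm: "g \<in> borel_measurable borel" by (rule borel_measurable_mono)
  \<comment> \<open>The inverse \<open>g\<close> pushes Lebesgue measure to the measure that gives
    \<open>{a..b}\<close> the mass \<open>f b - f a\<close>.\<close>
  define \<nu> where "\<nu> = distr lborel borel g"
  have \<nu>: "emeasure \<nu> A = emeasure lborel (f ` A)" if "A \<in> sets borel" for A
  proof -
    have "g -` A = f ` A" by (rule img)
    then show ?thesis unfolding \<nu>_def using that gm by (simp add: emeasure_distr)
  qed
  have sets\<nu>: "sets \<nu> = sets borel" by (simp add: \<nu>_def)
  have \<nu>I: "emeasure \<nu> {a..b} = ennreal (f b - f a)" if "a < b" for a b
  proof -
    have "f ` {a..b} = {f a..f b}"
    proof
      show "{f a..f b} \<subseteq> f ` {a..b}" using surj le_iff by (metis atLeastAtMost_iff image_eqI subsetI)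
    qed (auto simp: le_iff)
    then show ?thesis using \<nu>[of "{a..b}"] lower[OF that] that by simp
  qed
  have \<nu>0: "emeasure \<nu> N = 0" if N: "N \<in> null_sets lborel" for N
  proof -
    have Nb: "N \<in> sets borel" using N by auto
    have "negligible N" using null_sets_completionI[OF N] by (simp add: negligible_iff_null_sets)
    then have "negligible (f ` N)" using lipf lipschitz_on_subset negligible_lipschitz_image by blast
    moreover have "f ` N \<in> sets borel"
    proof -
      have "g -` N = f ` N" by (rule img)
      then show ?thesis using measurable_sets[OF gm Nb] by simp
    qed
    ultimately show ?thesis using \<nu>[OF Nb] by (simp add: negligible_iff_emeasure0)
  qed
  have lb_outer: "\<exists>U. open U \<and> E \<subseteq> U \<and> emeasure lborel U \<le> emeasure lborel E + ennreal e"
    if "E \<in> sets borel" "e > 0" for E :: "real set" and e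
    by (rule lborel_outer_open_density[of _ 1]) (use that in auto)
  \<comment> \<open>This domination is itself a Vitali estimate in which every interval is
    admissible; it serves to approximate sets from outside by open sets with respect to
    \<open>\<nu>\<close>.\<close>
  have \<nu>M: "emeasure \<nu> A \<le> ennreal M * emeasure lborel A" if A: "A \<in> sets borel" for A
  proof (rule emeasure_le_Vitali[OF _ sets\<nu> \<nu>0 A lb_outer[OF A]])
    fix x d :: real assume "d > 0"
    have "emeasure \<nu> {x..x+d/2} \<le> ennreal M * emeasure lborel {x..x+d/2}"
      using \<nu>I[of x "x+d/2"] upper[of x "x+d/2"] \<open>d > 0\<close> M
      by (simp add: ennreal_mult[symmetric] ennreal_leI)
    then show "\<exists>a b. a < b \<and> x \<in> {a..b} \<and> b - a < d \<and> emeasure \<nu> {a..b} \<le> ennreal M * emeasure lborel {a..b}"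
      using \<open>d > 0\<close> by (intro exI[of _ x] exI[of _ "x+d/2"]) auto
  qed (use M in auto)
  have \<nu>_outer: "\<exists>U. open U \<and> E \<subseteq> U \<and> emeasure \<nu> U \<le> emeasure \<nu> E + ennreal e"
    if "E \<in> sets borel" "e > 0" for E :: "real set" and e
    by (rule lborel_outer_open_density[OF sets\<nu> _ \<nu>M that]) (use M in auto)
  \<comment> \<open>Points with arbitrarily short chords of property \<open>P\<close> around them: a
    countable intersection of unions of open intervals, hence Borel for an arbitrary predicate
    \<open>P\<close>.\<close>
  define S where "S P = {x. \<forall>n. \<exists>a b. a < x \<and> x < b \<and> b - a < inverse (real (Suc n)) \<and> P a b}" for P
  have Sb: "S P \<in> sets borel" for P
  proof -
    have "S P = (\<Inter>n. \<Union>(a,b)\<in>{(a,b). b - a < inverse (real (Suc n)) \<and> P a b}. {a<..<b})"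
      by (simp add: S_def set_eq_iff) blast
    also have "\<dots> \<in> sets borel" by (intro sets.countable_INT'' borel_open open_UN) auto
    finally show ?thesis .
  qed
  have SD: "\<exists>a b. a < b \<and> x \<in> {a..b} \<and> b - a < d \<and> P a b" if xS: "x \<in> S P" and "d > 0" for x d P
  proof -
    obtain n where n: "inverse (real (Suc n)) < d" using reals_Archimedean[OF \<open>d > 0\<close>] by blast
    obtain a b where "a < x" "x < b" "b - a < inverse (real (Suc n))" "P a b" using xS unfolding S_def by blast
    then show ?thesis using n by (intro exI[of _ a] exI[of _ b]) auto
  qed
  define Lo where "Lo p = S (\<lambda>a b. f b - f a < p * (b - a))" for p
  define Hi where "Hi p = S (\<lambda>a b. f b - f a > p * (b - a))" for p
  have neg: "negligible (Lo p \<inter> Hi q \<inter> {-real n..real n})" if "p < q" for p q n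
  proof (cases "p > 0")
    case False
    have "Lo p = {}"
    proof (rule ccontr)
      assume "Lo p \<noteq> {}"
      then obtain x where "x \<in> Lo p" by auto
      then obtain a b where "a < b" "f b - f a < p * (b - a)" using SD[of x "\<lambda>a b. f b - f a < p * (b - a)" 1] unfolding Lo_def by auto
      moreover have "p * (b - a) \<le> 0" using False \<open>a < b\<close> by (simp add: mult_nonpos_nonneg)
      ultimately show False using lower[of a b] by simp
    qed
    then show ?thesis by simp
  next
    case True
    define E where "E = Lo p \<inter> Hi q \<inter> {-real n..real n}"
    have E: "E \<in> sets borel" unfolding E_def Lo_def Hi_def using Sb by auto
    have "emeasure \<nu> E \<le> ennreal p * emeasure lborel E"
    proof (rule emeasure_le_Vitali[OF _ sets\<nu> \<nu>0 E lb_outer[OF E]])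
      fix x d :: real assume "x \<in> E" "d > 0"
      then obtain a b where ab: "a < b" "x \<in> {a..b}" "b - a < d" "f b - f a < p * (b - a)"
        using SD[of x "\<lambda>a b. f b - f a < p * (b - a)" d] unfolding E_def Lo_def by blast
      then have "emeasure \<nu> {a..b} \<le> ennreal p * emeasure lborel {a..b}"
        using \<nu>I[of a b] True by (simp add: ennreal_mult[symmetric] ennreal_leI)
      then show "\<exists>a b. a < b \<and> x \<in> {a..b} \<and> b - a < d \<and> emeasure \<nu> {a..b} \<le> ennreal p * emeasure lborel {a..b}"
        using ab by blast
    qed (use True in auto)
    moreover have "emeasure lborel E \<le> ennreal (1/q) * emeasure \<nu> E"
    proof (rule emeasure_le_Vitali[OF sets\<nu> _ _ E \<nu>_outer[OF E]])
      fix x d :: real assume "x \<in> E" "d > 0"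
      then obtain a b where ab: "a < b" "x \<in> {a..b}" "b - a < d" "f b - f a > q * (b - a)"
        using SD[of x "\<lambda>a b. f b - f a > q * (b - a)" d] unfolding E_def Hi_def by blast
      then have "emeasure lborel {a..b} \<le> ennreal (1/q) * emeasure \<nu> {a..b}"
        using \<nu>I[of a b] True that lower[of a b]
        by (simp add: ennreal_mult[symmetric] field_simps)
      then show "\<exists>a b. a < b \<and> x \<in> {a..b} \<and> b - a < d \<and> emeasure lborel {a..b} \<le> ennreal (1/q) * emeasure \<nu> {a..b}"
        using ab by blast
    qed (use True that in auto)
    ultimately have "emeasure lborel E \<le> ennreal (1/q) * (ennreal p * emeasure lborel E)"
      by (meson mult_left_mono order_trans zero_le)
    also have "\<dots> = ennreal (p/q) * emeasure lborel E"
      using True that by (simp add: mult.assoc[symmetric] ennreal_mult[symmetric])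
    finally have le: "emeasure lborel E \<le> ennreal (p/q) * emeasure lborel E" .
    \<comment> \<open>Truncation to a bounded interval makes the measure finite; only then does the
      factor \<open>p / q < 1\<close> force it to be zero.\<close>
    have "emeasure lborel E \<le> emeasure lborel {-real n..real n}"
      by (rule emeasure_mono) (auto simp: E_def)
    also have "\<dots> < top" by simp
    finally obtain r where r: "r \<ge> 0" "emeasure lborel E = ennreal r" by (metis ennreal_cases less_irrefl infinity_ennreal_def)
    then have "r \<le> p/q * r" using le True that by (simp add: ennreal_mult[symmetric])
    then have "r * (q - p) \<le> 0" using True that by (simp add: field_simps)
    then have "r = 0" using r that by (simp add: mult_le_0_iff)
    then show ?thesis using r E unfolding E_def[symmetric] by (simp add: negligible_iff_emeasure0)
  qed
  have "{x. \<not> f differentiable (at x)} \<subseteq> (\<Union>(p,q,n)\<in>{(p,q,n). p \<in> \<rat> \<and> q \<in> \<rat> \<and> p < q}. Lo p \<inter> Hi q \<inter> {-real n..real n})"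
  proof (rule subsetI, rule ccontr)
    fix x assume x: "x \<in> {x. \<not> f differentiable (at x)}"
      and nx: "x \<notin> (\<Union>(p,q,n)\<in>{(p,q,n). p \<in> \<rat> \<and> q \<in> \<rat> \<and> p < q}. Lo p \<inter> Hi q \<inter> {-real n..real n})"
    obtain n where n: "\<bar>x\<bar> \<le> real n" using real_arch_simple by blast
    have "f differentiable (at x)"
    proof (rule bounded_slopes_differentiable[of _ _ M])
      fix h :: real assume "h \<noteq> 0"
      have "\<bar>f (x + h) - f x\<bar> \<le> M * \<bar>h\<bar>"
        using lipschitz_onD[OF lipf, of "x + h" x] by (simp add: dist_real_def)
      then show "\<bar>(f (x + h) - f x) / h\<bar> \<le> M" using \<open>h \<noteq> 0\<close> by (simp add: abs_divide pos_divide_le_eq)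
    next
      fix p q :: real assume pq: "p \<in> \<rat>" "q \<in> \<rat>" "p < q"
      then have "x \<notin> Lo p \<inter> Hi q \<inter> {-real n..real n}" using nx by blast
      moreover have "x \<in> {-real n..real n}" using n by (auto simp: abs_le_iff)
      ultimately have "x \<notin> Lo p \<or> x \<notin> Hi q" by blast
      then show "\<exists>d>0. (\<forall>h. h \<noteq> 0 \<longrightarrow> \<bar>h\<bar> < d \<longrightarrow> p \<le> (f (x + h) - f x) / h) \<or>
                    (\<forall>h. h \<noteq> 0 \<longrightarrow> \<bar>h\<bar> < d \<longrightarrow> (f (x + h) - f x) / h \<le> q)"
      proof
        assume "x \<notin> Lo p"
        then obtain n where n: "\<And>a b. a < x \<Longrightarrow> x < b \<Longrightarrow> b - a < inverse (real (Suc n)) \<Longrightarrow> \<not> f b - f a < p * (b - a)"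
          unfolding Lo_def S_def by blast
        have "p \<le> (f (x + h) - f x) / h" if "h \<noteq> 0" "\<bar>h\<bar> < inverse (real (Suc n))" for h
          using isCont_straddle[OF contf that, of x p] n by (meson not_le)
        then show ?thesis by (intro exI[of _ "inverse (real (Suc n))"]) simp
      next
        assume "x \<notin> Hi q"
        then obtain n where n: "\<And>a b. a < x \<Longrightarrow> x < b \<Longrightarrow> b - a < inverse (real (Suc n)) \<Longrightarrow> \<not> f b - f a > q * (b - a)"
          unfolding Hi_def S_def by blast
        have "(f (x + h) - f x) / h \<le> q" if h: "h \<noteq> 0" "\<bar>h\<bar> < inverse (real (Suc n))" for h
        proof (rule ccontr)
          assume "\<not> ?thesis"
          then have "(- f (x + h) - - f x) / h < - q" by (simp add: minus_divide_left[symmetric] diff_divide_distrib)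
          then obtain a b where "a < x" "x < b" "b - a < inverse (real (Suc n))" "- f b - - f a < - q * (b - a)"
            using isCont_straddle[of x "\<lambda>x. - f x" h "inverse (real (Suc n))" "-q"] h contf
            by (auto intro: isCont_minus)
          then show False using n[of a b] by simp
        qed
        then show ?thesis by (intro exI[of _ "inverse (real (Suc n))"]) simp
      qed
    qed
    then show False using x by simp
  qed
  moreover have "negligible (\<Union>(p,q,n)\<in>{(p,q,n). p \<in> \<rat> \<and> q \<in> \<rat> \<and> p < q}. Lo p \<inter> Hi q \<inter> {-real n..real n})"
  proof (rule negligible_countable_Union)
    have "{(p,q,n::nat). p \<in> \<rat> \<and> q \<in> \<rat> \<and> p < q} \<subseteq> (\<rat>::real set) \<times> (\<rat>::real set) \<times> UNIV" by auto
    then have "countable {(p::real,q,n::nat). p \<in> \<rat> \<and> q \<in> \<rat> \<and> p < q}"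
      by (rule countable_subset) (intro countable_SIGMA countable_rat, auto)
    then show "countable ((\<lambda>(p,q,n). Lo p \<inter> Hi q \<inter> {-real n..real n}) ` {(p,q,n). p \<in> \<rat> \<and> q \<in> \<rat> \<and> p < q})"
      by (rule countable_image)
  qed (use neg in auto)
  ultimately show ?thesis using negligible_subset by blast
qed

text \<open>Adding \<open>(K + 1) * x\<close> moves all slopes into the interval from
  \<open>1\<close> to \<open>2 * K + 1\<close> and does not change the points of
  differentiability.\<close>

lemma lipschitz_real_AE_differentiable:
  fixes f :: "real \<Rightarrow> real"
  assumes lip: "K-lipschitz_on UNIV f"
  shows "negligible {x. \<not> f differentiable (at x)}"
proof -
  have "\<bar>f y - f x\<bar> \<le> K * (y - x)" if "x < y" for x y
    using lipschitz_onD[OF lip, of y x] that by (simp add: dist_real_def)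
  then have *: "negligible {x. \<not> (\<lambda>x. f x + (K + 1) * x) differentiable (at x)}"
    by (intro bilipschitz_increasing_AE_differentiable[where M="2 * K + 1"]) (force simp: algebra_simps abs_le_iff)+
  have "f differentiable (at x)" if "(\<lambda>x. f x + (K + 1) * x) differentiable (at x)" for x
  proof -
    have "(\<lambda>y. (f y + (K + 1) * y) - (K + 1) * y) differentiable (at x)"
      by (intro differentiable_diff that) (auto intro!: derivative_intros)
    then show ?thesis by simp
  qed
  then show ?thesis using * negligible_subset by (metis (mono_tags, lifting) Collect_mono)
qed

section \<open>Rademacher's theorem\<close>

text \<open>The function \<open>1 + u / (B + 1)\<close> is a nonnegative density whose measure
  agrees with Lebesgue measure on all boxes. The two measures therefore coincide, and densities are
  unique almost everywhere.\<close>

lemma AE_zero_if_box_integrals_zero: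
  fixes u :: "'a::euclidean_space \<Rightarrow> real"
  assumes [measurable]: "u \<in> borel_measurable borel" and bd: "\<And>x. \<bar>u x\<bar> \<le> B"
    and zero: "\<And>l r. (\<integral>x. indicator (box l r) x * u x \<partial>lborel) = 0"
  shows "AE x in lborel. u x = 0"
proof -
  have "B \<ge> 0" using bd[of 0] by linarith
  then have B1: "B + 1 > 0" by simp
  define f where "f x = 1 + u x / (B + 1)" for x
  have f0: "f x \<ge> 0" for x using bd[of x] B1 by (simp add: f_def field_simps abs_le_iff)
  have [measurable]: "f \<in> borel_measurable borel" unfolding f_def by measurable
  have "lborel = density lborel (\<lambda>x. ennreal (f x))"
  proof (rule lborel_eqI)
    fix l r :: 'a assume lr: "\<And>b. b \<in> Basis \<Longrightarrow> l \<bullet> b \<le> r \<bullet> b"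
    have i1: "integrable lborel (\<lambda>x. indicator (box l r) x :: real)"
      by (rule integrable_real_indicator) (simp_all add: emeasure_lborel_box_eq)
    have i2: "integrable lborel (\<lambda>x. indicator (box l r) x * u x)"
    proof (rule Bochner_Integration.integrable_bound)
      show "integrable lborel (\<lambda>x. B * indicator (box l r) x :: real)" using i1 by simp
      show "AE x in lborel. norm (indicator (box l r) x * u x) \<le> norm (B * indicator (box l r) x)"
        using bd \<open>B \<ge> 0\<close> by (intro AE_I2) (auto simp: indicator_def)
    qed measurable
    have eq: "f x * indicator (box l r) x = indicator (box l r) x + (indicator (box l r) x * u x) / (B + 1)" for x
      by (simp add: f_def algebra_simps)
    have i3: "integrable lborel (\<lambda>x. f x * indicator (box l r) x)"
      unfolding eq using i1 i2 by simp
    have "emeasure (density lborel (\<lambda>x. ennreal (f x))) (box l r)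
        = (\<integral>\<^sup>+x. ennreal (f x * indicator (box l r) x) \<partial>lborel)"
      by (subst emeasure_density) (auto simp: indicator_def intro!: nn_integral_cong)
    also have "\<dots> = ennreal (\<integral>x. f x * indicator (box l r) x \<partial>lborel)"
      by (rule nn_integral_eq_integral[OF i3]) (use f0 in auto)
    also have "(\<integral>x. f x * indicator (box l r) x \<partial>lborel) = measure lborel (box l r)"
      unfolding eq using i1 i2 zero[of l r] by simp
    also have "\<dots> = (\<Prod>b\<in>Basis. (r - l) \<bullet> b)" using lr by (simp add: measure_lborel_box)
    finally show "emeasure (density lborel (\<lambda>x. ennreal (f x))) (box l r) = ennreal (\<Prod>b\<in>Basis. (r - l) \<bullet> b)" .
  qed simp
  moreover have "density lborel (\<lambda>_. 1) = (lborel :: 'a measure)" by (rule density_1)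
  ultimately have "density lborel (\<lambda>x. ennreal (f x)) = density lborel (\<lambda>_::'a. 1)" by simp
  then have "AE x in lborel. ennreal (f x) = 1"
    by (intro sigma_finite_measure.density_unique[OF lborel.sigma_finite_measure_axioms]) auto
  then show ?thesis
    by (rule AE_mp) (intro AE_I2 impI, use f0 B1 in \<open>simp add: f_def\<close>)
qed

lemma AE_lborel_translate:
  fixes c :: "'a::euclidean_space"
  assumes [measurable]: "Measurable.pred borel P" and "AE x in lborel. P (c + x)"
  shows "AE x in lborel. P x"
proof -
  have "AE x in distr lborel borel ((+) c). P x"
    using assms by (subst AE_distr_iff) auto
  then show ?thesis unfolding lborel_distr_plus .
qed

text \<open>On each line parallel to \<open>v\<close> the one-dimensional theorem applies. Instead
  of choosing coordinates adapted to \<open>v\<close>, Fubini is applied to \<open>(t, x)\<close>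
  and the point \<open>t *\<^sub>R v + x\<close>: for some \<open>t\<close> the translated set has
  full measure, and Lebesgue measure is translation invariant.\<close>

lemma lipschitz_AE_directional_derivative:
  fixes F :: "'a::euclidean_space \<Rightarrow> real"
  assumes lip: "K-lipschitz_on UNIV F"
  obtains G where "G \<in> sets borel" "AE x in lborel. x \<in> G"
    "\<And>x. x \<in> G \<Longrightarrow> (\<lambda>t. F (x + t *\<^sub>R v)) differentiable (at 0)"
proof -
  have contF: "continuous_on UNIV F" by (rule lipschitz_on_continuous_on[OF lip])
  have cF: "continuous_on UNIV (\<lambda>x. F (x + c))" for c
    by (intro continuous_on_compose2[OF contF] continuous_intros) auto
  have K: "K \<ge> 0" by (rule lipschitz_on_nonneg[OF lip])
  \<comment> \<open>Slopes bounded below (\<open>C1\<close>) or above (\<open>C2\<close>) for all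
    small \<open>h\<close> are intersections of closed conditions. Through the criterion with
    rational thresholds, differentiability becomes a Borel condition.\<close>
  define C1 where "C1 n p = {x. \<forall>h. h \<noteq> 0 \<longrightarrow> \<bar>h\<bar> < inverse (real (Suc n)) \<longrightarrow> (F (x + h *\<^sub>R v) - F x) / h \<ge> p}" for n p
  define C2 where "C2 n p = {x. \<forall>h. h \<noteq> 0 \<longrightarrow> \<bar>h\<bar> < inverse (real (Suc n)) \<longrightarrow> (F (x + h *\<^sub>R v) - F x) / h \<le> p}" for n p
  define G where "G = (\<Inter>(p,q)\<in>{(p,q). p \<in> \<rat> \<and> q \<in> \<rat> \<and> p < q}. \<Union>n. C1 n p \<union> C2 n q)"
  have "C1 n p = (\<Inter>h\<in>{h. h \<noteq> 0 \<and> \<bar>h\<bar> < inverse (real (Suc n))}. {x. p \<le> (F (x + h *\<^sub>R v) - F x) / h})"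
    "C2 n p = (\<Inter>h\<in>{h. h \<noteq> 0 \<and> \<bar>h\<bar> < inverse (real (Suc n))}. {x. (F (x + h *\<^sub>R v) - F x) / h \<le> p})" for n p
    by (auto simp: C1_def C2_def)
  moreover have "closed {x. p \<le> (F (x + h *\<^sub>R v) - F x) / h}" "closed {x. (F (x + h *\<^sub>R v) - F x) / h \<le> p}"
    if "h \<noteq> 0" for h p
    by (intro closed_Collect_le continuous_on_divide continuous_on_diff cF contF continuous_on_const ballI that)+
  ultimately have closed: "closed (C1 n p)" "closed (C2 n p)" for n p by auto
  have cnt: "countable {(p::real,q). p \<in> \<rat> \<and> q \<in> \<rat> \<and> p < q}"
    by (rule countable_subset[of _ "\<rat> \<times> \<rat>"]) (auto intro: countable_SIGMA countable_rat)
  have C12: "C1 n p \<union> C2 n q \<in> sets borel" for n p q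
    using closed by (intro borel_closed closed_Un) auto
  have ne: "{(p,q). p \<in> \<rat> \<and> q \<in> \<rat> \<and> p < q} \<noteq> ({} :: (real \<times> real) set)"
  proof -
    have "(0::real, 1::real) \<in> {(p,q). p \<in> \<rat> \<and> q \<in> \<rat> \<and> p < q}" by simp
    then show ?thesis by blast
  qed
  have G: "G \<in> sets borel" unfolding G_def
    by (rule sets.countable_INT'[OF cnt ne]) (use C12 in \<open>auto intro!: sets.countable_UN\<close>)
  have slope: "\<bar>(F (x + h *\<^sub>R v) - F x) / h\<bar> \<le> K * norm v" if "h \<noteq> 0" for x h
    using lipschitz_onD[OF lip, of "x + h *\<^sub>R v" x] that
    by (simp add: dist_norm abs_divide pos_divide_le_eq mult_ac)
  have Gdiff: "(\<lambda>t. F (x + t *\<^sub>R v)) differentiable (at 0)" if x: "x \<in> G" for x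
  proof (rule bounded_slopes_differentiable[of _ _ "K * norm v"])
    fix p q :: real assume pq: "p \<in> \<rat>" "q \<in> \<rat>" "p < q"
    then obtain n where "x \<in> C1 n p \<or> x \<in> C2 n q" using x unfolding G_def by blast
    then show "\<exists>d>0. (\<forall>h. h \<noteq> 0 \<longrightarrow> \<bar>h\<bar> < d \<longrightarrow> p \<le> (F (x + (0 + h) *\<^sub>R v) - F (x + 0 *\<^sub>R v)) / h) \<or>
                  (\<forall>h. h \<noteq> 0 \<longrightarrow> \<bar>h\<bar> < d \<longrightarrow> (F (x + (0 + h) *\<^sub>R v) - F (x + 0 *\<^sub>R v)) / h \<le> q)"
      by (intro exI[of _ "inverse (real (Suc n))"]) (auto simp: C1_def C2_def)
  qed (use slope in simp)
  have diffG: "y \<in> G" if y: "(\<lambda>t. F (y + t *\<^sub>R v)) differentiable (at 0)" for y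
  proof -
    obtain D where "((\<lambda>t. F (y + t *\<^sub>R v)) has_real_derivative D) (at 0)"
      using y by (auto simp: real_differentiable_def)
    then have lim: "((\<lambda>h. (F (y + h *\<^sub>R v) - F y) / h) \<longlongrightarrow> D) (at 0)"
      unfolding DERIV_def by simp
    have "\<exists>n. y \<in> C1 n p \<or> y \<in> C2 n q" if pq: "p < q" for p q
    proof (cases "p < D")
      case True
      then have "\<forall>\<^sub>F h in at 0. p < (F (y + h *\<^sub>R v) - F y) / h" using lim by (rule order_tendstoD(1)[rotated])
      then obtain d where d: "d > 0" "\<And>h. h \<noteq> 0 \<Longrightarrow> \<bar>h\<bar> < d \<Longrightarrow> p < (F (y + h *\<^sub>R v) - F y) / h"
        unfolding eventually_at by (auto simp: dist_real_def)
      obtain n where "inverse (real (Suc n)) < d" using reals_Archimedean[OF d(1)] by blast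
      then have "y \<in> C1 n p" unfolding C1_def using d(2) by (auto intro!: less_imp_le)
      then show ?thesis by blast
    next
      case False
      then have "D < q" using pq by simp
      then have "\<forall>\<^sub>F h in at 0. (F (y + h *\<^sub>R v) - F y) / h < q" using lim by (rule order_tendstoD(2)[rotated])
      then obtain d where d: "d > 0" "\<And>h. h \<noteq> 0 \<Longrightarrow> \<bar>h\<bar> < d \<Longrightarrow> (F (y + h *\<^sub>R v) - F y) / h < q"
        unfolding eventually_at by (auto simp: dist_real_def)
      obtain n where "inverse (real (Suc n)) < d" using reals_Archimedean[OF d(1)] by blast
      then have "y \<in> C2 n q" unfolding C2_def using d(2) by (auto intro!: less_imp_le)
      then show ?thesis by blast
    qed
    then show ?thesis unfolding G_def by blast
  qed
  have line: "AE t in lborel. t *\<^sub>R v + x \<in> G" for x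
  proof -
    define f where "f t = F (x + t *\<^sub>R v)" for t :: real
    have lipf: "(K * norm v)-lipschitz_on UNIV f"
    proof (rule lipschitz_onI)
      fix s t :: real
      show "dist (f s) (f t) \<le> K * norm v * dist s t"
        using lipschitz_onD[OF lip, of "x + s *\<^sub>R v" "x + t *\<^sub>R v"]
        by (simp add: f_def dist_norm scaleR_left_diff_distrib[symmetric] mult_ac)
    qed (use K in simp)
    have "t *\<^sub>R v + x \<in> G" if t: "f differentiable (at t)" for t
    proof (rule diffG)
      have "(\<lambda>s. f (t + s)) differentiable (at 0)"
        using t by (intro differentiable_compose[of f "\<lambda>s. t + s"]) (auto intro!: derivative_intros)
      moreover have "f (t + s) = F (t *\<^sub>R v + x + s *\<^sub>R v)" for s by (simp add: f_def algebra_simps)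
      ultimately show "(\<lambda>s. F (t *\<^sub>R v + x + s *\<^sub>R v)) differentiable (at 0)" by simp
    qed
    then have "{t. t *\<^sub>R v + x \<notin> G} \<subseteq> {t. \<not> f differentiable (at t)}" by blast
    then have "negligible {t. t *\<^sub>R v + x \<notin> G}"
      using lipschitz_real_AE_differentiable[OF lipf] negligible_subset by blast
    then have "AE t in lebesgue. t *\<^sub>R v + x \<in> G"
      by (auto simp: negligible_iff_null_sets intro: AE_I')
    then show ?thesis by (simp add: AE_completion_iff)
  qed
  have ae: "AE t in lborel. AE x in lborel. t *\<^sub>R v + x \<in> G"
  proof (subst lborel_pair.AE_commute)
    have "Measurable.pred (borel \<Otimes>\<^sub>M borel) (\<lambda>z. fst z *\<^sub>R v + snd z \<in> G)"
      using G by measurable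
    then show "{z \<in> space (lborel \<Otimes>\<^sub>M lborel). fst z *\<^sub>R v + snd z \<in> G} \<in> sets (lborel \<Otimes>\<^sub>M lborel)"
      by (simp add: pred_def space_pair_measure cong: sets_pair_measure_cong)
  qed (use line in auto)
  have "\<exists>t::real. AE x in lborel. t *\<^sub>R v + x \<in> G"
  proof (rule ccontr)
    assume "\<nexists>t::real. AE x in lborel. t *\<^sub>R v + x \<in> G"
    then have "AE t::real in lborel. False" using ae by simp
    then have "emeasure lborel (UNIV :: real set) = 0"
      using AE_iff_measurable[of UNIV "lborel :: real measure" "\<lambda>_. False"] by simp
    then show False by simp
  qed
  then obtain t :: real where t: "AE x in lborel. t *\<^sub>R v + x \<in> G" by blast
  have "AE x in lborel. x \<in> G"
    by (rule AE_lborel_translate[OF _ t]) (use G in measurable)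
  then show ?thesis using that G Gdiff by blast
qed

text \<open>Measurability comes from taking the limit of the slopes along the single sequence
  \<open>1 / (k + 1)\<close>, which agrees with the derivative on the Borel set where the latter
  exists.\<close>

lemma lipschitz_measurable_directional_derivative:
  fixes F :: "'a::euclidean_space \<Rightarrow> real"
  assumes lip: "K-lipschitz_on UNIV F"
  obtains D where "D \<in> borel_measurable borel" "\<And>x. \<bar>D x\<bar> \<le> K * norm v"
    "AE x in lborel. ((\<lambda>t. F (x + t *\<^sub>R v)) has_real_derivative D x) (at 0)"
proof -
  obtain G where G: "G \<in> sets borel" "AE x in lborel. x \<in> G"
    "\<And>x. x \<in> G \<Longrightarrow> (\<lambda>t. F (x + t *\<^sub>R v)) differentiable (at 0)"
    using lipschitz_AE_directional_derivative[OF lip] by metis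
  have K: "K \<ge> 0" by (rule lipschitz_on_nonneg[OF lip])
  have contF: "continuous_on UNIV F" by (rule lipschitz_on_continuous_on[OF lip])
  then have [measurable]: "F \<in> borel_measurable borel" by (rule borel_measurable_continuous_onI)
  define s where "s k x = (F (x + inverse (real (Suc k)) *\<^sub>R v) - F x) / inverse (real (Suc k))" for k x
  define D where "D x = (if x \<in> G then lim (\<lambda>k. s k x) else 0)" for x
  have [measurable]: "s k \<in> borel_measurable borel" for k unfolding s_def by measurable
  have m: "D \<in> borel_measurable borel" unfolding D_def using G(1) by measurable
  have slope': "\<bar>(F (x + h *\<^sub>R v) - F x) / h\<bar> \<le> K * norm v" if "h \<noteq> 0" for x h
    using lipschitz_onD[OF lip, of "x + h *\<^sub>R v" x] that
    by (simp add: dist_norm abs_divide pos_divide_le_eq mult_ac)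
  have slope: "\<bar>s k x\<bar> \<le> K * norm v" for k x
    unfolding s_def by (rule slope') simp
  have D: "((\<lambda>t. F (x + t *\<^sub>R v)) has_real_derivative D x) (at 0) \<and> (\<lambda>k. s k x) \<longlonglongrightarrow> D x" if x: "x \<in> G" for x
  proof -
    obtain d where d: "((\<lambda>t. F (x + t *\<^sub>R v)) has_real_derivative d) (at 0)"
      using G(3)[OF x] by (auto simp: real_differentiable_def)
    then have lim: "((\<lambda>h. (F (x + h *\<^sub>R v) - F x) / h) \<longlongrightarrow> d) (at 0)" unfolding DERIV_def by simp
    have "filterlim (\<lambda>k. inverse (real (Suc k))) (at 0) sequentially"
      using LIMSEQ_inverse_real_of_nat by (auto simp: filterlim_at simp del: of_nat_Suc)
    then have "(\<lambda>k. s k x) \<longlonglongrightarrow> d" unfolding s_def by (rule filterlim_compose[OF lim])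
    then show ?thesis using d x by (simp add: D_def limI)
  qed
  have "\<bar>D x\<bar> \<le> K * norm v" for x
  proof (cases "x \<in> G")
    case True
    then have "(\<lambda>k. \<bar>s k x\<bar>) \<longlonglongrightarrow> \<bar>D x\<bar>" using D by (intro tendsto_rabs) blast
    then show ?thesis by (rule LIMSEQ_le_const2) (use slope in auto)
  qed (use K in \<open>simp add: D_def\<close>)
  moreover have "AE x in lborel. ((\<lambda>t. F (x + t *\<^sub>R v)) has_real_derivative D x) (at 0)"
    using G(2) by eventually_elim (use D in blast)
  ultimately show ?thesis using that[of D] m by blast
qed

lemma tendsto_indicator_box_translate:
  fixes y :: "'a::euclidean_space"
  assumes c: "c \<longlonglongrightarrow> 0" and y: "y \<notin> frontier (box l r)"
  shows "(\<lambda>k. indicator (box l r) (y - c k) :: real) \<longlonglongrightarrow> indicator (box l r) y"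
proof (rule tendsto_eventually)
  have lim: "(\<lambda>k. y - c k) \<longlonglongrightarrow> y" using tendsto_diff[OF tendsto_const c, of y] by simp
  show "\<forall>\<^sub>F k in sequentially. indicator (box l r) (y - c k) = (indicator (box l r) y :: real)"
  proof (cases "y \<in> box l r")
    case True
    then have "\<forall>\<^sub>F k in sequentially. y - c k \<in> box l r" using lim by (intro topological_tendstoD) auto
    then show ?thesis by eventually_elim (use True in simp)
  next
    case False
    then have "y \<in> - closure (box l r)" using y interior_subset by (auto simp: frontier_def)
    then have "\<forall>\<^sub>F k in sequentially. y - c k \<in> - closure (box l r)" using lim by (intro topological_tendstoD) auto
    then show ?thesis
    proof eventually_elim
      case (elim k)
      then have "y - c k \<notin> box l r" using closure_subset by blast
      then show ?case using False by simp
    qed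
  qed
qed

text \<open>The identity \<open>s (v + w) k x = s v k x + s w k (x + e k *\<^sub>R v)\<close> is
  exact, but its last quotient sits at a moving point, where pointwise limits say nothing. Tested
  against the indicator of a box, the shift passes to the indicator, whose translates converge off
  the null boundary of the box. Dominated convergence then gives equal integrals over all
  boxes.\<close>

lemma AE_directional_derivative_add:
  fixes F :: "'a::euclidean_space \<Rightarrow> real"
  assumes lip: "K-lipschitz_on UNIV F"
  shows "AE x in lborel. \<forall>d1 d2. ((\<lambda>t. F (x + t *\<^sub>R v)) has_real_derivative d1) (at 0) \<longrightarrow>
      ((\<lambda>t. F (x + t *\<^sub>R w)) has_real_derivative d2) (at 0) \<longrightarrow>
      ((\<lambda>t. F (x + t *\<^sub>R (v + w))) has_real_derivative d1 + d2) (at 0)"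
proof -
  have K: "K \<ge> 0" by (rule lipschitz_on_nonneg[OF lip])
  have contF: "continuous_on UNIV F" by (rule lipschitz_on_continuous_on[OF lip])
  then have [measurable]: "F \<in> borel_measurable borel" by (rule borel_measurable_continuous_onI)
  obtain Dv where Dv[measurable]: "Dv \<in> borel_measurable borel" and Dv1: "\<And>x. \<bar>Dv x\<bar> \<le> K * norm v"
    and Dv2: "AE x in lborel. ((\<lambda>t. F (x + t *\<^sub>R v)) has_real_derivative Dv x) (at 0)"
    by (rule lipschitz_measurable_directional_derivative[OF lip, of v]) blast
  obtain Dw where Dw[measurable]: "Dw \<in> borel_measurable borel" and Dw1: "\<And>x. \<bar>Dw x\<bar> \<le> K * norm w"
    and Dw2: "AE x in lborel. ((\<lambda>t. F (x + t *\<^sub>R w)) has_real_derivative Dw x) (at 0)"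
    by (rule lipschitz_measurable_directional_derivative[OF lip, of w]) blast
  obtain Du where Du[measurable]: "Du \<in> borel_measurable borel" and Du1: "\<And>x. \<bar>Du x\<bar> \<le> K * norm (v + w)"
    and Du2: "AE x in lborel. ((\<lambda>t. F (x + t *\<^sub>R (v + w))) has_real_derivative Du x) (at 0)"
    by (rule lipschitz_measurable_directional_derivative[OF lip, of "v + w"]) blast
  define e where "e k = inverse (real (Suc k))" for k
  have e0: "e k > 0" "e k \<le> 1" for k by (simp_all add: e_def inverse_le_1_iff)
  have elim: "e \<longlonglongrightarrow> 0" unfolding e_def by (rule LIMSEQ_inverse_real_of_nat)
  have eat: "filterlim e (at 0) sequentially"
  proof -
    have "e k \<noteq> 0" for k using e0(1)[of k] by simp
    then show ?thesis using elim by (simp add: filterlim_at)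
  qed
  define s where "s z k x = (F (x + e k *\<^sub>R z) - F x) / e k" for z k x
  have [measurable]: "s z k \<in> borel_measurable borel" for z k unfolding s_def by measurable
  have sbd: "\<bar>s z k x\<bar> \<le> K * norm z" for z k x
    using lipschitz_onD[OF lip, of "x + e k *\<^sub>R z" x] e0(1)[of k]
    by (simp add: s_def dist_norm abs_divide pos_divide_le_eq mult_ac)
  have slim: "(\<lambda>k. s z k x) \<longlonglongrightarrow> d" if "((\<lambda>t. F (x + t *\<^sub>R z)) has_real_derivative d) (at 0)" for z x d
  proof -
    have "((\<lambda>h. (F (x + h *\<^sub>R z) - F x) / h) \<longlongrightarrow> d) (at 0)" using that unfolding DERIV_def by simp
    then show ?thesis unfolding s_def by (rule filterlim_compose[OF _ eat])
  qed
  have "AE x in lborel. Du x - Dv x - Dw x = 0"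
  proof (rule AE_zero_if_box_integrals_zero)
    show "\<bar>Du x - Dv x - Dw x\<bar> \<le> K * norm (v + w) + K * norm v + K * norm w" for x
      using Du1[of x] Dv1[of x] Dw1[of x] by linarith
    fix l r :: 'a
    let ?I = "\<lambda>x. indicator (box l r) x :: real"
    obtain R where R: "\<And>x. x \<in> box l r \<Longrightarrow> norm x \<le> R" using bounded_box[of l r] by (auto simp: bounded_iff)
    \<comment> \<open>The box widened by \<open>norm v\<close> contains all its translates by
      \<open>e k *\<^sub>R v\<close>, as \<open>e k\<close> is at most one, and carries the
      dominating function.\<close>
    define B where "B = cball (0::'a) (R + norm v)"
    have IB: "?I x \<le> indicator B x" for x using R[of x] by (auto simp: B_def indicator_def intro: add_increasing2)
    have iB: "integrable lborel (\<lambda>x. c * indicator B x :: real)" for c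
      unfolding B_def using emeasure_bounded_finite[OF bounded_cball[of "0::'a" "R + norm v"]]
      by (intro integrable_mult_right integrable_real_indicator) auto
    have DC: "(\<lambda>k. \<integral>x. ?I (x - c k) * s z k x \<partial>lborel) \<longlonglongrightarrow> (\<integral>x. ?I x * D x \<partial>lborel)"
      if D[measurable]: "D \<in> borel_measurable borel"
        and D2: "AE x in lborel. ((\<lambda>t. F (x + t *\<^sub>R z)) has_real_derivative D x) (at 0)"
        and c: "c \<longlonglongrightarrow> 0" "\<And>k. norm (c k) \<le> norm v" for z D c
    proof (rule integral_dominated_convergence[where w="\<lambda>x. (K * norm z) * indicator B x"])
      have "AE x in lborel. x \<notin> frontier (box l r)"
      proof -
        have "negligible (frontier (box l r))" by (rule negligible_convex_frontier) simp
        then have "AE x in lebesgue. x \<notin> frontier (box l r)"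
          by (auto simp: negligible_iff_null_sets intro: AE_I')
        then show ?thesis by (simp add: AE_completion_iff)
      qed
      with D2 show "AE x in lborel. (\<lambda>k. ?I (x - c k) * s z k x) \<longlonglongrightarrow> ?I x * D x"
      proof eventually_elim
        case (elim x)
        then show ?case by (intro tendsto_mult tendsto_indicator_box_translate c slim)
      qed
      show "AE x in lborel. norm (?I (x - c k) * s z k x) \<le> (K * norm z) * indicator B x" for k
      proof (rule AE_I2)
        fix x
        show "norm (?I (x - c k) * s z k x) \<le> (K * norm z) * indicator B x"
        proof (cases "x - c k \<in> box l r")
          case True
          have "norm x \<le> norm (x - c k) + norm (c k)" using norm_triangle_ineq[of "x - c k" "c k"] by simp
          then have "x \<in> B" using R[OF True] c(2)[of k] by (simp add: B_def)
          then show ?thesis using True sbd[of z k x] by simp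
        next
          case False
          then show ?thesis using K by (simp add: indicator_def)
        qed
      qed
    qed (use iB in measurable)
    have sI: "integrable lborel (\<lambda>x. ?I x * s z k (x + c))" for z k c
    proof (rule Bochner_Integration.integrable_bound[OF iB[of "K * norm z"]])
      show "AE x in lborel. norm (?I x * s z k (x + c)) \<le> norm (K * norm z * indicator B x)"
        using IB sbd[of z k] K by (intro AE_I2) (auto simp: indicator_def abs_mult split: if_splits)
    qed measurable
    have DI: "integrable lborel (\<lambda>x. ?I x * D x)" if [measurable]: "D \<in> borel_measurable borel" and "\<And>x. \<bar>D x\<bar> \<le> c" for D c
    proof (rule Bochner_Integration.integrable_bound[OF iB[of c]])
      have "c \<ge> 0" using that(2)[of 0] by linarith
      then show "AE x in lborel. norm (?I x * D x) \<le> norm (c * indicator B x)"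
        using IB that(2) by (intro AE_I2) (auto simp: indicator_def abs_mult split: if_splits)
    qed measurable
    have split: "s (v + w) k x = s v k x + s w k (x + e k *\<^sub>R v)" for k x
      by (simp add: s_def add_divide_distrib[symmetric] algebra_simps)
    have shift: "(\<integral>x. ?I x * s w k (x + e k *\<^sub>R v) \<partial>lborel) = (\<integral>x. ?I (x - e k *\<^sub>R v) * s w k x \<partial>lborel)" for k
    proof -
      have "(\<integral>x. ?I (x - e k *\<^sub>R v) * s w k x \<partial>lborel) = (\<integral>x. ?I (x - e k *\<^sub>R v) * s w k x \<partial>distr lborel borel ((+) (e k *\<^sub>R v)))"
        unfolding lborel_distr_plus ..
      also have "\<dots> = (\<integral>x. ?I x * s w k (x + e k *\<^sub>R v) \<partial>lborel)"
        by (subst integral_distr) (auto simp: add.commute)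
      finally show ?thesis by simp
    qed
    have A: "(\<lambda>k. \<integral>x. ?I x * s (v + w) k x \<partial>lborel) \<longlonglongrightarrow> (\<integral>x. ?I x * Du x \<partial>lborel)"
      using DC[OF Du Du2, of "\<lambda>_. 0"] by simp
    have B: "(\<lambda>k. \<integral>x. ?I x * s v k x \<partial>lborel) \<longlonglongrightarrow> (\<integral>x. ?I x * Dv x \<partial>lborel)"
      using DC[OF Dv Dv2, of "\<lambda>_. 0"] by simp
    have C: "(\<lambda>k. \<integral>x. ?I (x - e k *\<^sub>R v) * s w k x \<partial>lborel) \<longlonglongrightarrow> (\<integral>x. ?I x * Dw x \<partial>lborel)"
    proof (rule DC[OF Dw Dw2])
      show "(\<lambda>k. e k *\<^sub>R v) \<longlonglongrightarrow> 0" using tendsto_scaleR[OF elim tendsto_const, of v] by simp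
      show "norm (e k *\<^sub>R v) \<le> norm v" for k using e0[of k] by (simp add: mult_left_le_one_le)
    qed
    have "(\<integral>x. ?I x * s (v + w) k x \<partial>lborel) = (\<integral>x. ?I x * s v k x \<partial>lborel) + (\<integral>x. ?I (x - e k *\<^sub>R v) * s w k x \<partial>lborel)" for k
      unfolding split distrib_left shift[symmetric]
      by (rule Bochner_Integration.integral_add) (use sI[of v k 0] sI[of w k "e k *\<^sub>R v"] in auto)
    then have "(\<integral>x. ?I x * Du x \<partial>lborel) = (\<integral>x. ?I x * Dv x \<partial>lborel) + (\<integral>x. ?I x * Dw x \<partial>lborel)"
      using A tendsto_add[OF B C] by (simp add: LIMSEQ_unique)
    then show "(\<integral>x. ?I x * (Du x - Dv x - Dw x) \<partial>lborel) = 0"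
      using DI[OF Du Du1] DI[OF Dv Dv1] DI[OF Dw Dw1] by (simp add: right_diff_distrib)
  qed measurable
  with Du2 Dv2 Dw2 show ?thesis
  proof eventually_elim
    case (elim x)
    then show ?case using DERIV_unique by (metis add_diff_cancel_left' diff_add_cancel diff_diff_eq eq_iff_diff_eq_0)
  qed
qed

text \<open>By compactness finitely many directions of \<open>Q\<close> form a net of the unit
  sphere, and on a finite net the difference quotients converge uniformly. The Lipschitz bound
  carries the estimate to all other directions.\<close>

lemma has_derivative_if_dense_directional:
  fixes F :: "'a::euclidean_space \<Rightarrow> real"
  assumes lip: "K-lipschitz_on UNIV F" and dense: "\<And>U. open U \<Longrightarrow> U \<noteq> {} \<Longrightarrow> \<exists>q\<in>Q. q \<in> U"
    and deriv: "\<And>q. q \<in> Q \<Longrightarrow> ((\<lambda>t. F (x + t *\<^sub>R q)) has_real_derivative G \<bullet> q) (at 0)"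
  shows "(F has_derivative (\<lambda>h. G \<bullet> h)) (at x)"
  unfolding has_derivative_at_alt
proof (intro conjI allI impI)
  show "bounded_linear ((\<bullet>) G)" by (rule bounded_linear_inner_right)
  fix e :: real assume e: "e > 0"
  have K: "K \<ge> 0" by (rule lipschitz_on_nonneg[OF lip])
  \<comment> \<open>Changing the direction by \<open>\<eta>\<close> costs \<open>K * \<eta>\<close>
    for \<open>F\<close> and \<open>norm G * \<eta>\<close> for the candidate derivative, and the
    quotients on the net cost another \<open>\<eta>\<close>; together this is
    \<open>e\<close>.\<close>
  define \<eta> where "\<eta> = e / (K + norm G + 1)"
  have pos: "K + norm G + 1 > 0" using K norm_ge_zero[of G] by linarith
  have \<eta>: "\<eta> > 0" using e pos by (simp add: \<eta>_def)
  have "sphere 0 1 \<subseteq> (\<Union>q\<in>Q. ball q \<eta>)"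
  proof
    fix u :: 'a
    obtain q where "q \<in> Q" "q \<in> ball u \<eta>" using dense[of "ball u \<eta>"] \<eta> by auto
    then show "u \<in> (\<Union>q\<in>Q. ball q \<eta>)" by (auto simp: dist_commute)
  qed
  then obtain Q' where Q': "Q' \<subseteq> Q" "finite Q'" "sphere 0 1 \<subseteq> (\<Union>q\<in>Q'. ball q \<eta>)"
    using compactE_image[OF compact_sphere, of Q "\<lambda>q. ball q \<eta>" 0 1] by (metis open_ball)
  have "\<forall>q\<in>Q'. \<forall>\<^sub>F t in at_right 0. \<bar>F (x + t *\<^sub>R q) - F x - t * (G \<bullet> q)\<bar> \<le> \<eta> * t"
  proof
    fix q assume "q \<in> Q'"
    then have "((\<lambda>h. (F (x + h *\<^sub>R q) - F x) / h) \<longlongrightarrow> G \<bullet> q) (at 0)"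
      using deriv[of q] Q' unfolding DERIV_def by auto
    then have "\<forall>\<^sub>F t in at 0. dist ((F (x + t *\<^sub>R q) - F x) / t) (G \<bullet> q) < \<eta>" using \<eta> by (rule tendstoD)
    then have "\<forall>\<^sub>F t in at_right 0. dist ((F (x + t *\<^sub>R q) - F x) / t) (G \<bullet> q) < \<eta>"
      by (rule filter_leD[rotated]) (simp add: at_within_le_at)
    moreover have "\<forall>\<^sub>F t::real in at_right 0. t > 0" by (rule eventually_at_right_less)
    ultimately show "\<forall>\<^sub>F t in at_right 0. \<bar>F (x + t *\<^sub>R q) - F x - t * (G \<bullet> q)\<bar> \<le> \<eta> * t"
    proof eventually_elim
      case (elim t)
      have "F (x + t *\<^sub>R q) - F x - t * (G \<bullet> q) = t * ((F (x + t *\<^sub>R q) - F x) / t - G \<bullet> q)"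
        using elim by (simp add: field_simps)
      then have "\<bar>F (x + t *\<^sub>R q) - F x - t * (G \<bullet> q)\<bar> = t * \<bar>(F (x + t *\<^sub>R q) - F x) / t - G \<bullet> q\<bar>"
        using elim by (simp add: abs_mult)
      also have "\<dots> \<le> t * \<eta>" using elim by (intro mult_left_mono) (auto simp: dist_real_def)
      finally show ?case by (simp add: mult.commute)
    qed
  qed
  then have "\<forall>\<^sub>F t in at_right 0. \<forall>q\<in>Q'. \<bar>F (x + t *\<^sub>R q) - F x - t * (G \<bullet> q)\<bar> \<le> \<eta> * t"
    by (rule eventually_ball_finite[OF Q'(2)])
  then obtain d where d: "d > 0" "\<And>t q. 0 < t \<Longrightarrow> t < d \<Longrightarrow> q \<in> Q' \<Longrightarrow> \<bar>F (x + t *\<^sub>R q) - F x - t * (G \<bullet> q)\<bar> \<le> \<eta> * t"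
    unfolding eventually_at_right_field by auto
  show "\<exists>d>0. \<forall>y. norm (y - x) < d \<longrightarrow> norm (F y - F x - G \<bullet> (y - x)) \<le> e * norm (y - x)"
  proof (intro exI conjI allI impI)
    fix y assume y: "norm (y - x) < d"
    show "norm (F y - F x - G \<bullet> (y - x)) \<le> e * norm (y - x)"
    proof (cases "y = x")
      case False
      define t where "t = norm (y - x)"
      define u where "u = (y - x) /\<^sub>R t"
      have t: "0 < t" "t < d" using False y by (auto simp: t_def)
      have yx: "y = x + t *\<^sub>R u" using t by (simp add: u_def)
      have "norm u = 1" using False by (simp add: u_def t_def)
      then obtain q where q: "q \<in> Q'" "u \<in> ball q \<eta>" using Q'(3) by (auto simp: subset_iff)
      have qu: "norm (q - u) \<le> \<eta>" using q by (simp add: dist_norm)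
      have 1: "\<bar>F (x + t *\<^sub>R q) - F x - t * (G \<bullet> q)\<bar> \<le> \<eta> * t" by (rule d(2)[OF t q(1)])
      have "\<bar>F (x + t *\<^sub>R u) - F (x + t *\<^sub>R q)\<bar> \<le> K * (t * norm (q - u))"
        using lipschitz_onD[OF lip, of "x + t *\<^sub>R u" "x + t *\<^sub>R q"] t
        by (simp add: dist_norm norm_minus_commute[of q] scaleR_diff_right[symmetric])
      also have "\<dots> \<le> K * (t * \<eta>)" using K t qu by (intro mult_left_mono) auto
      finally have 2: "\<bar>F (x + t *\<^sub>R u) - F (x + t *\<^sub>R q)\<bar> \<le> K * \<eta> * t" by (simp add: mult_ac)
      have "\<bar>t * (G \<bullet> q) - t * (G \<bullet> u)\<bar> = t * \<bar>G \<bullet> (q - u)\<bar>"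
        using t by (simp add: inner_diff_right right_diff_distrib[symmetric] abs_mult)
      also have "\<dots> \<le> t * (norm G * norm (q - u))" using t Cauchy_Schwarz_ineq2[of G "q - u"] by simp
      also have "\<dots> \<le> t * (norm G * \<eta>)" using t qu by (intro mult_left_mono) auto
      finally have 3: "\<bar>t * (G \<bullet> q) - t * (G \<bullet> u)\<bar> \<le> norm G * \<eta> * t" by (simp add: mult_ac)
      have "\<bar>F y - F x - G \<bullet> (y - x)\<bar> = \<bar>(F (x + t *\<^sub>R u) - F (x + t *\<^sub>R q)) + (F (x + t *\<^sub>R q) - F x - t * (G \<bullet> q)) + (t * (G \<bullet> q) - t * (G \<bullet> u))\<bar>"
        unfolding yx by simp
      also have "\<dots> \<le> K * \<eta> * t + \<eta> * t + norm G * \<eta> * t" using 1 2 3 by linarith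
      also have "\<dots> = (K + norm G + 1) * \<eta> * t" by (simp add: algebra_simps)
      also have "\<dots> = e * t" using pos by (simp add: \<eta>_def)
      finally show ?thesis by (simp add: t_def)
    qed simp
  qed (rule d(1))
qed

text \<open>The partial derivatives give a candidate gradient. Additivity shows, for each fixed
  direction, that it is right almost everywhere; restricting to countably many dense directions
  leaves one common null set.\<close>

lemma Rademacher_real:
  fixes F :: "'a::euclidean_space \<Rightarrow> real"
  assumes lip: "K-lipschitz_on UNIV F"
  shows "negligible {x. \<not> F differentiable (at x)}"
proof -
  define P where "P v x d \<longleftrightarrow> ((\<lambda>t. F (x + t *\<^sub>R v)) has_real_derivative d) (at 0)" for v x d
  have "\<exists>D. AE x in lborel. P v x (D x)" for v
    using lipschitz_measurable_directional_derivative[OF lip, of v] unfolding P_def by metis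
  then obtain D where D: "\<And>v. AE x in lborel. P v x (D v x)" by metis
  have scale: "P (c *\<^sub>R v) x (c * d)" if "P v x d" for c v x d
  proof -
    have "((\<lambda>t. F (x + (c * t) *\<^sub>R v)) has_real_derivative d * c) (at 0)"
    proof (rule DERIV_chain2[where f="\<lambda>s. F (x + s *\<^sub>R v)" and g="\<lambda>t. c * t"])
      show "((\<lambda>s. F (x + s *\<^sub>R v)) has_real_derivative d) (at (c * 0))" using that by (simp add: P_def)
      show "((*) c has_real_derivative c) (at 0)" by (auto intro!: derivative_eq_intros)
    qed
    then show ?thesis by (simp add: P_def mult.commute)
  qed
  define G where "G x = (\<Sum>e\<in>Basis. D e x *\<^sub>R e)" for x
  have sumP: "AE x in lborel. P (\<Sum>e\<in>S. (v \<bullet> e) *\<^sub>R e) x (\<Sum>e\<in>S. (v \<bullet> e) * D e x)" if "finite S" for S v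
    using that
  proof induction
    case empty
    then show ?case by (simp add: P_def)
  next
    case (insert e S)
    have "AE x in lborel. \<forall>d1 d2. P ((v \<bullet> e) *\<^sub>R e) x d1 \<longrightarrow> P (\<Sum>e\<in>S. (v \<bullet> e) *\<^sub>R e) x d2 \<longrightarrow> P ((v \<bullet> e) *\<^sub>R e + (\<Sum>e\<in>S. (v \<bullet> e) *\<^sub>R e)) x (d1 + d2)"
      unfolding P_def by (rule AE_directional_derivative_add[OF lip])
    with insert.IH D[of e] show ?case
    proof eventually_elim
      case (elim x)
      then show ?case using insert.hyps scale by simp
    qed
  qed
  have GP: "AE x in lborel. P v x (G x \<bullet> v)" for v
  proof -
    have "G x \<bullet> v = (\<Sum>e\<in>Basis. (v \<bullet> e) * D e x)" for x
      by (simp add: G_def inner_sum_left inner_commute[of v] mult.commute)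
    then show ?thesis using sumP[OF finite_Basis, of v] by (simp add: euclidean_representation)
  qed
  obtain Q :: "'a set" where Q: "countable Q" "\<And>U. open U \<Longrightarrow> U \<noteq> {} \<Longrightarrow> \<exists>q\<in>Q. q \<in> U"
    using countable_dense_exists[where 'a='a] by blast
  have "AE x in lborel. \<forall>q\<in>Q. P q x (G x \<bullet> q)"
    by (subst AE_ball_countable[OF Q(1)]) (use GP in blast)
  then have "AE x in lborel. F differentiable (at x)"
  proof eventually_elim
    case (elim x)
    then have "(F has_derivative (\<lambda>h. G x \<bullet> h)) (at x)"
      by (intro has_derivative_if_dense_directional[OF lip Q(2)]) (auto simp: P_def)
    then show ?case by (rule differentiableI)
  qed
  then have "AE x in lebesgue. F differentiable (at x)" by (rule AE_completion)
  then show ?thesis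
    by (auto simp: negligible_iff_null_sets eventually_ae_filter intro: null_sets_completion_subset)
qed

theorem Rademacher:
  fixes F :: "'a::euclidean_space \<Rightarrow> 'b::euclidean_space"
  assumes lip: "K-lipschitz_on UNIV F"
  shows "negligible {x. \<not> F differentiable (at x)}"
proof -
  have "negligible {x. \<not> (\<lambda>y. F y \<bullet> i) differentiable (at x)}" if "i \<in> Basis" for i
  proof (rule Rademacher_real)
    show "K-lipschitz_on UNIV (\<lambda>y. F y \<bullet> i)"
    proof (rule lipschitz_onI)
      fix x y :: 'a
      have "\<bar>F x \<bullet> i - F y \<bullet> i\<bar> \<le> norm (F x - F y)"
        using Basis_le_norm[OF that, of "F x - F y"] by (simp add: inner_diff_left)
      then show "dist (F x \<bullet> i) (F y \<bullet> i) \<le> K * dist x y"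
        using lipschitz_onD[OF lip, of x y] by (simp add: dist_real_def dist_norm)
    qed (rule lipschitz_on_nonneg[OF lip])
  qed
  then have "negligible (\<Union>i\<in>Basis. {x. \<not> (\<lambda>y. F y \<bullet> i) differentiable (at x)})"
    by (intro negligible_Union) auto
  then show ?thesis
    by (rule negligible_subset) (auto simp: differentiable_componentwise_within[of F])
qed

section \<open>Integrals of almost everywhere derivatives\<close>

lemma lipschitz_on_norm_deriv_le:
  fixes f :: "real \<Rightarrow> 'b::real_normed_vector"
  assumes lip: "K-lipschitz_on S f" and "open S" "t \<in> S" and D: "(f has_vector_derivative D) (at t)"
  shows "norm D \<le> K"
proof (rule field_le_epsilon)
  fix e :: real assume "e > 0"
  then obtain d where d: "d > 0" "\<And>y. norm (y - t) < d \<Longrightarrow> norm (f y - f t - (y - t) *\<^sub>R D) \<le> e * norm (y - t)"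
    using D unfolding has_vector_derivative_def has_derivative_at_alt by blast
  obtain d' where d': "d' > 0" "ball t d' \<subseteq> S" using assms(2,3) open_contains_ball by blast
  define h where "h = min d d' / 2"
  have h: "h > 0" "h < d" "h < d'" using d d' by (auto simp: h_def)
  then have "t + h \<in> S" using d' by (auto simp: subset_iff dist_real_def)
  then have "norm (f (t + h) - f t) \<le> K * h"
    using lipschitz_onD[OF lip, of "t + h" t] assms(3) h by (simp add: dist_norm)
  moreover have "norm (f (t + h) - f t - h *\<^sub>R D) \<le> e * h" using d(2)[of "t + h"] h by simp
  moreover have "norm (h *\<^sub>R D) \<le> norm (f (t + h) - f t) + norm (f (t + h) - f t - h *\<^sub>R D)"
    using norm_triangle_ineq4[of "f (t + h) - f t" "f (t + h) - f t - h *\<^sub>R D"] by simp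
  ultimately have "h * norm D \<le> h * (K + e)" using h by (simp add: algebra_simps)
  then show "norm D \<le> K + e" using h by simp
qed

lemma has_vector_derivative_sequential:
  fixes f :: "real \<Rightarrow> 'b::real_normed_vector"
  assumes D: "(f has_vector_derivative D) (at t)" and \<eta>: "\<And>j. \<eta> j > 0" "\<eta> \<longlonglongrightarrow> 0"
  shows "(\<lambda>j. (1 / \<eta> j) *\<^sub>R (f (t + \<eta> j) - f t)) \<longlonglongrightarrow> D"
proof (rule LIMSEQ_I)
  fix e :: real assume "e > 0"
  then obtain d where d: "d > 0" "\<And>y. norm (y - t) < d \<Longrightarrow> norm (f y - f t - (y - t) *\<^sub>R D) \<le> e / 2 * norm (y - t)"
    using D unfolding has_vector_derivative_def has_derivative_at_alt by (meson half_gt_zero)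
  obtain n where n: "\<And>j. j \<ge> n \<Longrightarrow> \<eta> j < d" using LIMSEQ_D[OF \<eta>(2) d(1)] by (auto simp: abs_less_iff)
  have "norm ((1 / \<eta> j) *\<^sub>R (f (t + \<eta> j) - f t) - D) < e" if "j \<ge> n" for j
  proof -
    have "(1 / \<eta> j) *\<^sub>R (f (t + \<eta> j) - f t) - D = (1 / \<eta> j) *\<^sub>R (f (t + \<eta> j) - f t - \<eta> j *\<^sub>R D)"
      using \<eta>(1)[of j] by (simp add: scaleR_diff_right)
    moreover have "norm (f (t + \<eta> j) - f t - \<eta> j *\<^sub>R D) \<le> e / 2 * \<eta> j"
      using d(2)[of "t + \<eta> j"] n[OF that] \<eta>(1)[of j] by simp
    ultimately have "norm ((1 / \<eta> j) *\<^sub>R (f (t + \<eta> j) - f t) - D) \<le> e / 2"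
      using \<eta>(1)[of j] by (simp add: pos_divide_le_eq)
    then show ?thesis using \<open>e > 0\<close> by simp
  qed
  then show "\<exists>n. \<forall>j\<ge>n. norm ((1 / \<eta> j) *\<^sub>R (f (t + \<eta> j) - f t) - D) < e" by blast
qed

text \<open>The fundamental theorem of calculus for Lipschitz functions. Difference quotients are
  bounded by \<open>K\<close> and converge almost everywhere, while their integral over
  \<open>{0..s}\<close> telescopes to averages of \<open>f\<close> over short intervals starting at
  \<open>s\<close> and at \<open>0\<close>. Values on the exceptional set are put to zero so that
  convergence holds at every point.\<close>

lemma lipschitz_integral_deriv:
  fixes f :: "real \<Rightarrow> 'b::euclidean_space"
  assumes lip: "K-lipschitz_on {0..1} f" and N: "negligible N"
    and deriv: "\<And>t. t \<in> {0<..<1} \<Longrightarrow> t \<notin> N \<Longrightarrow> (f has_vector_derivative f' t) (at t)"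
  defines "g \<equiv> \<lambda>t. if t \<in> N \<union> {0, 1} then 0 else f' t"
  shows "g absolutely_integrable_on {0..1}"
    and "\<And>s. s \<in> {0..1} \<Longrightarrow> norm (f s - f 0) \<le> integral {0..1} (\<lambda>t. norm (g t))"
proof -
  have K: "K \<ge> 0" by (rule lipschitz_on_nonneg[OF lip])
  \<comment> \<open>Constant extension beyond \<open>{0..1}\<close>: forward difference quotients
    make sense up to time \<open>1\<close>, and the constant \<open>K\<close> is kept.\<close>
  define fh where "fh t = f (max 0 (min 1 t))" for t
  have lipfh: "norm (fh s - fh t) \<le> K * \<bar>s - t\<bar>" for s t
  proof -
    have "norm (fh s - fh t) \<le> K * \<bar>max 0 (min 1 s) - max 0 (min 1 t)\<bar>"
      using lipschitz_onD[OF lip, of "max 0 (min 1 s)" "max 0 (min 1 t)"] by (simp add: fh_def dist_norm)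
    also have "\<dots> \<le> K * \<bar>s - t\<bar>" using K by (intro mult_left_mono) (auto simp: max_def min_def)
    finally show ?thesis .
  qed
  have "K-lipschitz_on UNIV fh" using lipfh K by (intro lipschitz_onI) (auto simp: dist_norm)
  then have cont: "continuous_on A fh" for A
    using lipschitz_on_continuous_on continuous_on_subset by blast
  define \<eta> where "\<eta> j = inverse (real (Suc j))" for j
  have \<eta>: "\<eta> j > 0" for j by (simp add: \<eta>_def)
  have \<eta>lim: "\<eta> \<longlonglongrightarrow> 0" unfolding \<eta>_def by (rule LIMSEQ_inverse_real_of_nat)
  define q where "q j t = (1 / \<eta> j) *\<^sub>R (fh (t + \<eta> j) - fh t)" for j t
  define q' where "q' j t = (if t \<in> N \<union> {0, 1} then 0 else q j t)" for j t
  have N01: "negligible (N \<union> {0, 1})" using N by simp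
  have qbd: "norm (q j t) \<le> K" for j t
    using lipfh[of "t + \<eta> j" t] \<eta>[of j] by (simp add: q_def divide_simps mult.commute)
  have cont': "continuous_on A (\<lambda>t. fh (t + c))" for A c
    by (rule continuous_on_compose2[OF cont[of UNIV]]) (auto intro!: continuous_intros)
  have qint: "q j integrable_on {0..s}" for j s
    unfolding q_def by (intro integrable_continuous_real continuous_intros cont cont')
  have q'int: "q' j integrable_on {0..s}" for j s
    by (rule integrable_spike[OF qint N01]) (simp add: q'_def)
  have qlim: "(\<lambda>j. q' j t) \<longlonglongrightarrow> g t" if t: "t \<in> {0..1}" for t
  proof (cases "t \<in> N \<union> {0, 1}")
    case False
    then have t': "t \<in> {0<..<1}" "t \<notin> N" using t by auto
    have "((\<lambda>x. f x) has_vector_derivative f' t) (at t)" using deriv t' by simp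
    then have "(fh has_vector_derivative f' t) (at t)"
      by (rule has_vector_derivative_transform_within_open[of _ _ _ "{0<..<1}"]) (use t' in \<open>auto simp: fh_def\<close>)
    then have "(\<lambda>j. q j t) \<longlonglongrightarrow> f' t" unfolding q_def
      by (rule has_vector_derivative_sequential[OF _ \<eta> \<eta>lim])
    then show ?thesis using False by (simp add: q'_def g_def)
  qed (simp add: q'_def g_def)
  have q'bd: "norm (q' j t) \<le> K" for j t using qbd K by (simp add: q'_def)
  have gbd: "norm (g t) \<le> K" if "t \<in> {0..1}" for t
    by (rule LIMSEQ_le_const2[OF tendsto_norm[OF qlim[OF that]]]) (use q'bd in auto)
  have gint: "g integrable_on {0..s}" and glim: "(\<lambda>j. integral {0..s} (q' j)) \<longlonglongrightarrow> integral {0..s} g"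
    if s: "s \<in> {0..1}" for s
    by (rule dominated_convergence[where h="\<lambda>_. K" and f=q']; use q'int q'bd qlim s in auto)+
  show gabs: "g absolutely_integrable_on {0..1}"
    by (rule absolutely_integrable_integrable_bound[where g="\<lambda>_. K"]) (use gbd gint[of 1] in auto)
  show "norm (f s - f 0) \<le> integral {0..1} (\<lambda>t. norm (g t))" if s: "s \<in> {0..1}" for s
  proof -
    have avg: "norm ((1 / \<eta> j) *\<^sub>R integral {a..a + \<eta> j} fh - fh a) \<le> K * \<eta> j" for a j
    proof -
      have "integral {a..a + \<eta> j} fh - \<eta> j *\<^sub>R fh a = integral {a..a + \<eta> j} (\<lambda>t. fh t - fh a)"
        using \<eta>[of j] by (subst integral_diff) (auto intro!: integrable_continuous_real cont)
      moreover have "norm (integral {a..a + \<eta> j} (\<lambda>t. fh t - fh a)) \<le> (K * \<eta> j) * (a + \<eta> j - a)"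
      proof (rule integral_bound)
        fix t assume "t \<in> {a..a + \<eta> j}"
        then have "K * \<bar>t - a\<bar> \<le> K * \<eta> j" using K by (intro mult_left_mono) auto
        then show "norm (fh t - fh a) \<le> K * \<eta> j" using lipfh[of t a] by linarith
      qed (use \<eta>[of j] in \<open>auto intro!: continuous_intros cont\<close>)
      ultimately have le: "norm (integral {a..a + \<eta> j} fh - \<eta> j *\<^sub>R fh a) \<le> K * \<eta> j * \<eta> j" by simp
      have "(1 / \<eta> j) *\<^sub>R integral {a..a + \<eta> j} fh - fh a = (1 / \<eta> j) *\<^sub>R (integral {a..a + \<eta> j} fh - \<eta> j *\<^sub>R fh a)"
        using \<eta>[of j] by (simp add: scaleR_diff_right)
      then show ?thesis using le \<eta>[of j] by (simp add: pos_divide_le_eq)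
    qed
    have avglim: "(\<lambda>j. (1 / \<eta> j) *\<^sub>R integral {a..a + \<eta> j} fh) \<longlonglongrightarrow> fh a" for a
    proof -
      have "(\<lambda>j. K * \<eta> j) \<longlonglongrightarrow> 0" using tendsto_mult_right_zero[OF \<eta>lim] by simp
      then have "(\<lambda>j. (1 / \<eta> j) *\<^sub>R integral {a..a + \<eta> j} fh - fh a) \<longlonglongrightarrow> 0"
        by (rule Lim_null_comparison[rotated]) (use avg in auto)
      then show ?thesis by (simp add: LIM_zero_iff)
    qed
    have "integral {0..s} (q' j) = (1 / \<eta> j) *\<^sub>R integral {s..s + \<eta> j} fh - (1 / \<eta> j) *\<^sub>R integral {0..0 + \<eta> j} fh" for j
    proof -
      have "integral {0..s} (q' j) = integral {0..s} (q j)"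
        by (rule integral_spike[OF N01]) (simp add: q'_def)
      also have "\<dots> = (1 / \<eta> j) *\<^sub>R (integral {0..s} (\<lambda>t. fh (t + \<eta> j)) - integral {0..s} fh)"
        unfolding q_def by (subst integral_cmul, subst integral_diff) (auto intro!: integrable_continuous_real cont cont')
      also have "integral {0..s} (\<lambda>t. fh (t + \<eta> j)) = integral {\<eta> j..s + \<eta> j} fh"
        using integral_shift_real_ivl[of "\<eta> j" "\<eta> j" "s + \<eta> j" fh] by simp
      also have "integral {\<eta> j..s + \<eta> j} fh - integral {0..s} fh = integral {s..s + \<eta> j} fh - integral {0..\<eta> j} fh"
      proof -
        have I: "fh integrable_on {a..b}" for a b by (rule integrable_continuous_real[OF cont])
        have "integral {0..\<eta> j} fh + integral {\<eta> j..s + \<eta> j} fh = integral {0..s + \<eta> j} fh"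
          by (rule Henstock_Kurzweil_Integration.integral_combine) (use \<eta>[of j] s I in auto)
        moreover have "integral {0..s} fh + integral {s..s + \<eta> j} fh = integral {0..s + \<eta> j} fh"
          by (rule Henstock_Kurzweil_Integration.integral_combine) (use \<eta>[of j] s I in auto)
        ultimately have "integral {\<eta> j..s + \<eta> j} fh = integral {0..s + \<eta> j} fh - integral {0..\<eta> j} fh"
          "integral {s..s + \<eta> j} fh = integral {0..s + \<eta> j} fh - integral {0..s} fh"
          by (simp_all add: eq_diff_eq add.commute)
        then show ?thesis by simp
      qed
      finally show ?thesis by (simp add: scaleR_diff_right)
    qed
    then have "(\<lambda>j. integral {0..s} (q' j)) \<longlonglongrightarrow> fh s - fh 0"
      using tendsto_diff[OF avglim[of s] avglim[of 0]] by simp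
    then have "integral {0..s} g = fh s - fh 0" using glim[OF s] LIMSEQ_unique by blast
    then have "norm (f s - f 0) = norm (integral {0..s} g)" using s by (simp add: fh_def)
    also have "\<dots> \<le> integral {0..s} (\<lambda>t. norm (g t))"
    proof (rule integral_norm_bound_integral)
      show "(\<lambda>t. norm (g t)) integrable_on {0..s}"
        using absolutely_integrable_on_subinterval[OF gabs, of 0 s] s by (auto simp: absolutely_integrable_on_def)
    qed (use gint[OF s] in auto)
    also have "\<dots> \<le> integral {0..1} (\<lambda>t. norm (g t))"
      by (rule integral_subset_le)
         (use s gabs absolutely_integrable_on_subinterval[OF gabs, of 0 s] in \<open>auto simp: absolutely_integrable_on_def\<close>)
    finally show ?thesis .
  qed
qed

lemma vector_derivative_norm_bound:
  fixes f :: "real \<Rightarrow> 'b::real_normed_vector"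
  assumes "\<And>t. t \<in> {a..b} \<Longrightarrow> (f has_vector_derivative f' t) (at t within {a..b})"
    and B: "\<And>t. t \<in> {a..b} \<Longrightarrow> norm (f' t) \<le> B" and "s \<in> {a..b}" "t \<in> {a..b}"
  shows "norm (f s - f t) \<le> B * \<bar>s - t\<bar>"
proof -
  have "norm (f s - f t) \<le> B * norm (s - t)"
  proof (rule differentiable_bound[OF convex_real_interval(5)])
    show "(f has_derivative (\<lambda>h. h *\<^sub>R f' x)) (at x within {a..b})" if "x \<in> {a..b}" for x
      using assms(1)[OF that] by (simp add: has_vector_derivative_def)
    show "onorm (\<lambda>h. h *\<^sub>R f' x) \<le> B" if "x \<in> {a..b}" for x
      by (rule onorm_bound) (use B[OF that] order_trans[OF norm_ge_zero B[OF that]] in \<open>auto simp: mult.commute[of B] intro: mult_left_mono\<close>)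
  qed (use assms in auto)
  then show ?thesis by simp
qed

text \<open>The error \<open>r\<close> tends to zero at each time but not uniformly, so it cannot be
  inserted into a bound for the maximum \<open>S k\<close>. The excess of the derivative over
  \<open>S k / 2 + c\<close>, however, has integral tending to zero by dominated convergence.
  Evaluated where the maximum is attained, this gives \<open>S k \<le> S k / 2 + c + e / 2\<close>,
  and half of \<open>S k\<close> is absorbed.\<close>

lemma lipschitz_family_AE_deriv_limit:
  fixes f :: "nat \<Rightarrow> real \<Rightarrow> 'b::euclidean_space"
  assumes lip: "\<And>k. B-lipschitz_on {0..1} (f k)" and f0: "\<And>k. f k 0 = 0" and N: "negligible N"
    and S: "\<And>k t. t \<in> {0..1} \<Longrightarrow> norm (f k t) \<le> S k" "\<And>k. \<exists>t\<in>{0..1}. norm (f k t) = S k"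
    and deriv: "\<And>t. t \<in> {0<..<1} \<Longrightarrow> t \<notin> N \<Longrightarrow>
      \<exists>r. r \<longlonglongrightarrow> 0 \<and> (\<forall>k. \<exists>D. (f k has_vector_derivative D) (at t) \<and> norm D \<le> S k / 2 + c + r k)"
    and "c \<ge> 0" "e > 0"
  shows "\<forall>\<^sub>F k in sequentially. norm (f k 1) \<le> 2 * c + e"
proof -
  have B: "B \<ge> 0" by (rule lipschitz_on_nonneg[OF lip])
  have S0: "S k \<ge> 0" for k using S(2)[of k] norm_ge_zero by metis
  define f' where "f' k t = vector_derivative (f k) (at t)" for k t
  have f': "(f k has_vector_derivative f' k t) (at t)" if "t \<in> {0<..<1}" "t \<notin> N" for k t
    using deriv[OF that] vector_derivative_works unfolding f'_def differentiable_def has_vector_derivative_def by blast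
  define g where "g k t = (if t \<in> N \<union> {0, 1} then 0 else f' k t)" for k t
  have gabs: "g k absolutely_integrable_on {0..1}" for k
    using lipschitz_integral_deriv(1)[OF lip N f'] unfolding g_def by simp
  have gle: "norm (f k s) \<le> integral {0..1} (\<lambda>t. norm (g k t))" if "s \<in> {0..1}" for k s
    using lipschitz_integral_deriv(2)[OF lip N f' that, of k] f0[of k] unfolding g_def by simp
  \<comment> \<open>Since the nonnegative \<open>S k / 2 + c\<close> is subtracted, the excess stays
    dominated by the Lipschitz constant \<open>B\<close>, whatever the size of
    \<open>S k\<close>.\<close>
  define h where "h k t = max 0 (norm (g k t) - (S k / 2 + c))" for k t
  have gbd: "norm (g k t) \<le> B" if "t \<in> {0..1}" for k t
  proof (cases "t \<in> N \<union> {0, 1}")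
    case False
    then show ?thesis
      using lipschitz_on_norm_deriv_le[OF lipschitz_on_subset[OF lip] _ _ f', of "{0<..<1}" t k] that
        greaterThanLessThan_subseteq_atLeastAtMost_iff[of 0 1 "0::real" 1]
      by (auto simp: g_def)
  qed (use B in \<open>simp add: g_def\<close>)
  have ng: "(\<lambda>t. norm (g k t)) absolutely_integrable_on {0..1}" for k
    by (rule absolutely_integrable_norm[OF gabs, unfolded o_def])
  have hint: "h k integrable_on {0..1}" for k
  proof -
    have "(\<lambda>t. norm (g k t) - (S k / 2 + c)) absolutely_integrable_on {0..1}"
      by (rule set_integral_diff(1)[OF ng]) (auto intro: absolutely_integrable_on_const)
    then have "h k absolutely_integrable_on {0..1}" unfolding h_def
      by (intro absolutely_integrable_max_1) (auto intro: absolutely_integrable_on_const)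
    then show ?thesis by (simp add: absolutely_integrable_on_def)
  qed
  have h0: "h k t \<ge> 0" for k t by (simp add: h_def)
  have hlim: "(\<lambda>k. h k t) \<longlonglongrightarrow> 0" if t: "t \<in> {0..1}" for t
  proof (cases "t \<in> N \<union> {0, 1}")
    case True
    then have "h k t = 0" for k using S0[of k] \<open>c \<ge> 0\<close> by (simp add: h_def g_def)
    then show ?thesis by simp
  next
    case False
    then have t': "t \<in> {0<..<1}" "t \<notin> N" using t by auto
    obtain r where r: "r \<longlonglongrightarrow> 0" "\<And>k. \<exists>D. (f k has_vector_derivative D) (at t) \<and> norm D \<le> S k / 2 + c + r k"
      using deriv[OF t'] by blast
    have "norm (f' k t) \<le> S k / 2 + c + r k" for k
      using r(2)[of k] f'[OF t', of k] vector_derivative_unique_at by metis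
    then have "h k t \<le> \<bar>r k\<bar>" for k using False by (simp add: h_def g_def) (smt (verit, best))
    then have "norm (h k t) \<le> \<bar>r k\<bar>" for k using h0[of k t] by simp
    moreover have "(\<lambda>k. \<bar>r k\<bar>) \<longlonglongrightarrow> 0" using tendsto_rabs[OF r(1)] by simp
    ultimately show ?thesis by (intro Lim_null_comparison[of "\<lambda>k. h k t" "\<lambda>k. \<bar>r k\<bar>"]) auto
  qed
  have hB: "norm (h k t) \<le> B" if "t \<in> {0..1}" for k t
    using gbd[OF that, of k] S0[of k] \<open>c \<ge> 0\<close> B by (simp add: h_def)
  have "(\<lambda>k. integral {0..1} (h k)) \<longlonglongrightarrow> integral {0..1} (\<lambda>_::real. 0::real)"
    by (rule dominated_convergence(2)[where h="\<lambda>_. B"]) (use hint hB hlim in auto)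
  then have "(\<lambda>k. integral {0..1} (h k)) \<longlonglongrightarrow> 0" by simp
  then have "\<forall>\<^sub>F k in sequentially. integral {0..1} (h k) < e / 2" using \<open>e > 0\<close> by (intro order_tendstoD) auto
  then show ?thesis
  proof eventually_elim
    case (elim k)
    have "integral {0..1} (\<lambda>t. norm (g k t)) \<le> integral {0..1} (\<lambda>t. (S k / 2 + c) + h k t)"
    proof (rule integral_le)
      show "norm (g k t) \<le> S k / 2 + c + h k t" for t by (simp add: h_def)
    qed (use ng[of k] hint[of k] in \<open>auto simp: absolutely_integrable_on_def intro!: integrable_add\<close>)
    also have "\<dots> = S k / 2 + c + integral {0..1} (h k)"
      by (subst integral_add) (use hint[of k] in auto)
    finally have I: "integral {0..1} (\<lambda>t. norm (g k t)) \<le> S k / 2 + c + integral {0..1} (h k)" .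
    obtain s where "s \<in> {0..1}" "norm (f k s) = S k" using S(2) by blast
    then have "S k \<le> S k / 2 + c + e / 2" using gle[of s k] I elim by simp
    then have "S k \<le> 2 * c + e" by simp
    then show ?case using S(1)[of 1 k] by simp
  qed
qed

section \<open>Flows of a Lipschitz frame\<close>

text \<open>Fields \<open>Z _ v\<close> depending linearly on a direction \<open>v\<close>. The
  bounds hold on the whole space, so that trajectories never leave the domain. \<open>P\<close> is
  the horizontal projection; \<open>P_Z\<close> prescribes the horizontal velocity, which is what
  later makes the parameter of a trajectory readable from its endpoint.\<close>

locale horizontal_frame =
  fixes Z :: "'a::euclidean_space \<Rightarrow> 'a \<Rightarrow> 'a" and P :: "'a \<Rightarrow> 'a" and K M :: real
  assumes linear_Z: "linear (Z x)" and norm_Z: "norm (Z x v) \<le> M * norm v"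
    and lipschitz_Z: "norm (Z x v - Z y v) \<le> K * norm (x - y) * norm v"
    and K_nonneg: "K \<ge> 0" and M_nonneg: "M \<ge> 0"
    and linear_P: "linear P" and P_idem: "P (P x) = P x"
    and norm_P: "norm (P x) \<le> norm x" and norm_P_compl: "norm (x - P x) \<le> norm x"
    and P_Z: "P (Z x v) = P v"
begin

definition is_sol :: "'a \<Rightarrow> 'a \<Rightarrow> (real \<Rightarrow> 'a) \<Rightarrow> bool" where
  "is_sol v x \<gamma> \<longleftrightarrow> \<gamma> 0 = x \<and>
     (\<forall>t\<in>{0..1}. (\<gamma> has_vector_derivative Z (\<gamma> t) v) (at t within {0..1}))"

definition flow :: "'a \<Rightarrow> 'a \<Rightarrow> real \<Rightarrow> 'a" where
  "flow v x = (SOME \<gamma>. is_sol v x \<gamma>)"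

lemma continuous_Z: "continuous_on A (\<lambda>x. Z x v)"
proof (rule lipschitz_on_continuous_on)
  show "(K * norm v)-lipschitz_on A (\<lambda>x. Z x v)"
    using lipschitz_Z K_nonneg by (intro lipschitz_onI) (auto simp: dist_norm mult_ac)
qed

text \<open>Picard iteration on bounded continuous maps of the whole line, with time clamped to the
  unit interval by \<open>c\<close>. The smallness of \<open>v\<close> makes the integral operator a
  contraction with factor one half over the full unit time.\<close>

lemma is_sol_exists:
  assumes v: "K * norm v \<le> 1 / 2"
  shows "\<exists>\<gamma>. is_sol v x \<gamma>"
proof -
  define c :: "real \<Rightarrow> real" where "c t = max 0 (min 1 t)" for t
  have c: "c t \<in> {0..1}" for t by (auto simp: c_def)
  define F where "F \<gamma> t = x + integral {0..c t} (\<lambda>s. Z (apply_bcontfun \<gamma> s) v)" for \<gamma> :: "real \<Rightarrow>\<^sub>C 'a" and t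
  have contI: "continuous_on A (\<lambda>s. Z (apply_bcontfun \<gamma> s) v)" for A and \<gamma> :: "real \<Rightarrow>\<^sub>C 'a"
    by (rule continuous_on_compose2[OF continuous_Z[of UNIV v]]) auto
  have int: "(\<lambda>s. Z (apply_bcontfun \<gamma> s) v) integrable_on {a..b}" for \<gamma> :: "real \<Rightarrow>\<^sub>C 'a" and a b
    by (rule integrable_continuous_real[OF contI])
  have Fb: "F \<gamma> \<in> bcontfun" for \<gamma>
  proof (rule bcontfun_normI)
    have "continuous_on {0..1} (\<lambda>u. integral {0..u} (\<lambda>s. Z (apply_bcontfun \<gamma> s) v))"
      by (rule indefinite_integral_continuous_1[OF int])
    then have "continuous_on UNIV (\<lambda>t. integral {0..c t} (\<lambda>s. Z (apply_bcontfun \<gamma> s) v))"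
      by (rule continuous_on_compose2) (use c in \<open>auto simp: c_def intro!: continuous_intros\<close>)
    then show "continuous_on UNIV (F \<gamma>)" unfolding F_def by (intro continuous_intros)
    fix t
    have "norm (integral {0..c t} (\<lambda>s. Z (apply_bcontfun \<gamma> s) v)) \<le> (M * norm v) * (c t - 0)"
      by (rule integral_bound) (use c[of t] contI norm_Z in auto)
    also have "\<dots> \<le> M * norm v" using c[of t] M_nonneg by (simp add: mult_left_le)
    finally show "norm (F \<gamma> t) \<le> norm x + M * norm v"
      unfolding F_def using norm_triangle_ineq[of x "integral {0..c t} (\<lambda>s. Z (apply_bcontfun \<gamma> s) v)"] by linarith
  qed
  have "\<exists>!\<gamma>. Bcontfun (F \<gamma>) = \<gamma>"
  proof (rule banach_fix_type[of "1/2"])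
    show "\<forall>\<gamma> \<delta>. dist (Bcontfun (F \<gamma>)) (Bcontfun (F \<delta>)) \<le> 1/2 * dist \<gamma> \<delta>"
    proof (intro allI dist_bound)
      fix \<gamma> \<delta> t
      have "dist (F \<gamma> t) (F \<delta> t) = norm (integral {0..c t} (\<lambda>s. Z (apply_bcontfun \<gamma> s) v - Z (apply_bcontfun \<delta> s) v))"
        unfolding F_def dist_norm using int by (subst integral_diff) auto
      also have "\<dots> \<le> (1/2 * dist \<gamma> \<delta>) * (c t - 0)"
      proof (rule integral_bound)
        fix s
        have "norm (Z (apply_bcontfun \<gamma> s) v - Z (apply_bcontfun \<delta> s) v) \<le> K * norm v * norm (apply_bcontfun \<gamma> s - apply_bcontfun \<delta> s)"
          using lipschitz_Z[of "apply_bcontfun \<gamma> s" v "apply_bcontfun \<delta> s"] by (simp add: mult_ac)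
        also have "\<dots> \<le> 1/2 * dist \<gamma> \<delta>"
          using v dist_bounded[of \<gamma> s \<delta>] by (intro mult_mono) (auto simp: dist_norm)
        finally show "norm (Z (apply_bcontfun \<gamma> s) v - Z (apply_bcontfun \<delta> s) v) \<le> 1/2 * dist \<gamma> \<delta>" .
      qed (use c[of t] contI in \<open>auto intro!: continuous_intros\<close>)
      also have "\<dots> \<le> 1/2 * dist \<gamma> \<delta>" using c[of t] by (simp add: mult_left_le)
      finally show "dist (apply_bcontfun (Bcontfun (F \<gamma>)) t) (apply_bcontfun (Bcontfun (F \<delta>)) t) \<le> 1/2 * dist \<gamma> \<delta>"
        using Fb by (simp add: Bcontfun_inverse)
    qed
  qed auto
  then obtain \<gamma> where "Bcontfun (F \<gamma>) = \<gamma>" by blast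
  then have eq: "apply_bcontfun \<gamma> = F \<gamma>" using Fb Bcontfun_inverse by metis
  have "is_sol v x (apply_bcontfun \<gamma>)"
    unfolding is_sol_def
  proof
    show "apply_bcontfun \<gamma> 0 = x" by (subst eq) (simp add: F_def c_def)
    show "\<forall>t\<in>{0..1}. (apply_bcontfun \<gamma> has_vector_derivative Z (apply_bcontfun \<gamma> t) v) (at t within {0..1})"
    proof
      fix t :: real assume t: "t \<in> {0..1}"
      have "((\<lambda>u. x + integral {0..u} (\<lambda>s. Z (apply_bcontfun \<gamma> s) v)) has_vector_derivative Z (apply_bcontfun \<gamma> t) v) (at t within {0..1})"
        using integral_has_vector_derivative[OF contI t] by (auto intro!: derivative_eq_intros)
      then show "(apply_bcontfun \<gamma> has_vector_derivative Z (apply_bcontfun \<gamma> t) v) (at t within {0..1})"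
        by (rule has_vector_derivative_transform[OF t, rotated]) (subst eq, simp add: F_def c_def)
    qed
  qed
  then show ?thesis by blast
qed

lemma flow_is_sol: "K * norm v \<le> 1 / 2 \<Longrightarrow> is_sol v x (flow v x)"
  unfolding flow_def using someI_ex[OF is_sol_exists] .

text \<open>The maximum of the difference over \<open>{0..1}\<close> is at most the initial
  difference, plus half of itself, plus \<open>M * norm (v - w)\<close>; absorbing the half gives
  the factor two. Uniqueness is the case of equal data.\<close>

lemma is_sol_dependence:
  assumes v: "K * norm v \<le> 1 / 2" and s1: "is_sol v x \<gamma>" and s2: "is_sol w y \<delta>" and t: "t \<in> {0..1}"
  shows "norm (\<gamma> t - \<delta> t) \<le> 2 * (norm (x - y) + M * norm (v - w))"
proof -
  define f where "f t = \<gamma> t - \<delta> t" for t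
  have d: "(f has_vector_derivative (Z (\<gamma> t) v - Z (\<delta> t) w)) (at t within {0..1})" if "t \<in> {0..1}" for t
    unfolding f_def using s1 s2 that by (auto simp: is_sol_def intro!: derivative_intros)
  have "continuous_on {0..1} f"
    by (rule continuous_on_vector_derivative[OF d])
  then have "continuous_on {0..1} (\<lambda>t. norm (f t))" by (rule continuous_on_norm)
  then have "\<exists>m\<in>{0..1}. \<forall>t\<in>{0..1}. norm (f t) \<le> norm (f m)"
    by (intro continuous_attains_sup) auto
  then obtain m where m: "m \<in> {0..1}" "\<And>t. t \<in> {0..1} \<Longrightarrow> norm (f t) \<le> norm (f m)"
    by blast
  have "norm (f m - f 0) \<le> (norm (f m) / 2 + M * norm (v - w)) * \<bar>m - 0\<bar>"
  proof (rule vector_derivative_norm_bound[OF d])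
    fix t :: real assume t: "t \<in> {0..1}"
    have "Z (\<gamma> t) v - Z (\<delta> t) w = (Z (\<gamma> t) v - Z (\<delta> t) v) + Z (\<delta> t) (v - w)"
      by (simp add: linear_diff[OF linear_Z])
    then have "norm (Z (\<gamma> t) v - Z (\<delta> t) w) \<le> norm (Z (\<gamma> t) v - Z (\<delta> t) v) + norm (Z (\<delta> t) (v - w))"
      by (metis norm_triangle_ineq)
    also have "\<dots> \<le> K * norm v * norm (f t) + M * norm (v - w)"
      using lipschitz_Z[of "\<gamma> t" v "\<delta> t"] norm_Z[of "\<delta> t" "v - w"] by (simp add: f_def mult_ac)
    also have "K * norm v * norm (f t) \<le> 1/2 * norm (f m)"
      using v m(2)[OF t] by (intro mult_mono) auto
    finally show "norm (Z (\<gamma> t) v - Z (\<delta> t) w) \<le> norm (f m) / 2 + M * norm (v - w)" by simp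
  qed (use m in auto)
  also have "\<dots> \<le> norm (f m) / 2 + M * norm (v - w)"
    using m(1) M_nonneg by (simp add: mult_left_le)
  finally have "norm (f m) \<le> norm (f 0) + norm (f m) / 2 + M * norm (v - w)"
    using norm_triangle_ineq2[of "f m" "f 0"] by linarith
  moreover have "f 0 = x - y" using s1 s2 by (simp add: f_def is_sol_def)
  ultimately have "norm (f m) \<le> 2 * (norm (x - y) + M * norm (v - w))" by simp
  then show ?thesis using m(2)[OF t] by (simp add: f_def)
qed

lemma is_sol_unique:
  assumes "K * norm v \<le> 1 / 2" "is_sol v x \<gamma>" "is_sol v x \<delta>" "t \<in> {0..1}"
  shows "\<gamma> t = \<delta> t"
  using is_sol_dependence[OF assms] by simp

lemma flow_zero: "K * norm v \<le> 1 / 2 \<Longrightarrow> flow v x 0 = x"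
  using flow_is_sol by (simp add: is_sol_def)

lemma flow_deriv:
  "K * norm v \<le> 1 / 2 \<Longrightarrow> t \<in> {0..1} \<Longrightarrow>
    (flow v x has_vector_derivative Z (flow v x t) v) (at t within {0..1})"
  using flow_is_sol by (simp add: is_sol_def)

lemma flow_lipschitz:
  assumes "K * norm v \<le> 1 / 2" "s \<in> {0..1}" "t \<in> {0..1}"
  shows "norm (flow v x s - flow v x t) \<le> M * norm v * \<bar>s - t\<bar>"
  by (rule vector_derivative_norm_bound[OF flow_deriv[OF assms(1)]]) (use norm_Z assms in auto)

lemma flow_dependence:
  assumes "K * norm v \<le> 1 / 2" "K * norm w \<le> 1 / 2" "t \<in> {0..1}"
  shows "norm (flow v x t - flow w y t) \<le> 2 * (norm (x - y) + M * norm (v - w))"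
  using is_sol_dependence flow_is_sol assms by blast

text \<open>By \<open>P_Z\<close> the horizontal velocity along a trajectory is the constant
  \<open>P v\<close>, so subtracting \<open>t *\<^sub>R P v\<close> leaves a map with zero
  derivative.\<close>

lemma P_flow:
  assumes v: "K * norm v \<le> 1 / 2" and t: "t \<in> {0..1}"
  shows "P (flow v x t) = P x + t *\<^sub>R P v"
proof -
  interpret bl: bounded_linear P using linear_P by (simp add: linear_conv_bounded_linear)
  have "norm ((P (flow v x t) - t *\<^sub>R P v) - (P (flow v x 0) - 0 *\<^sub>R P v)) \<le> 0 * \<bar>t - 0\<bar>"
  proof (rule vector_derivative_norm_bound[where f'="\<lambda>t. P (Z (flow v x t) v) - 1 *\<^sub>R P v" and a=0 and b=1])
    fix t :: real assume "t \<in> {0..1}"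
    then show "((\<lambda>t. P (flow v x t) - t *\<^sub>R P v) has_vector_derivative P (Z (flow v x t) v) - 1 *\<^sub>R P v) (at t within {0..1})"
      using bl.has_vector_derivative[OF flow_deriv[OF v]]
      by (intro derivative_intros has_vector_derivative_scaleR has_vector_derivative_eq_rhs[OF has_vector_derivative_diff])
         (auto intro!: derivative_eq_intros)
  qed (use t P_Z in auto)
  then show ?thesis using flow_zero[OF v] by (simp add: algebra_simps)
qed

lemma K_norm_scale: "K * norm v \<le> 1 / 2 \<Longrightarrow> \<bar>s\<bar> \<le> 1 \<Longrightarrow> K * norm (s *\<^sub>R v) \<le> 1 / 2"
  using mult_right_mono[of "\<bar>s\<bar>" 1 "K * norm v"] K_nonneg by (simp add: mult_ac)

lemma flow_scale:
  assumes v: "K * norm v \<le> 1 / 2" and s: "s \<in> {0..1}" and t: "t \<in> {0..1}"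
  shows "flow (s *\<^sub>R v) x t = flow v x (s * t)"
proof (rule is_sol_unique[where \<gamma>="flow (s *\<^sub>R v) x" and \<delta>="\<lambda>t. flow v x (s * t)", OF K_norm_scale[OF v]])
  show "is_sol (s *\<^sub>R v) x (flow (s *\<^sub>R v) x)" by (rule flow_is_sol[OF K_norm_scale[OF v]]) (use s in auto)
  have "((\<lambda>t. flow v x (s * t)) has_vector_derivative Z (flow v x (s * t)) (s *\<^sub>R v)) (at t within {0..1})"
    if t: "t \<in> {0..1}" for t
  proof -
    have st: "s * t \<in> {0..1}" using s t by (auto simp: mult_le_one)
    have "((flow v x \<circ> (\<lambda>t. s * t)) has_vector_derivative s *\<^sub>R Z (flow v x (s * t)) v) (at t within {0..1})"
    proof (rule vector_diff_chain_within)
      show "((\<lambda>t. s * t) has_vector_derivative s) (at t within {0..1})"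
        by (auto intro!: derivative_eq_intros simp: has_real_derivative_iff_has_vector_derivative[symmetric])
      have "(\<lambda>t. s * t) ` {0..1} \<subseteq> {0..1}" using s by (auto simp: mult_le_one)
      then show "(flow v x has_vector_derivative Z (flow v x (s * t)) v) (at (s * t) within (\<lambda>t. s * t) ` {0..1})"
        using flow_deriv[OF v st] has_vector_derivative_within_subset by blast
    qed
    then show ?thesis by (simp add: o_def linear_cmul[OF linear_Z])
  qed
  then show "is_sol (s *\<^sub>R v) x (\<lambda>t. flow v x (s * t))"
    unfolding is_sol_def using flow_zero[OF v] by auto
qed (use s t in auto)

lemma flow_reverse:
  assumes v: "K * norm v \<le> 1 / 2"
  shows "flow (- v) (flow v x 1) 1 = x"
proof -
  have v': "K * norm (- v) \<le> 1 / 2" using v by simp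
  have "((\<lambda>t. flow v x (1 - t)) has_vector_derivative Z (flow v x (1 - t)) (- v)) (at t within {0..1})"
    if t: "t \<in> {0..1}" for t
  proof -
    have st: "1 - t \<in> {0..1}" using t by auto
    have "((flow v x \<circ> (\<lambda>t. 1 - t)) has_vector_derivative (- 1) *\<^sub>R Z (flow v x (1 - t)) v) (at t within {0..1})"
    proof (rule vector_diff_chain_within)
      show "((\<lambda>t. 1 - t) has_vector_derivative - 1) (at t within {0..1})"
        by (auto intro!: derivative_eq_intros simp: has_real_derivative_iff_has_vector_derivative[symmetric])
      have "(\<lambda>t. 1 - t) ` {0..1} \<subseteq> {0..1::real}" by auto
      then show "(flow v x has_vector_derivative Z (flow v x (1 - t)) v) (at (1 - t) within (\<lambda>t. 1 - t) ` {0..1})"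
        using flow_deriv[OF v st] has_vector_derivative_within_subset by blast
    qed
    then show ?thesis by (simp add: o_def linear_neg[OF linear_Z])
  qed
  then have "is_sol (- v) (flow v x 1) (\<lambda>t. flow v x (1 - t))" unfolding is_sol_def by auto
  then have "flow (- v) (flow v x 1) 1 = flow v x (1 - 1)"
    using is_sol_unique[OF v' flow_is_sol[OF v']] by auto
  then show ?thesis using flow_zero[OF v] by simp
qed

end

section \<open>Integral surfaces of involutive frames\<close>

text \<open>The set where the inequality fails is open, and a nonempty open set is not null. In this
  way estimates along almost every trajectory reach the trajectories that start at
  \<open>x0\<close>.\<close>

lemma AE_le_imp_le:
  fixes f g :: "'a::euclidean_space \<Rightarrow> real"
  assumes "open U" "continuous_on U f" "continuous_on U g" "negligible N"
    and le: "\<And>x. x \<in> U \<Longrightarrow> x \<notin> N \<Longrightarrow> f x \<le> g x" and "x \<in> U"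
  shows "f x \<le> g x"
proof (rule ccontr)
  assume "\<not> f x \<le> g x"
  define V where "V = U \<inter> (\<lambda>x. f x - g x) -` {0<..}"
  have "open V" unfolding V_def
    by (rule continuous_open_preimage) (use assms in \<open>auto intro!: continuous_intros\<close>)
  moreover have "V \<subseteq> N" using le by (force simp: V_def)
  moreover have "x \<in> V" using assms \<open>\<not> f x \<le> g x\<close> by (auto simp: V_def)
  ultimately show False using open_not_negligible negligible_subset assms(4) by blast
qed

text \<open>The \<open>W l\<close> measure how far the given fields are from being combinations of
  the frame. Both bounds are relative to the total size of the \<open>W l\<close>, and they are
  assumed only off the null set \<open>N\<close>, which may contain the whole orbit of
  \<open>x0\<close>; no statement is made at \<open>x0\<close> except that the remainders vanish
  there.\<close>

locale involutive_frame = horizontal_frame Z P K M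
  for Z :: "'a::euclidean_space \<Rightarrow> 'a \<Rightarrow> 'a" and P K M +
  fixes W :: "nat \<Rightarrow> 'a \<Rightarrow> 'a" and q :: nat and C L R :: real and x0 :: 'a and N :: "'a set"
  assumes negligible_N: "negligible N" and R_pos: "R > 0" and C_nonneg: "C \<ge> 0"
    and lipschitz_W: "\<And>l. l < q \<Longrightarrow> L-lipschitz_on UNIV (W l)"
    and W_x0: "\<And>l. l < q \<Longrightarrow> W l x0 = 0"
    and bracket_Z: "\<And>x. x \<in> ball x0 R \<Longrightarrow> x \<notin> N \<Longrightarrow>
      \<exists>DZ. (\<forall>v. ((\<lambda>y. Z y v) has_derivative DZ v) (at x)) \<and>
        (\<forall>v w. norm (DZ w (Z x v) - DZ v (Z x w)) \<le> C * (\<Sum>l<q. norm (W l x)) * norm v * norm w)"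
    and deriv_W: "\<And>x l. x \<in> ball x0 R \<Longrightarrow> x \<notin> N \<Longrightarrow> l < q \<Longrightarrow>
      \<exists>DW. (W l has_derivative DW) (at x) \<and> (\<forall>v. norm (DW (Z x v)) \<le> C * (\<Sum>l<q. norm (W l x)) * norm v)"
begin

definition \<omega> :: "'a \<Rightarrow> real" where "\<omega> x = (\<Sum>l<q. norm (W l x))"

text \<open>The three bounds keep \<open>K * norm v\<close> at most \<open>1 / 2\<close> (existence
  and dependence of flows), \<open>real q * C * norm v\<close> at most \<open>1 / 2\<close>
  (absorption when the \<open>q\<close> remainders are summed), and trajectories inside
  \<open>ball x0 R\<close>.\<close>

definition r :: real where
  "r = min (1 / (2 * (K + 1))) (min (1 / (2 * (real q * C + 1))) (R / (2 + M)))"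

text \<open>A point near \<open>x0\<close> encodes a pair: its horizontal displacement is the
  direction of the flow, and \<open>base x\<close> is the starting point. Null sets of pairs thereby
  become null sets of the space itself.\<close>

definition base :: "'a \<Rightarrow> 'a" where "base x = x - P (x - x0)"

definition \<Psi> :: "'a \<Rightarrow> 'a" where "\<Psi> x = flow (P (x - x0)) (base x) 1"

text \<open>Time \<open>0\<close> is left out to match the rays in
  \<open>negligible_bad_rays\<close>, which are images under invertible maps for positive times
  only.\<close>

definition good_ray :: "'a \<Rightarrow> bool" where
  "good_ray x \<longleftrightarrow> negligible {t \<in> {0<..1}. flow (P (x - x0)) (base x) t \<in> N}"

lemma \<omega>_nonneg: "\<omega> x \<ge> 0" unfolding \<omega>_def by (rule sum_nonneg) simp

lemma continuous_\<omega>: "continuous_on A \<omega>"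
proof -
  have "continuous_on A (W l)" if "l < q" for l
    using lipschitz_on_continuous_on[OF lipschitz_W[OF that]] continuous_on_subset by blast
  then show ?thesis unfolding \<omega>_def by (intro continuous_intros) auto
qed

lemma r_pos: "r > 0"
  using K_nonneg M_nonneg C_nonneg R_pos by (auto simp: r_def add_nonneg_pos)

lemma K_small: assumes "norm v \<le> r" shows "K * norm v \<le> 1 / 2"
proof -
  have "K * norm v \<le> K * (1 / (2 * (K + 1)))"
    using assms K_nonneg by (intro mult_left_mono) (auto simp: r_def)
  also have "\<dots> \<le> 1 / 2" using K_nonneg by (simp add: field_simps)
  finally show ?thesis .
qed

lemma C_small: assumes "norm v \<le> r" shows "real q * C * norm v \<le> 1 / 2"
proof -
  have "real q * C * norm v \<le> real q * C * (1 / (2 * (real q * C + 1)))"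
    using assms C_nonneg by (intro mult_left_mono) (auto simp: r_def)
  also have "\<dots> \<le> 1 / 2"
  proof -
    have "a * (1 / (2 * (a + 1))) \<le> 1 / 2" if "a \<ge> 0" for a :: real using that by (simp add: field_simps)
    from this[of "real q * C"] show ?thesis using C_nonneg by (simp only: mult_nonneg_nonneg of_nat_0_le_iff)
  qed
  finally show ?thesis .
qed

lemma R_large: "(1 + M) * r < R"
proof -
  have "(1 + M) * r \<le> (1 + M) * (R / (2 + M))" using M_nonneg by (intro mult_left_mono) (auto simp: r_def)
  also have "\<dots> < R" using M_nonneg R_pos by (simp add: field_simps)
  finally show ?thesis .
qed

section \<open>Trajectories encoded by the points of a ball\<close>

lemma norm_dir: "norm (P (x - x0)) \<le> dist x x0" using norm_P by (simp add: dist_norm)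

lemma dist_base: "dist (base x) x0 \<le> dist x x0"
  using norm_P_compl[of "x - x0"] by (simp add: base_def dist_norm algebra_simps)

lemma K_dir: "x \<in> ball x0 r \<Longrightarrow> K * norm (P (x - x0)) \<le> 1 / 2"
  using norm_dir[of x] by (intro K_small) (simp add: dist_commute)

lemma flow_in_ball:
  assumes x: "x \<in> ball x0 r" and t: "t \<in> {0..1}"
  shows "flow (P (x - x0)) (base x) t \<in> ball x0 R"
proof -
  have "norm (flow (P (x - x0)) (base x) t - flow (P (x - x0)) (base x) 0) \<le> M * norm (P (x - x0)) * \<bar>t - 0\<bar>"
    by (rule flow_lipschitz[OF K_dir[OF x]]) (use t in auto)
  also have "\<dots> \<le> M * norm (P (x - x0))" using t M_nonneg by (simp add: mult_left_le)
  also have "\<dots> \<le> M * r" using norm_dir[of x] x M_nonneg by (intro mult_left_mono) (auto simp: dist_commute)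
  finally have "dist (flow (P (x - x0)) (base x) t) (base x) \<le> M * r"
    using flow_zero[OF K_dir[OF x]] by (simp add: dist_norm)
  moreover have "dist (base x) x0 < r" using dist_base[of x] x by (simp add: dist_commute)
  ultimately have "dist (flow (P (x - x0)) (base x) t) x0 < (1 + M) * r"
    using dist_triangle[of "flow (P (x - x0)) (base x) t" x0 "base x"] by (simp add: algebra_simps)
  then show ?thesis using R_large by (simp add: dist_commute)
qed

lemma linear_P_simps:
  "P (x + y) = P x + P y" "P (x - y) = P x - P y" "P (c *\<^sub>R x) = c *\<^sub>R P x" "P (- x) = - P x"
  using linear_P by (simp_all add: linear_add linear_diff linear_cmul linear_neg)

lemma P_\<Psi>:
  assumes x: "x \<in> ball x0 r"
  shows "P (\<Psi> x - x0) = P (x - x0)"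
proof -
  have "P (\<Psi> x) = P (base x) + 1 *\<^sub>R P (P (x - x0))"
    unfolding \<Psi>_def by (rule P_flow[OF K_dir[OF x]]) auto
  then show ?thesis by (simp add: base_def linear_P_simps P_idem)
qed

lemma \<Psi>_lipschitz:
  assumes "x \<in> ball x0 r" "y \<in> ball x0 r"
  shows "norm (\<Psi> x - \<Psi> y) \<le> 2 * (norm (base x - base y) + M * norm (P (x - y)))"
  using flow_dependence[OF K_dir[OF assms(1)] K_dir[OF assms(2)], of 1 "base x" "base y"]
  by (simp add: \<Psi>_def linear_P_simps)

lemma norm_base_diff: "norm (base x - base y) \<le> norm (x - y)"
  using norm_P_compl[of "x - y"] by (simp add: base_def linear_P_simps algebra_simps)

lemma continuous_\<Psi>: "continuous_on (ball x0 r) \<Psi>"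
proof (rule lipschitz_on_continuous_on)
  show "(2 * (1 + M))-lipschitz_on (ball x0 r) \<Psi>"
  proof (rule lipschitz_onI)
    fix x y assume xy: "x \<in> ball x0 r" "y \<in> ball x0 r"
    have "M * norm (P (x - y)) \<le> M * norm (x - y)" using M_nonneg norm_P by (rule mult_left_mono[rotated])
    then show "dist (\<Psi> x) (\<Psi> y) \<le> 2 * (1 + M) * dist x y"
      using \<Psi>_lipschitz[OF xy] norm_base_diff[of x y] by (simp add: dist_norm algebra_simps)
  qed (use M_nonneg in simp)
qed

lemma \<Psi>_along:
  assumes "x \<in> ball x0 r" "x + w \<in> ball x0 r" "P w = w"
  shows "norm (\<Psi> (x + w) - \<Psi> x) \<le> 2 * M * norm w"
proof -
  have "base (x + w) = base x" using assms(3) by (simp add: base_def linear_P_simps)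
  then show ?thesis using \<Psi>_lipschitz[OF assms(2,1)] assms(3) by simp
qed

text \<open>\<open>\<Psi>\<close> has a Lipschitz left inverse, so the points with endpoint in
  \<open>N\<close> form a null set. Intermediate positions are endpoints too: by scaling, the
  trajectory of \<open>x\<close> at time \<open>t\<close> is \<open>\<Psi>\<close> at the point
  whose horizontal displacement is multiplied by \<open>t\<close>. Fubini over \<open>t\<close> does
  the rest.\<close>

lemma negligible_bad_rays: "negligible {x \<in> ball x0 r. \<not> good_ray x}"
proof -
  define N1 where "N1 = {x \<in> ball x0 r. \<Psi> x \<in> N}"
  \<comment> \<open>Left inverse of \<open>\<Psi>\<close>: the horizontal part of
    \<open>y - x0\<close> tells which direction was followed, and flowing back along it recovers the
    base.\<close>
  define \<Theta> where "\<Theta> y = P (y - x0) + flow (- P (y - x0)) y 1" for y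
  define S where "S = {y. norm (P (y - x0)) \<le> r}"
  have "(1 + 2 * (1 + M))-lipschitz_on (N \<inter> S) \<Theta>"
  proof (rule lipschitz_onI)
    fix x y assume "x \<in> N \<inter> S" "y \<in> N \<inter> S"
    then have "K * norm (- P (x - x0)) \<le> 1/2" "K * norm (- P (y - x0)) \<le> 1/2"
      using K_small by (auto simp: S_def)
    then have "norm (flow (- P (x - x0)) x 1 - flow (- P (y - x0)) y 1) \<le> 2 * (norm (x - y) + M * norm (- P (x - x0) - - P (y - x0)))"
      by (rule flow_dependence) auto
    also have "- P (x - x0) - - P (y - x0) = - P (x - y)" by (simp add: linear_P_simps)
    finally have 1: "norm (flow (- P (x - x0)) x 1 - flow (- P (y - x0)) y 1) \<le> 2 * (norm (x - y) + M * norm (P (x - y)))" by simp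
    have 2: "M * norm (P (x - y)) \<le> M * norm (x - y)" using M_nonneg norm_P by (rule mult_left_mono[rotated])
    have "\<Theta> x - \<Theta> y = P (x - y) + (flow (- P (x - x0)) x 1 - flow (- P (y - x0)) y 1)"
      by (simp add: \<Theta>_def linear_P_simps)
    then have "norm (\<Theta> x - \<Theta> y) \<le> norm (P (x - y)) + norm (flow (- P (x - x0)) x 1 - flow (- P (y - x0)) y 1)"
      by (metis norm_triangle_ineq)
    then show "dist (\<Theta> x) (\<Theta> y) \<le> (1 + 2 * (1 + M)) * dist x y"
      using 1 2 norm_P[of "x - y"] by (simp add: dist_norm algebra_simps)
  qed (use M_nonneg in simp)
  then have "negligible (\<Theta> ` (N \<inter> S))"
    by (rule negligible_lipschitz_image[rotated]) (use negligible_N negligible_Int in blast)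
  moreover have "N1 \<subseteq> \<Theta> ` (N \<inter> S)"
  proof
    fix x assume "x \<in> N1"
    then have x: "x \<in> ball x0 r" "\<Psi> x \<in> N" by (auto simp: N1_def)
    have "\<Theta> (\<Psi> x) = P (x - x0) + base x"
      using flow_reverse[OF K_dir[OF x(1)], of "base x"]
      unfolding \<Theta>_def P_\<Psi>[OF x(1)] by (simp add: \<Psi>_def)
    then have "x = \<Theta> (\<Psi> x)" by (simp add: base_def)
    moreover have "\<Psi> x \<in> S" using P_\<Psi>[OF x(1)] norm_dir[of x] x(1) by (simp add: S_def dist_commute)
    ultimately show "x \<in> \<Theta> ` (N \<inter> S)" using x(2) by blast
  qed
  ultimately have N1: "negligible N1" using negligible_subset by blast
  \<comment> \<open>Scales the horizontal displacement by \<open>t\<close> and fixes the base. The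
    inverse \<open>U\<close> below contains \<open>1 / t\<close>, whence the restriction to positive
    times.\<close>
  define T where "T t x = x - (1 - t) *\<^sub>R P (x - x0)" for t x
  have "AE x in lborel. negligible {t. t > 0 \<and> T t x \<in> N1}"
  proof (rule AE_negligible_family[OF N1])
    have "continuous_on UNIV P" using linear_P by (simp add: linear_continuous_on linear_conv_bounded_linear)
    then have "continuous_on UNIV (\<lambda>z. P (snd z - x0) :: 'a)" 
      by (rule continuous_on_compose2) (auto intro!: continuous_intros)
    then have "continuous_on UNIV (\<lambda>z. T (fst z) (snd z))"
      unfolding T_def by (intro continuous_intros)
    then have "(\<lambda>z. T (fst z) (snd z)) \<in> borel_measurable borel" by (rule borel_measurable_continuous_onI)
    then show "(\<lambda>(t, x). T t x) \<in> borel_measurable (borel \<Otimes>\<^sub>M borel)"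
      by (simp add: borel_prod case_prod_beta')
  next
    fix t :: real and N' :: "'a set" assume N': "negligible N'" and t: "t > 0"
    define U where "U y = y + (1 / t - 1) *\<^sub>R P (y - x0)" for y
    have "(1 + \<bar>1 / t - 1\<bar>)-lipschitz_on N' U"
    proof (rule lipschitz_onI)
      fix x y
      have "U x - U y = (x - y) + (1 / t - 1) *\<^sub>R P (x - y)"
        by (simp add: U_def linear_P_simps algebra_simps)
      then have "norm (U x - U y) \<le> norm (x - y) + \<bar>1 / t - 1\<bar> * norm (P (x - y))"
        by (metis norm_scaleR norm_triangle_ineq)
      also have "\<dots> \<le> norm (x - y) + \<bar>1 / t - 1\<bar> * norm (x - y)"
        by (intro add_left_mono mult_left_mono norm_P) auto
      finally show "dist (U x) (U y) \<le> (1 + \<bar>1 / t - 1\<bar>) * dist x y" by (simp add: dist_norm algebra_simps)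
    qed auto
    then have "negligible (U ` N')" using N' negligible_lipschitz_image by blast
    moreover have "{x. T t x \<in> N'} \<subseteq> U ` N'"
    proof
      fix x assume "x \<in> {x. T t x \<in> N'}"
      moreover have "U (T t x) = x"
      proof -
        have "P (T t x - x0) = t *\<^sub>R P (x - x0)"
          by (simp add: T_def linear_P_simps P_idem algebra_simps)
        then have "U (T t x) = T t x + (1 - t) *\<^sub>R P (x - x0)"
          using t by (simp add: U_def algebra_simps)
        then show ?thesis by (simp add: T_def)
      qed
      ultimately show "x \<in> U ` N'" by (metis imageI mem_Collect_eq)
    qed
    ultimately show "negligible {x. T t x \<in> N'}" using negligible_subset by blast
  qed
  then have "AE x in lebesgue. negligible {t. t > 0 \<and> T t x \<in> N1}" by (rule AE_completion)
  then have "negligible {x. \<not> negligible {t. t > 0 \<and> T t x \<in> N1}}"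
    by (auto simp: negligible_iff_null_sets eventually_ae_filter intro: null_sets_completion_subset)
  moreover have "good_ray x" if x: "x \<in> ball x0 r" and n: "negligible {t. t > 0 \<and> T t x \<in> N1}" for x
    unfolding good_ray_def
  proof (rule negligible_subset[OF n], rule subsetI)
    fix t assume t: "t \<in> {t \<in> {0<..1}. flow (P (x - x0)) (base x) t \<in> N}"
    have PT: "P (T t x - x0) = t *\<^sub>R P (x - x0)"
      by (simp add: T_def linear_P_simps P_idem algebra_simps)
    have bT: "base (T t x) = base x" unfolding base_def PT by (simp add: T_def algebra_simps)
    have "T t x - x0 = t *\<^sub>R (x - x0) + (1 - t) *\<^sub>R (x - x0 - P (x - x0))"
      by (simp add: T_def algebra_simps)
    then have "norm (T t x - x0) \<le> t * norm (x - x0) + (1 - t) * norm (x - x0 - P (x - x0))"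
      using norm_triangle_ineq[of "t *\<^sub>R (x - x0)" "(1 - t) *\<^sub>R (x - x0 - P (x - x0))"] t by simp
    also have "\<dots> \<le> t * norm (x - x0) + (1 - t) * norm (x - x0)"
      using t norm_P_compl by (intro add_left_mono mult_left_mono) auto
    finally have "T t x \<in> ball x0 r" using x by (simp add: dist_norm norm_minus_commute algebra_simps)
    moreover have "\<Psi> (T t x) = flow (P (x - x0)) (base x) (t * 1)"
      unfolding \<Psi>_def PT bT by (rule flow_scale[OF K_dir[OF x]]) (use t in auto)
    ultimately show "t \<in> {t. t > 0 \<and> T t x \<in> N1}" using t by (simp add: N1_def)
  qed
  then have "{x \<in> ball x0 r. \<not> good_ray x} \<subseteq> {x. \<not> negligible {t. t > 0 \<and> T t x \<in> N1}}" by blast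
  ultimately show ?thesis using negligible_subset by blast
qed

text \<open>At the time \<open>m\<close> of the maximum, each remainder exceeds its initial size by
  at most \<open>C * \<omega> (\<gamma> m) * norm v\<close>, because its derivative along the frame
  is controlled by \<open>\<omega>\<close> itself at almost every time. Summing over
  \<open>l\<close>, the choice of \<open>r\<close> leaves half of the maximum, which is
  absorbed.\<close>

lemma \<omega>_flow_le:
  assumes x: "x \<in> ball x0 r" and good: "good_ray x" and t: "t \<in> {0..1}"
  shows "\<omega> (flow (P (x - x0)) (base x) t) \<le> 2 * \<omega> (base x)"
proof -
  define v where "v = P (x - x0)"
  define \<gamma> where "\<gamma> = flow v (base x)"
  have v: "K * norm v \<le> 1/2" "norm v \<le> r" unfolding v_def using K_dir[OF x] norm_dir[of x] x by (auto simp: dist_commute)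
  have lip\<gamma>: "(M * norm v)-lipschitz_on {0..1} \<gamma>"
    using flow_lipschitz[OF v(1)] M_nonneg by (intro lipschitz_onI) (auto simp: \<gamma>_def dist_norm)
  have "continuous_on {0..1} (\<lambda>t. \<omega> (\<gamma> t))"
    by (rule continuous_on_compose2[OF continuous_\<omega>[of UNIV] lipschitz_on_continuous_on[OF lip\<gamma>]]) auto
  then have "\<exists>m\<in>{0..1}. \<forall>t\<in>{0..1}. \<omega> (\<gamma> t) \<le> \<omega> (\<gamma> m)"
    by (intro continuous_attains_sup) auto
  then obtain m where m: "m \<in> {0..1}" "\<And>t. t \<in> {0..1} \<Longrightarrow> \<omega> (\<gamma> t) \<le> \<omega> (\<gamma> m)" by blast
  have Wl: "norm (W l (\<gamma> m)) \<le> norm (W l (base x)) + C * \<omega> (\<gamma> m) * norm v" if l: "l < q" for l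
  proof -
    have "(L * (M * norm v))-lipschitz_on {0..1} (\<lambda>t. W l (\<gamma> t))"
      using lipschitz_on_compose2[OF lip\<gamma> lipschitz_on_subset[OF lipschitz_W[OF l]]] by simp
    then have "(L * (M * norm v))-lipschitz_on {0..m} (\<lambda>t. W l (\<gamma> t))"
      by (rule lipschitz_on_subset) (use m in auto)
    then have "norm (W l (\<gamma> m) - W l (\<gamma> 0)) \<le> (C * \<omega> (\<gamma> m) * norm v) * (m - 0)"
    proof (rule lipschitz_AE_deriv_bound[rotated])
      show "negligible {t \<in> {0<..1}. \<gamma> t \<in> N}" using good by (simp add: good_ray_def \<gamma>_def v_def)
      fix t assume t: "t \<in> {0<..<m}" "t \<notin> {t \<in> {0<..1}. \<gamma> t \<in> N}"
      then have t': "t \<in> {0<..<1}" "\<gamma> t \<notin> N" using m by auto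
      have ball: "\<gamma> t \<in> ball x0 R" unfolding \<gamma>_def v_def by (rule flow_in_ball[OF x]) (use t' in auto)
      obtain DW where DW: "(W l has_derivative DW) (at (\<gamma> t))" "\<And>v. norm (DW (Z (\<gamma> t) v)) \<le> C * \<omega> (\<gamma> t) * norm v"
        using deriv_W[OF ball t'(2) l] unfolding \<omega>_def by blast
      have "(\<gamma> has_vector_derivative Z (\<gamma> t) v) (at t within {0..1})"
        unfolding \<gamma>_def by (rule flow_deriv[OF v(1)]) (use t' in auto)
      then have "(\<gamma> has_vector_derivative Z (\<gamma> t) v) (at t)" using t' by (simp add: at_within_Icc_at)
      then have "((W l \<circ> \<gamma>) has_vector_derivative DW (Z (\<gamma> t) v)) (at t)"
        using DW(1) by (intro vector_derivative_diff_chain_within) (auto intro: has_derivative_at_withinI)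
      moreover have "norm (DW (Z (\<gamma> t) v)) \<le> C * \<omega> (\<gamma> m) * norm v"
      proof -
        have "C * \<omega> (\<gamma> t) * norm v \<le> C * \<omega> (\<gamma> m) * norm v"
          using m(2)[of t] t' C_nonneg by (intro mult_right_mono mult_left_mono) auto
        then show ?thesis using DW(2)[of v] by linarith
      qed
      ultimately show "\<exists>D. ((\<lambda>t. W l (\<gamma> t)) has_vector_derivative D) (at t) \<and> norm D \<le> C * \<omega> (\<gamma> m) * norm v"
        by (auto simp: o_def)
    qed (use m in auto)
    also have "\<dots> \<le> C * \<omega> (\<gamma> m) * norm v"
      using m C_nonneg \<omega>_nonneg by (simp add: mult_left_le)
    finally show ?thesis
      using norm_triangle_ineq2[of "W l (\<gamma> m)" "W l (\<gamma> 0)"] flow_zero[OF v(1)] by (simp add: \<gamma>_def)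
  qed
  have "\<omega> (\<gamma> m) \<le> (\<Sum>l<q. norm (W l (base x)) + C * \<omega> (\<gamma> m) * norm v)"
    unfolding \<omega>_def[of "\<gamma> m"] using Wl by (intro sum_mono) (auto simp: \<omega>_def)
  also have "\<dots> = \<omega> (base x) + (real q * C * norm v) * \<omega> (\<gamma> m)"
    by (simp add: sum.distrib \<omega>_def)
  also have "\<dots> \<le> \<omega> (base x) + 1/2 * \<omega> (\<gamma> m)"
    using C_small[OF v(2)] \<omega>_nonneg by (intro add_left_mono mult_right_mono) auto
  finally have "\<omega> (\<gamma> m) \<le> 2 * \<omega> (base x)" by simp
  then show ?thesis using m(2)[OF t] by (simp add: \<gamma>_def v_def)
qed

text \<open>The difference quotient of two flows in the direction parameter, minus its expected
  value \<open>t *\<^sub>R Z (\<gamma> t) w\<close>, starts at zero. Its derivative consists of a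
  Lipschitz term proportional to itself, of terms tending to zero at almost every time, and of
  \<open>t\<close> times the bracket of \<open>Z v\<close> and \<open>Z w\<close>, which
  \<open>\<omega>\<close> controls. The limit runs along one sequence of steps, so a single small
  \<open>h\<close> is extracted.\<close>

lemma flow_first_order:
  assumes x: "x \<in> ball x0 r" and good: "good_ray x" and w: "P w = w" and "e > 0" "d > 0"
  shows "\<exists>h>0. h < d \<and> x + h *\<^sub>R w \<in> ball x0 r \<and>
    norm (\<Psi> (x + h *\<^sub>R w) - \<Psi> x - h *\<^sub>R Z (\<Psi> x) w) \<le> h * (4 * C * r * \<omega> (base x) * norm w + e)"
proof -
  define v where "v = P (x - x0)"
  define z where "z = base x"
  define \<gamma> where "\<gamma> = flow v z"
  have v: "K * norm v \<le> 1/2" "norm v \<le> r" unfolding v_def using K_dir[OF x] norm_dir[of x] x by (auto simp: dist_commute)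
  \<comment> \<open>Steps up to \<open>\<epsilon>0\<close> keep the shifted point in the ball; the
    \<open>+ 1\<close> allows \<open>w = 0\<close>.\<close>
  define \<epsilon>0 where "\<epsilon>0 = (r - dist x x0) / (norm w + 1)"
  have nw: "norm w + 1 > 0" using norm_ge_zero[of w] by linarith
  have \<epsilon>0: "\<epsilon>0 > 0" using x nw by (simp add: \<epsilon>0_def dist_commute)
  have \<epsilon>0w: "\<epsilon>0 * norm w < r - dist x x0"
  proof -
    have "\<epsilon>0 * norm w < \<epsilon>0 * (norm w + 1)" using \<epsilon>0 by simp
    also have "\<dots> = r - dist x x0" using nw by (simp add: \<epsilon>0_def)
    finally show ?thesis .
  qed
  define \<epsilon> where "\<epsilon> k = \<epsilon>0 * inverse (real (Suc k))" for k
  have \<epsilon>: "\<epsilon> k > 0" for k using \<epsilon>0 by (simp add: \<epsilon>_def)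
  have \<epsilon>le: "\<epsilon> k \<le> \<epsilon>0" for k using \<epsilon>0 by (simp add: \<epsilon>_def inverse_le_1_iff mult_left_le)
  have \<epsilon>lim: "\<epsilon> \<longlonglongrightarrow> 0" unfolding \<epsilon>_def
    using tendsto_mult_left[OF LIMSEQ_inverse_real_of_nat, of \<epsilon>0] by simp
  have xw: "x + \<epsilon> k *\<^sub>R w \<in> ball x0 r" for k
  proof -
    have "norm (\<epsilon> k *\<^sub>R w) \<le> \<epsilon>0 * norm w" using \<epsilon>[of k] \<epsilon>le[of k] by (simp add: mult_right_mono)
    then have "dist (x + \<epsilon> k *\<^sub>R w) x0 < r"
      using \<epsilon>0w norm_triangle_ineq[of "x - x0" "\<epsilon> k *\<^sub>R w"] by (simp add: dist_norm algebra_simps)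
    then show ?thesis by (simp add: dist_commute)
  qed
  have dirk: "P (x + \<epsilon> k *\<^sub>R w - x0) = v + \<epsilon> k *\<^sub>R w" for k
    using w by (simp add: v_def linear_P_simps)
  have basek: "base (x + \<epsilon> k *\<^sub>R w) = z" for k
    using dirk[of k] unfolding base_def by (simp add: z_def base_def v_def)
  have vk: "K * norm (v + \<epsilon> k *\<^sub>R w) \<le> 1/2" for k using K_dir[OF xw[of k]] dirk by simp
  define \<delta> where "\<delta> k = flow (v + \<epsilon> k *\<^sub>R w) z" for k
  have \<Psi>k: "\<Psi> (x + \<epsilon> k *\<^sub>R w) = \<delta> k 1" for k by (simp add: \<Psi>_def \<delta>_def dirk basek)
  have \<Psi>x: "\<Psi> x = \<gamma> 1" by (simp add: \<Psi>_def \<gamma>_def v_def z_def)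
  have \<delta>\<gamma>: "norm (\<delta> k t - \<gamma> t) \<le> 2 * M * norm w * \<epsilon> k" if "t \<in> {0..1}" for k t
    using flow_dependence[OF vk[of k] v(1) that, of z z] \<epsilon>[of k] by (simp add: \<delta>_def \<gamma>_def mult_ac)
  define f where "f k t = (1 / \<epsilon> k) *\<^sub>R (\<delta> k t - \<gamma> t) - t *\<^sub>R Z (\<gamma> t) w" for k t
  have f0: "f k 0 = 0" for k using flow_zero[OF vk[of k]] flow_zero[OF v(1)] by (simp add: f_def \<delta>_def \<gamma>_def)
  have \<delta>d: "(\<delta> k has_vector_derivative Z (\<delta> k t) (v + \<epsilon> k *\<^sub>R w)) (at t within {0..1})" if "t \<in> {0..1}" for k t
    unfolding \<delta>_def by (rule flow_deriv[OF vk that])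
  have \<gamma>d: "(\<gamma> has_vector_derivative Z (\<gamma> t) v) (at t within {0..1})" if "t \<in> {0..1}" for t
    unfolding \<gamma>_def by (rule flow_deriv[OF v(1) that])
  have Kv: "K * a * norm v \<le> a / 2" if "a \<ge> 0" for a
    using mult_right_mono[OF v(1) that] by (simp add: mult_ac)
  \<comment> \<open>The difference of the two flows is Lipschitz in time with a constant
    proportional to \<open>\<epsilon> k\<close>; after division by \<open>\<epsilon> k\<close> the
    maps \<open>f k\<close> share one Lipschitz constant, as the limit lemma demands.\<close>
  have lip\<delta>: "norm ((\<delta> k s - \<gamma> s) - (\<delta> k t - \<gamma> t)) \<le> 2 * M * norm w * \<epsilon> k * \<bar>s - t\<bar>"
    if st: "s \<in> {0..1}" "t \<in> {0..1}" for k s t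
  proof (rule vector_derivative_norm_bound[where a=0 and b=1 and f="\<lambda>s. \<delta> k s - \<gamma> s"])
    fix t :: real assume t: "t \<in> {0..1}"
    show "((\<lambda>s. \<delta> k s - \<gamma> s) has_vector_derivative Z (\<delta> k t) (v + \<epsilon> k *\<^sub>R w) - Z (\<gamma> t) v) (at t within {0..1})"
      by (intro derivative_intros \<delta>d \<gamma>d t)
    have "Z (\<delta> k t) (v + \<epsilon> k *\<^sub>R w) - Z (\<gamma> t) v = (Z (\<delta> k t) v - Z (\<gamma> t) v) + \<epsilon> k *\<^sub>R Z (\<delta> k t) w"
      by (simp add: linear_add[OF linear_Z] linear_cmul[OF linear_Z])
    then have "norm (Z (\<delta> k t) (v + \<epsilon> k *\<^sub>R w) - Z (\<gamma> t) v) \<le> norm (Z (\<delta> k t) v - Z (\<gamma> t) v) + norm (\<epsilon> k *\<^sub>R Z (\<delta> k t) w)"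
      by (metis norm_triangle_ineq)
    moreover have "norm (\<epsilon> k *\<^sub>R Z (\<delta> k t) w) \<le> \<epsilon> k * (M * norm w)" using \<epsilon>[of k] norm_Z by simp
    moreover have "norm (Z (\<delta> k t) v - Z (\<gamma> t) v) \<le> norm (\<delta> k t - \<gamma> t) / 2"
      using lipschitz_Z[of "\<delta> k t" v "\<gamma> t"] Kv[of "norm (\<delta> k t - \<gamma> t)"] by simp
    ultimately show "norm (Z (\<delta> k t) (v + \<epsilon> k *\<^sub>R w) - Z (\<gamma> t) v) \<le> 2 * M * norm w * \<epsilon> k"
      using \<delta>\<gamma>[OF t, of k] by (simp add: algebra_simps)
  qed (use st in auto)
  have \<gamma>lip: "norm (\<gamma> s - \<gamma> t) \<le> M * norm v * \<bar>s - t\<bar>" if "s \<in> {0..1}" "t \<in> {0..1}" for s t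
    unfolding \<gamma>_def by (rule flow_lipschitz[OF v(1) that])
  have lipf: "(4 * M * norm w)-lipschitz_on {0..1} (f k)" for k
  proof (rule lipschitz_onI)
    fix s t :: real assume st: "s \<in> {0..1}" "t \<in> {0..1}"
    have "f k s - f k t = (1 / \<epsilon> k) *\<^sub>R ((\<delta> k s - \<gamma> s) - (\<delta> k t - \<gamma> t)) - ((s - t) *\<^sub>R Z (\<gamma> s) w + t *\<^sub>R (Z (\<gamma> s) w - Z (\<gamma> t) w))"
      by (simp add: f_def algebra_simps)
    then have "norm (f k s - f k t) \<le> norm ((1 / \<epsilon> k) *\<^sub>R ((\<delta> k s - \<gamma> s) - (\<delta> k t - \<gamma> t))) + norm ((s - t) *\<^sub>R Z (\<gamma> s) w + t *\<^sub>R (Z (\<gamma> s) w - Z (\<gamma> t) w))"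
      by (metis norm_triangle_ineq4)
    also have "norm ((1 / \<epsilon> k) *\<^sub>R ((\<delta> k s - \<gamma> s) - (\<delta> k t - \<gamma> t))) \<le> 2 * M * norm w * \<bar>s - t\<bar>"
      using lip\<delta>[OF st, of k] \<epsilon>[of k] by (simp add: pos_divide_le_eq mult_ac)
    also have "norm ((s - t) *\<^sub>R Z (\<gamma> s) w + t *\<^sub>R (Z (\<gamma> s) w - Z (\<gamma> t) w)) \<le> norm ((s - t) *\<^sub>R Z (\<gamma> s) w) + norm (t *\<^sub>R (Z (\<gamma> s) w - Z (\<gamma> t) w))"
      by (rule norm_triangle_ineq)
    also have "norm ((s - t) *\<^sub>R Z (\<gamma> s) w) \<le> \<bar>s - t\<bar> * (M * norm w)"
      using norm_Z by (simp add: mult_left_mono)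
    also have "norm (t *\<^sub>R (Z (\<gamma> s) w - Z (\<gamma> t) w)) \<le> M * norm w * \<bar>s - t\<bar>"
    proof -
      have "norm (t *\<^sub>R (Z (\<gamma> s) w - Z (\<gamma> t) w)) \<le> norm (Z (\<gamma> s) w - Z (\<gamma> t) w)"
        using st by (simp add: mult_left_le_one_le)
      also have "\<dots> \<le> K * norm (\<gamma> s - \<gamma> t) * norm w" by (rule lipschitz_Z)
      also have "\<dots> \<le> K * (M * norm v * \<bar>s - t\<bar>) * norm w"
        using \<gamma>lip[OF st] K_nonneg by (intro mult_right_mono mult_left_mono) auto
      also have "\<dots> = K * (M * \<bar>s - t\<bar> * norm w) * norm v" by (simp add: mult_ac)
      also have "\<dots> \<le> M * \<bar>s - t\<bar> * norm w / 2" by (rule Kv) (use M_nonneg in auto)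
      also have "\<dots> \<le> M * \<bar>s - t\<bar> * norm w" using M_nonneg by simp
      finally show ?thesis by (simp add: mult_ac)
    qed
    finally show "dist (f k s) (f k t) \<le> 4 * M * norm w * dist s t"
      by (simp add: dist_norm algebra_simps)
  qed (use M_nonneg in simp)
  have "\<exists>m\<in>{0..1}. \<forall>t\<in>{0..1}. norm (f k t) \<le> norm (f k m)" for k
    using lipschitz_on_continuous_on[OF lipf] by (intro continuous_attains_sup continuous_on_norm) auto
  then obtain m where m: "\<And>k. m k \<in> {0..1}" "\<And>k t. t \<in> {0..1} \<Longrightarrow> norm (f k t) \<le> norm (f k (m k))" by metis
  define S where "S k = norm (f k (m k))" for k
  \<comment> \<open>The factor two is the growth of \<open>\<omega>\<close> along the trajectory,
    and \<open>r\<close> bounds the direction \<open>v\<close>. The limit lemma doubles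
    \<open>c\<close> once more, whence the \<open>4\<close> in the claim.\<close>
  define c where "c = 2 * C * r * \<omega> z * norm w"
  have "\<forall>\<^sub>F k in sequentially. norm (f k 1) \<le> 2 * c + e"
  proof (rule lipschitz_family_AE_deriv_limit[OF lipf f0, where S=S and N="{t \<in> {0<..1}. \<gamma> t \<in> N}"])
    show "negligible {t \<in> {0<..1}. \<gamma> t \<in> N}" using good by (simp add: good_ray_def \<gamma>_def v_def z_def)
    show "norm (f k t) \<le> S k" if "t \<in> {0..1}" for k t using m(2)[OF that] by (simp add: S_def)
    show "\<exists>t\<in>{0..1}. norm (f k t) = S k" for k using m(1) by (auto simp: S_def)
    show "c \<ge> 0" using C_nonneg r_pos \<omega>_nonneg by (simp add: c_def)
    show "e > 0" by fact
    fix t assume t: "t \<in> {0<..<1}" "t \<notin> {t \<in> {0<..1}. \<gamma> t \<in> N}"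
    then have t01: "t \<in> {0..1}" and tN: "\<gamma> t \<notin> N" by auto
    have ball: "\<gamma> t \<in> ball x0 R" unfolding \<gamma>_def v_def z_def by (rule flow_in_ball[OF x t01])
    obtain DZ where DZ: "\<And>v. ((\<lambda>y. Z y v) has_derivative DZ v) (at (\<gamma> t))"
      "\<And>v w. norm (DZ w (Z (\<gamma> t) v) - DZ v (Z (\<gamma> t) w)) \<le> C * \<omega> (\<gamma> t) * norm v * norm w"
      using bracket_Z[OF ball tN] unfolding \<omega>_def by blast
    define p where "p = \<gamma> t"
    define u where "u = t *\<^sub>R Z p w"
    have DZu: "DZ v u = t *\<^sub>R DZ v (Z p w)"
      unfolding u_def using has_derivative_linear[OF DZ(1)[of v]] by (simp add: linear_cmul)
    \<comment> \<open>Error of replacing the derivative of \<open>Z _ v\<close> in direction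
      \<open>u\<close> by a difference quotient, plus the change of \<open>Z _ w\<close> between the
      two flows. Its rate of decay depends on the time \<open>t\<close>, since differentiability at
      the points of the trajectory is not uniform.\<close>
    define \<rho> where "\<rho> k = norm ((1 / \<epsilon> k) *\<^sub>R (Z (p + \<epsilon> k *\<^sub>R u) v - Z p v) - DZ v u) + 2 * K * M * (norm w)\<^sup>2 * \<epsilon> k" for k
    have "\<rho> \<longlonglongrightarrow> 0"
    proof -
      have "((\<lambda>s. p + s *\<^sub>R u) has_vector_derivative u) (at 0)"
        by (auto intro!: derivative_eq_intros)
      then have "(((\<lambda>y. Z y v) \<circ> (\<lambda>s. p + s *\<^sub>R u)) has_vector_derivative DZ v u) (at 0)"
        using DZ(1)[of v] by (intro vector_derivative_diff_chain_within) (auto simp: p_def intro: has_derivative_at_withinI)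
      then have "(\<lambda>k. (1 / \<epsilon> k) *\<^sub>R (((\<lambda>y. Z y v) \<circ> (\<lambda>s. p + s *\<^sub>R u)) (0 + \<epsilon> k) - ((\<lambda>y. Z y v) \<circ> (\<lambda>s. p + s *\<^sub>R u)) 0)) \<longlonglongrightarrow> DZ v u"
        by (rule has_vector_derivative_sequential[OF _ \<epsilon> \<epsilon>lim])
      then have "(\<lambda>k. (1 / \<epsilon> k) *\<^sub>R (Z (p + \<epsilon> k *\<^sub>R u) v - Z p v) - DZ v u) \<longlonglongrightarrow> 0"
        by (simp add: LIM_zero_iff)
      from tendsto_add[OF tendsto_norm[OF this] tendsto_mult_left[OF \<epsilon>lim, of "2 * K * M * (norm w)\<^sup>2"]]
      show ?thesis unfolding \<rho>_def by simp
    qed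
    moreover have "\<exists>D. (f k has_vector_derivative D) (at t) \<and> norm D \<le> S k / 2 + c + \<rho> k" for k
    proof -
      have at: "at t within {0..1} = at t" using t by (simp add: at_within_Icc_at)
      have 1: "(\<delta> k has_vector_derivative Z (\<delta> k t) (v + \<epsilon> k *\<^sub>R w)) (at t)" using \<delta>d[OF t01] unfolding at .
      have 2: "(\<gamma> has_vector_derivative Z p v) (at t)" using \<gamma>d[OF t01] unfolding at p_def .
      have 3: "((\<lambda>s. Z (\<gamma> s) w) has_vector_derivative DZ w (Z p v)) (at t)"
        using vector_derivative_diff_chain_within[OF 2 has_derivative_at_withinI[OF DZ(1)[of w]]] by (simp add: o_def)
      define D where "D = (1 / \<epsilon> k) *\<^sub>R (Z (\<delta> k t) (v + \<epsilon> k *\<^sub>R w) - Z p v) - (t *\<^sub>R DZ w (Z p v) + 1 *\<^sub>R Z p w)"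
      have "(f k has_vector_derivative D) (at t)"
        unfolding f_def D_def p_def
        by (intro has_vector_derivative_diff has_vector_derivative_scaleR DERIV_ident
            bounded_linear.has_vector_derivative[OF bounded_linear_scaleR_right] 1 2[unfolded p_def] 3[unfolded p_def])
      moreover have "norm D \<le> S k / 2 + c + \<rho> k"
      proof -
        define a where "a = \<epsilon> k"
        have a: "a > 0" using \<epsilon> by (simp add: a_def)
        \<comment> \<open>\<open>D1\<close> is proportional to \<open>f k\<close> and absorbed into
          \<open>S k / 2\<close>; \<open>D2\<close> and \<open>D3\<close> make up
          \<open>\<rho> k\<close>; \<open>D4\<close> is the bracket, one half of which comes from
          differentiating the correction \<open>t *\<^sub>R Z (\<gamma> t) w\<close>.\<close>
        define D1 where "D1 = (1 / a) *\<^sub>R (Z (\<delta> k t) v - Z (p + a *\<^sub>R u) v)"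
        define D2 where "D2 = Z (\<delta> k t) w - Z p w"
        define D3 where "D3 = (1 / a) *\<^sub>R (Z (p + a *\<^sub>R u) v - Z p v) - DZ v u"
        define D4 where "D4 = t *\<^sub>R (DZ v (Z p w) - DZ w (Z p v))"
        have Deq: "D = D1 + D2 + D3 + D4"
          using a by (simp add: D_def D1_def D2_def D3_def D4_def DZu a_def[symmetric] linear_add[OF linear_Z]
              linear_cmul[OF linear_Z] scaleR_add_right scaleR_diff_right)
        have "norm D \<le> norm D1 + norm D2 + norm D3 + norm D4"
          unfolding Deq using norm_triangle_ineq[of "D1 + D2 + D3" D4] norm_triangle_ineq[of "D1 + D2" D3] norm_triangle_ineq[of D1 D2] by linarith
        moreover have "norm D1 \<le> S k / 2"
        proof -
          have "\<delta> k t - (p + a *\<^sub>R u) = a *\<^sub>R f k t"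
            using a by (simp add: f_def a_def[symmetric] p_def u_def scaleR_diff_right)
          then have "norm (Z (\<delta> k t) v - Z (p + a *\<^sub>R u) v) \<le> K * (a * norm (f k t)) * norm v"
            using lipschitz_Z[of "\<delta> k t" v "p + a *\<^sub>R u"] a by simp
          also have "\<dots> \<le> a * norm (f k t) / 2" by (rule Kv) (use a in simp)
          also have "\<dots> \<le> a * S k / 2" using m(2)[OF t01, of k] a by (simp add: S_def)
          finally show ?thesis using a by (simp add: D1_def pos_divide_le_eq mult_ac)
        qed
        moreover have "norm D2 \<le> 2 * K * M * (norm w)\<^sup>2 * \<epsilon> k"
        proof -
          have "norm D2 \<le> K * norm (\<delta> k t - p) * norm w" unfolding D2_def by (rule lipschitz_Z)
          also have "\<dots> \<le> K * (2 * M * norm w * \<epsilon> k) * norm w"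
            using \<delta>\<gamma>[OF t01, of k] K_nonneg by (intro mult_right_mono mult_left_mono) (auto simp: p_def)
          finally show ?thesis by (simp add: power2_eq_square mult_ac)
        qed
        moreover have "norm D4 \<le> c"
        proof -
          have "norm D4 \<le> norm (DZ v (Z p w) - DZ w (Z p v))"
            using t by (simp add: D4_def mult_left_le_one_le)
          also have "\<dots> \<le> C * \<omega> p * norm w * norm v" unfolding p_def by (rule DZ(2))
          also have "\<dots> \<le> C * (2 * \<omega> z) * norm w * r"
            using \<omega>_flow_le[OF x good t01] v(2) C_nonneg \<omega>_nonneg[of z] r_pos
            by (intro mult_mono) (auto simp: p_def \<gamma>_def z_def v_def \<omega>_nonneg)
          finally show ?thesis by (simp add: c_def mult_ac)
        qed
        ultimately show ?thesis by (simp add: \<rho>_def D3_def a_def)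
      qed
      ultimately show ?thesis by blast
    qed
    ultimately show "\<exists>r. r \<longlonglongrightarrow> 0 \<and> (\<forall>k. \<exists>D. (f k has_vector_derivative D) (at t) \<and> norm D \<le> S k / 2 + c + r k)"
      by blast
  qed
  moreover have "\<forall>\<^sub>F k in sequentially. \<epsilon> k < d" using \<epsilon>lim \<open>d > 0\<close> by (intro order_tendstoD) auto
  ultimately have "\<forall>\<^sub>F k in sequentially. norm (f k 1) \<le> 2 * c + e \<and> \<epsilon> k < d" by (rule eventually_conj)
  then obtain k where k: "norm (f k 1) \<le> 2 * c + e" "\<epsilon> k < d" using eventually_happens by fastforce
  have "\<Psi> (x + \<epsilon> k *\<^sub>R w) - \<Psi> x - \<epsilon> k *\<^sub>R Z (\<Psi> x) w = \<epsilon> k *\<^sub>R f k 1"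
    using \<epsilon>[of k] by (simp add: \<Psi>k \<Psi>x f_def scaleR_diff_right)
  then have "norm (\<Psi> (x + \<epsilon> k *\<^sub>R w) - \<Psi> x - \<epsilon> k *\<^sub>R Z (\<Psi> x) w) = \<epsilon> k * norm (f k 1)"
    using \<epsilon>[of k] by simp
  also have "\<dots> \<le> \<epsilon> k * (2 * c + e)" using k(1) \<epsilon>[of k] by simp
  finally have "norm (\<Psi> (x + \<epsilon> k *\<^sub>R w) - \<Psi> x - \<epsilon> k *\<^sub>R Z (\<Psi> x) w) \<le> \<epsilon> k * (4 * C * r * \<omega> (base x) * norm w + e)"
    by (simp add: c_def z_def mult.assoc)
  then show ?thesis using \<epsilon>[of k] k(2) xw by blast
qed

text \<open>The infinitesimal estimate is integrated along the segment from \<open>x\<close> to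
  \<open>x + w\<close>, all of whose points have the same base. By Fubini, for almost every
  \<open>x\<close> almost all points of the segment are good; continuity in \<open>x\<close> then
  covers all \<open>x\<close>. The quadratic term is the variation of \<open>Z (\<Psi> _) w\<close>
  along the segment.\<close>

lemma \<Psi>_first_order:
  assumes x: "x \<in> ball x0 (r / 2)" and w: "P w = w" "norm w < r / 2"
  shows "norm (\<Psi> (x + w) - \<Psi> x - Z (\<Psi> x) w) \<le> 4 * C * r * \<omega> (base x) * norm w + 2 * K * M * (norm w)\<^sup>2"
proof -
  define Bad where "Bad = {x \<in> ball x0 r. \<not> good_ray x}"
  have Bad: "negligible Bad" unfolding Bad_def by (rule negligible_bad_rays)
  have "AE x in lborel. negligible {s. s > 0 \<and> x + s *\<^sub>R w \<in> Bad}"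
  proof (rule AE_negligible_family[OF Bad])
    have "continuous_on UNIV (\<lambda>z::real \<times> 'a. snd z + fst z *\<^sub>R w)" by (intro continuous_intros)
    then have "(\<lambda>z::real \<times> 'a. snd z + fst z *\<^sub>R w) \<in> borel_measurable borel" by (rule borel_measurable_continuous_onI)
    then show "(\<lambda>(s, x::'a). x + s *\<^sub>R w) \<in> borel_measurable (borel \<Otimes>\<^sub>M borel)"
      by (simp add: borel_prod case_prod_beta')
    fix s :: real and N' :: "'a set" assume "negligible N'"
    then have "negligible ((+) (- (s *\<^sub>R w)) ` N')" by (rule negligible_translation)
    moreover have "{x. x + s *\<^sub>R w \<in> N'} \<subseteq> (+) (- (s *\<^sub>R w)) ` N'"
    proof
      fix x assume "x \<in> {x. x + s *\<^sub>R w \<in> N'}"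
      then have "x + s *\<^sub>R w \<in> N'" "x = - (s *\<^sub>R w) + (x + s *\<^sub>R w)" by auto
      then show "x \<in> (+) (- (s *\<^sub>R w)) ` N'" by blast
    qed
    ultimately show "negligible {x. x + s *\<^sub>R w \<in> N'}" using negligible_subset by blast
  qed
  then have "AE x in lebesgue. negligible {s. s > 0 \<and> x + s *\<^sub>R w \<in> Bad}" by (rule AE_completion)
  then have neg: "negligible {x. \<not> negligible {s. s > 0 \<and> x + s *\<^sub>R w \<in> Bad}}"
    by (auto simp: negligible_iff_null_sets eventually_ae_filter intro: null_sets_completion_subset)
  have inball: "y + s *\<^sub>R w \<in> ball x0 r" if y: "y \<in> ball x0 (r / 2)" and s: "s \<in> {0..1}" for y s
  proof -
    have "norm (s *\<^sub>R w) \<le> norm w" using s by (simp add: mult_left_le_one_le)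
    then show ?thesis
      using y w(2) norm_triangle_ineq[of "y - x0" "s *\<^sub>R w"]
      by (simp add: dist_norm norm_minus_commute[of x0] algebra_simps)
  qed
  have sub: "ball x0 (r / 2) \<subseteq> ball x0 r" using r_pos by auto
  show ?thesis
  proof (rule AE_le_imp_le[OF open_ball _ _ neg _ x])
    have cw: "continuous_on (ball x0 (r / 2)) (\<lambda>x. \<Psi> (x + w))"
      by (rule continuous_on_compose2[OF continuous_\<Psi>])
         (use inball[where s=1] in \<open>auto intro!: continuous_intros\<close>)
    have c: "continuous_on (ball x0 (r / 2)) \<Psi>" using continuous_on_subset[OF continuous_\<Psi> sub] .
    have cz: "continuous_on (ball x0 (r / 2)) (\<lambda>x. Z (\<Psi> x) w)"
      by (rule continuous_on_compose2[OF continuous_Z[of UNIV w] c]) auto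
    show "continuous_on (ball x0 (r / 2)) (\<lambda>x. norm (\<Psi> (x + w) - \<Psi> x - Z (\<Psi> x) w))"
      by (intro continuous_intros cw c cz)
    have "1-lipschitz_on UNIV base" using norm_base_diff by (intro lipschitz_onI) (auto simp: dist_norm)
    then have "continuous_on (ball x0 (r / 2)) (\<lambda>x. \<omega> (base x))"
      using continuous_on_compose2[OF continuous_\<omega>[of UNIV] lipschitz_on_continuous_on] continuous_on_subset by blast
    then show "continuous_on (ball x0 (r / 2)) (\<lambda>x. 4 * C * r * \<omega> (base x) * norm w + 2 * K * M * (norm w)\<^sup>2)"
      by (intro continuous_intros)
  next
    fix x assume x: "x \<in> ball x0 (r / 2)" and "x \<notin> {x. \<not> negligible {s. s > 0 \<and> x + s *\<^sub>R w \<in> Bad}}"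
    then have n: "negligible {s. s > 0 \<and> x + s *\<^sub>R w \<in> Bad}" by simp
    define f where "f s = \<Psi> (x + s *\<^sub>R w) - s *\<^sub>R Z (\<Psi> x) w" for s
    have along: "norm (\<Psi> (x + s *\<^sub>R w) - \<Psi> (x + t *\<^sub>R w)) \<le> 2 * M * norm w * \<bar>s - t\<bar>"
      if st: "s \<in> {0..1}" "t \<in> {0..1}" for s t
    proof -
      have "x + t *\<^sub>R w + (s - t) *\<^sub>R w = x + s *\<^sub>R w" by (simp add: algebra_simps)
      then show ?thesis
        using \<Psi>_along[of "x + t *\<^sub>R w" "(s - t) *\<^sub>R w"] inball[OF x st(1)] inball[OF x st(2)] w(1)
        by (simp add: linear_P_simps(3) add.assoc mult_ac)
    qed
    have base: "base (x + s *\<^sub>R w) = base x" for s using w(1) by (simp add: base_def linear_P_simps)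
    have lipf: "(2 * M * norm w + M * norm w)-lipschitz_on {0..1} f"
    proof (rule lipschitz_onI)
      fix s t :: real assume st: "s \<in> {0..1}" "t \<in> {0..1}"
      have "f s - f t = (\<Psi> (x + s *\<^sub>R w) - \<Psi> (x + t *\<^sub>R w)) - (s - t) *\<^sub>R Z (\<Psi> x) w"
        by (simp add: f_def algebra_simps)
      then have "norm (f s - f t) \<le> norm (\<Psi> (x + s *\<^sub>R w) - \<Psi> (x + t *\<^sub>R w)) + norm ((s - t) *\<^sub>R Z (\<Psi> x) w)"
        by (metis norm_triangle_ineq4)
      moreover have "norm ((s - t) *\<^sub>R Z (\<Psi> x) w) \<le> \<bar>s - t\<bar> * (M * norm w)"
        using norm_Z by (simp add: mult_left_mono)
      ultimately show "dist (f s) (f t) \<le> (2 * M * norm w + M * norm w) * dist s t"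
        using along[OF st] by (simp add: dist_norm algebra_simps)
    qed (use M_nonneg in simp)
    define c where "c = 4 * C * r * \<omega> (base x) * norm w + 2 * K * M * (norm w)\<^sup>2"
    have "norm (f 1 - f 0) \<le> c * (1 - 0)"
    proof (rule lipschitz_increment_le[OF _ lipf])
      \<comment> \<open>The Fubini lemma speaks of positive parameters only, so the parameter
        \<open>0\<close> is added by hand.\<close>
      show "negligible (insert 0 {s. s > 0 \<and> x + s *\<^sub>R w \<in> Bad})" using n by simp
      fix s e :: real assume s: "s \<in> {0..<1}" "s \<notin> insert 0 {s. s > 0 \<and> x + s *\<^sub>R w \<in> Bad}" and e: "e > 0"
      then have s': "s \<in> {0..1}" "x + s *\<^sub>R w \<notin> Bad" by auto
      have b: "x + s *\<^sub>R w \<in> ball x0 r" by (rule inball[OF x s'(1)])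
      then have "good_ray (x + s *\<^sub>R w)" using s'(2) by (auto simp: Bad_def)
      then obtain h where h: "h > 0" "h < 1 - s"
        "norm (\<Psi> (x + s *\<^sub>R w + h *\<^sub>R w) - \<Psi> (x + s *\<^sub>R w) - h *\<^sub>R Z (\<Psi> (x + s *\<^sub>R w)) w) \<le> h * (4 * C * r * \<omega> (base x) * norm w + e)"
        using flow_first_order[OF b _ w(1) e, of "1 - s"] s(1) base by auto
      define A where "A = \<Psi> (x + s *\<^sub>R w + h *\<^sub>R w) - \<Psi> (x + s *\<^sub>R w) - h *\<^sub>R Z (\<Psi> (x + s *\<^sub>R w)) w"
      define B where "B = Z (\<Psi> (x + s *\<^sub>R w)) w - Z (\<Psi> x) w"
      have "f (s + h) - f s = A + h *\<^sub>R B"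
        by (simp add: f_def A_def B_def algebra_simps)
      then have "norm (f (s + h) - f s) \<le> norm A + h * norm B"
        using norm_triangle_ineq[of A "h *\<^sub>R B"] h(1) by simp
      moreover have "norm B \<le> 2 * K * M * (norm w)\<^sup>2"
      proof -
        have "norm B \<le> K * norm (\<Psi> (x + s *\<^sub>R w) - \<Psi> x) * norm w" unfolding B_def by (rule lipschitz_Z)
        also have "norm (\<Psi> (x + s *\<^sub>R w) - \<Psi> x) \<le> 2 * M * norm w"
        proof -
          have "norm (\<Psi> (x + s *\<^sub>R w) - \<Psi> x) \<le> 2 * M * norm w * \<bar>s\<bar>" using along[OF s'(1), of 0] by simp
          also have "\<dots> \<le> 2 * M * norm w" using s'(1) M_nonneg by (simp add: mult_left_le)
          finally show ?thesis .
        qed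
        finally show ?thesis using K_nonneg by (simp add: power2_eq_square mult_ac mult_left_mono mult_right_mono)
      qed
      then have "h * norm B \<le> h * (2 * K * M * (norm w)\<^sup>2)" using h(1) by simp
      ultimately have "norm (f (s + h) - f s) \<le> (c + e) * h"
        using h(3) unfolding A_def[symmetric] by (simp add: c_def algebra_simps)
      then show "\<exists>h>0. s + h \<le> 1 \<and> norm (f (s + h) - f s) \<le> (c + e) * h"
        using h by (intro exI[of _ h]) auto
    qed auto
    then show "norm (\<Psi> (x + w) - \<Psi> x - Z (\<Psi> x) w) \<le> 4 * C * r * \<omega> (base x) * norm w + 2 * K * M * (norm w)\<^sup>2"
      by (simp add: f_def c_def algebra_simps)
  qed
qed

lemma \<omega>_\<Psi>_le:
  assumes x: "x \<in> ball x0 r"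
  shows "\<omega> (\<Psi> x) \<le> 2 * \<omega> (base x)"
proof (rule AE_le_imp_le[OF open_ball _ _ negligible_bad_rays _ x])
  show "continuous_on (ball x0 r) (\<lambda>x. \<omega> (\<Psi> x))"
    by (rule continuous_on_compose2[OF continuous_\<omega>[of UNIV] continuous_\<Psi>]) auto
  have "1-lipschitz_on UNIV base" using norm_base_diff by (intro lipschitz_onI) (auto simp: dist_norm)
  then have "continuous_on (ball x0 r) (\<lambda>x. \<omega> (base x))"
    using continuous_on_compose2[OF continuous_\<omega>[of UNIV] lipschitz_on_continuous_on] continuous_on_subset by blast
  then show "continuous_on (ball x0 r) (\<lambda>x. 2 * \<omega> (base x))" by (intro continuous_intros)
  show "\<omega> (\<Psi> x) \<le> 2 * \<omega> (base x)" if "x \<in> ball x0 r" "x \<notin> {x \<in> ball x0 r. \<not> good_ray x}" for x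
    unfolding \<Psi>_def using that by (intro \<omega>_flow_le) auto
qed

theorem integral_surface_exists:
  obtains \<phi> \<rho> where "\<rho> > 0" "\<phi> 0 = x0"
    "\<And>v. P v = v \<Longrightarrow> norm v < \<rho> \<Longrightarrow> P (\<phi> v - x0) = v"
    "\<And>v w. P v = v \<Longrightarrow> norm v < \<rho> \<Longrightarrow> P w = w \<Longrightarrow> norm w < \<rho> \<Longrightarrow> norm (\<phi> w - \<phi> v) \<le> 2 * M * norm (w - v)"
    "\<And>v w. P v = v \<Longrightarrow> norm v < \<rho> \<Longrightarrow> P w = w \<Longrightarrow> norm w < \<rho> \<Longrightarrow>
       norm (\<phi> w - \<phi> v - Z (\<phi> v) (w - v)) \<le> 2 * K * M * (norm (w - v))\<^sup>2"
    "\<And>v l. P v = v \<Longrightarrow> norm v < \<rho> \<Longrightarrow> l < q \<Longrightarrow> W l (\<phi> v) = 0"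
proof -
  define \<phi> where "\<phi> v = \<Psi> (x0 + v)" for v
  \<comment> \<open>Horizontal displacements from \<open>x0\<close> all have base \<open>x0\<close>,
    where \<open>\<omega>\<close> vanishes; this removes the error terms from the estimates for
    \<open>\<Psi>\<close>.\<close>
  have base: "base (x0 + v) = x0" if "P v = v" for v using that by (simp add: base_def)
  have \<omega>0: "\<omega> x0 = 0" using W_x0 by (simp add: \<omega>_def)
  \<comment> \<open>A quarter, so that the difference of two parameters stays below the bound
    \<open>r / 2\<close> of \<open>\<Psi>_first_order\<close>.\<close>
  have r4: "r / 4 > 0" using r_pos by simp
  have ball: "x0 + v \<in> ball x0 r" "x0 + v \<in> ball x0 (r / 2)" if "norm v < r / 4" for v
    using that r_pos by (auto simp: dist_norm)
  show ?thesis
  proof (rule that[OF r4])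
    show "\<phi> 0 = x0"
    proof -
      have "norm (flow 0 x0 1 - flow 0 x0 0) \<le> M * norm (0::'a) * \<bar>1 - 0\<bar>" by (rule flow_lipschitz) auto
      then show ?thesis using flow_zero[of 0 x0] by (simp add: \<phi>_def \<Psi>_def base_def linear_0[OF linear_P])
    qed
    fix v assume v: "P v = v" "norm v < r / 4"
    show "P (\<phi> v - x0) = v" using P_\<Psi>[OF ball(1)[OF v(2)]] v(1) by (simp add: \<phi>_def)
    show "W l (\<phi> v) = 0" if "l < q" for l
    proof -
      have "\<omega> (\<phi> v) = 0"
        using \<omega>_\<Psi>_le[OF ball(1)[OF v(2)]] \<omega>_nonneg[of "\<phi> v"] base[OF v(1)] \<omega>0 by (simp add: \<phi>_def)
      then have "norm (W l (\<phi> v)) = 0" unfolding \<omega>_def using that by (subst (asm) sum_nonneg_eq_0_iff) auto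
      then show ?thesis by simp
    qed
    fix w assume w: "P w = w" "norm w < r / 4"
    have wv: "P (w - v) = w - v" "norm (w - v) < r / 2"
      using v w norm_triangle_ineq4[of w v] by (auto simp: linear_P_simps)
    show "norm (\<phi> w - \<phi> v) \<le> 2 * M * norm (w - v)"
      using \<Psi>_along[OF ball(1)[OF v(2)], of "w - v"] ball(1)[OF w(2)] wv by (simp add: \<phi>_def)
    show "norm (\<phi> w - \<phi> v - Z (\<phi> v) (w - v)) \<le> 2 * K * M * (norm (w - v))\<^sup>2"
      using \<Psi>_first_order[OF ball(2)[OF v(2)] wv] base[OF v(1)] \<omega>0 by (simp add: \<phi>_def)
  qed
qed

end

section \<open>Normalised frames\<close>

lemma orthogonal_projection_exists:
  fixes L :: "'a::euclidean_space set"
  assumes L: "subspace L"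
  obtains P where "linear P" "\<And>x. P x \<in> L" "\<And>x. x \<in> L \<Longrightarrow> P x = x"
    "\<And>x. norm (P x) \<le> norm x" "\<And>x. norm (x - P x) \<le> norm x"
proof -
  obtain B where B: "B \<subseteq> L" "pairwise orthogonal B" "\<And>b. b \<in> B \<Longrightarrow> norm b = 1"
    "independent B" "span B = L"
    using orthonormal_basis_subspace[OF L] by metis
  have fin: "finite B" using B(4) by (rule independent_imp_finite)
  define P where "P x = (\<Sum>b\<in>B. (x \<bullet> b) *\<^sub>R b)" for x
  have lin: "linear P" unfolding P_def
    by (rule linearI) (simp_all add: inner_add_left scaleR_add_left sum.distrib scaleR_sum_right)
  have PL: "P x \<in> L" for x unfolding P_def using B(1) L by (intro subspace_sum subspace_scale) auto
  have orthb: "(x - P x) \<bullet> b = 0" if b: "b \<in> B" for x b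
  proof -
    have "P x \<bullet> b = (\<Sum>b'\<in>B. (x \<bullet> b') * (b' \<bullet> b))" by (simp add: P_def inner_sum_left)
    also have "\<dots> = (\<Sum>b'\<in>B. if b' = b then x \<bullet> b else 0)"
      using B(2,3) b by (intro sum.cong) (auto simp: pairwise_def orthogonal_def norm_eq_1)
    also have "\<dots> = x \<bullet> b" using fin b by simp
    finally show ?thesis by (simp add: inner_diff_left)
  qed
  have orth: "(x - P x) \<bullet> y = 0" if "y \<in> L" for x y
  proof -
    have "orthogonal (x - P x) y"
      by (rule orthogonal_to_span[of y B]) (use that B(5) orthb in \<open>auto simp: orthogonal_def\<close>)
    then show ?thesis by (simp add: orthogonal_def)
  qed
  have pyth: "(norm x)\<^sup>2 = (norm (P x))\<^sup>2 + (norm (x - P x))\<^sup>2" for x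
  proof -
    have "orthogonal (P x) (x - P x)" using orth[OF PL, of x x] by (simp add: orthogonal_def inner_commute)
    from norm_add_Pythagorean[OF this] show ?thesis by simp
  qed
  have "P x = x" if x: "x \<in> L" for x
  proof -
    have "x - P x \<in> L" using x PL L by (simp add: subspace_diff)
    then have "(x - P x) \<bullet> (x - P x) = 0" by (rule orth)
    then show ?thesis by simp
  qed
  moreover have "norm (P x) \<le> norm x" for x by (rule power2_le_imp_le) (use pyth[of x] in auto)
  moreover have "norm (x - P x) \<le> norm x" for x by (rule power2_le_imp_le) (use pyth[of x] in auto)
  ultimately show ?thesis using that[of P] lin PL by blast
qed

lemma norm_le_if_inner_le:
  fixes u :: "'a::real_inner"
  assumes "\<And>v. \<bar>u \<bullet> v\<bar> \<le> c * norm v" "c \<ge> 0"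
  shows "norm u \<le> c"
proof (cases "u = 0")
  case False
  have "norm u * norm u \<le> c * norm u" using assms(1)[of u] by (simp add: dot_square_norm power2_eq_square)
  then show ?thesis using False by simp
qed (use assms in simp)

lemma lipschitz_has_derivative_bound:
  fixes f :: "'a::real_normed_vector \<Rightarrow> 'b::real_normed_vector"
  assumes lip: "L-lipschitz_on UNIV f" and D: "(f has_derivative D) (at x)"
  shows "norm (D h) \<le> L * norm h"
proof -
  have "((\<lambda>s. x + s *\<^sub>R h) has_vector_derivative h) (at 0)" by (auto intro!: derivative_eq_intros)
  then have "((f \<circ> (\<lambda>s. x + s *\<^sub>R h)) has_vector_derivative D h) (at 0)"
    using D by (intro vector_derivative_diff_chain_within) (auto intro: has_derivative_at_withinI)
  moreover have "(L * norm h)-lipschitz_on UNIV (f \<circ> (\<lambda>s. x + s *\<^sub>R h))"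
  proof (rule lipschitz_onI)
    fix s t :: real
    show "dist ((f \<circ> (\<lambda>s. x + s *\<^sub>R h)) s) ((f \<circ> (\<lambda>s. x + s *\<^sub>R h)) t) \<le> L * norm h * dist s t"
      using lipschitz_onD[OF lip, of "x + s *\<^sub>R h" "x + t *\<^sub>R h"]
      by (simp add: dist_norm scaleR_left_diff_distrib[symmetric] mult_ac)
  qed (use lipschitz_on_nonneg[OF lip] in simp)
  ultimately show ?thesis by (intro lipschitz_on_norm_deriv_le[of _ UNIV]) auto
qed

text \<open>Leibniz rule at one point: \<open>db\<close> and \<open>da\<close> stand for the
  derivatives of the coefficients \<open>\<beta>\<close> along \<open>X\<close> and
  \<open>\<alpha>\<close> along \<open>Y\<close>. The remaining terms pair up into brackets of the
  fields, so the bracket of two combinations is again a combination, with explicit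
  coefficients.\<close>

lemma lie_bracket_combination:
  fixes gx :: "nat \<Rightarrow> 'a::real_vector" and Dg :: "nat \<Rightarrow> 'a \<Rightarrow> 'a"
  assumes lin: "\<And>j. j < q \<Longrightarrow> linear (Dg j)"
    and c: "\<And>j k. j < q \<Longrightarrow> k < q \<Longrightarrow> Dg k (gx j) - Dg j (gx k) = (\<Sum>l<q. c j k l *\<^sub>R gx l)"
    and X: "X = (\<Sum>j<q. \<alpha> j *\<^sub>R gx j)" and Y: "Y = (\<Sum>j<q. \<beta> j *\<^sub>R gx j)"
  shows "(\<Sum>k<q. db k *\<^sub>R gx k + \<beta> k *\<^sub>R Dg k X) - (\<Sum>j<q. da j *\<^sub>R gx j + \<alpha> j *\<^sub>R Dg j Y)
    = (\<Sum>l<q. (db l - da l + (\<Sum>j<q. \<Sum>k<q. \<alpha> j * \<beta> k * c j k l)) *\<^sub>R gx l)"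
proof -
  have 1: "(\<Sum>k<q. \<beta> k *\<^sub>R Dg k X) = (\<Sum>j<q. \<Sum>k<q. (\<alpha> j * \<beta> k) *\<^sub>R Dg k (gx j))"
  proof -
    have "(\<Sum>k<q. \<beta> k *\<^sub>R Dg k X) = (\<Sum>k<q. \<Sum>j<q. (\<alpha> j * \<beta> k) *\<^sub>R Dg k (gx j))"
      unfolding X using lin by (intro sum.cong) (auto simp: linear_sum linear_cmul scaleR_sum_right mult.commute)
    then show ?thesis by (subst sum.swap)
  qed
  have 2: "(\<Sum>j<q. \<alpha> j *\<^sub>R Dg j Y) = (\<Sum>j<q. \<Sum>k<q. (\<alpha> j * \<beta> k) *\<^sub>R Dg j (gx k))"
    unfolding Y using lin by (intro sum.cong) (auto simp: linear_sum linear_cmul scaleR_sum_right)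
  have "(\<Sum>k<q. \<beta> k *\<^sub>R Dg k X) - (\<Sum>j<q. \<alpha> j *\<^sub>R Dg j Y)
      = (\<Sum>j<q. \<Sum>k<q. (\<alpha> j * \<beta> k) *\<^sub>R (Dg k (gx j) - Dg j (gx k)))"
    unfolding 1 2 by (simp add: sum_subtractf scaleR_diff_right)
  also have "\<dots> = (\<Sum>j<q. \<Sum>k<q. \<Sum>l<q. (\<alpha> j * \<beta> k * c j k l) *\<^sub>R gx l)"
    using c by (intro sum.cong) (auto simp: scaleR_sum_right)
  also have "\<dots> = (\<Sum>j<q. \<Sum>l<q. \<Sum>k<q. (\<alpha> j * \<beta> k * c j k l) *\<^sub>R gx l)"
    by (intro sum.cong refl sum.swap)
  also have "\<dots> = (\<Sum>l<q. \<Sum>j<q. \<Sum>k<q. (\<alpha> j * \<beta> k * c j k l) *\<^sub>R gx l)"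
    by (rule sum.swap)
  also have "\<dots> = (\<Sum>l<q. (\<Sum>j<q. \<Sum>k<q. \<alpha> j * \<beta> k * c j k l) *\<^sub>R gx l)"
    by (simp add: scaleR_sum_left)
  finally show ?thesis
    by (simp add: sum.distrib scaleR_add_left scaleR_diff_left sum_subtractf algebra_simps)
qed

lemma locally_lipschitz_family:
  fixes g :: "nat \<Rightarrow> 'a::euclidean_space \<Rightarrow> 'b::metric_space"
  assumes "\<forall>j<q. locally_lipschitz (g j)"
  obtains r L where "r > 0" "\<And>j. j < q \<Longrightarrow> L-lipschitz_on (cball x r) (g j)" "L \<ge> 0"
proof -
  have "\<exists>r>0. \<exists>L\<ge>0. \<forall>j<q. L-lipschitz_on (cball x r) (g j)"
    using assms
  proof (induction q)
    case 0
    show ?case by (intro exI[of _ 1]) auto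
  next
    case (Suc q)
    then obtain r1 L1 where 1: "r1 > 0" "L1 \<ge> 0" "\<And>j. j < q \<Longrightarrow> L1-lipschitz_on (cball x r1) (g j)" by auto
    obtain r2 L2 where 2: "r2 > 0" "L2-lipschitz_on (ball x r2) (g q)"
      using Suc.prems unfolding locally_lipschitz_def by blast
    define r where "r = min r1 (r2 / 2)"
    have sub: "cball x r \<subseteq> cball x r1" "cball x r \<subseteq> ball x r2" using 2(1) by (auto simp: r_def)
    have "(max L1 L2)-lipschitz_on (cball x r) (g j)" if "j < Suc q" for j
    proof (cases "j = q")
      case True
      then show ?thesis using 2(2) sub(2) by (auto intro: lipschitz_on_mono[where M=L2])
    next
      case False
      then show ?thesis using 1(3)[of j] sub(1) that by (auto intro: lipschitz_on_mono[where M=L1])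
    qed
    then show ?case using 1 2 by (intro exI[of _ r] conjI exI[of _ "max L1 L2"]) (auto simp: r_def)
  qed
  then show ?thesis using that by blast
qed

lemma Pspace_iff_combination:
  "v \<in> Pspace g q x \<longleftrightarrow> (\<exists>c. v = (\<Sum>j<q. c j *\<^sub>R g j x))"
proof
  assume "v \<in> Pspace g q x"
  moreover have "Pspace g q x \<subseteq> {v. \<exists>c. v = (\<Sum>j<q. c j *\<^sub>R g j x)}"
    unfolding Pspace_def
  proof (rule span_minimal)
    show "{g j x | j. j < q} \<subseteq> {v. \<exists>c. v = (\<Sum>j<q. c j *\<^sub>R g j x)}"
    proof clarify
      fix j assume "j < q"
      then show "\<exists>c. g j x = (\<Sum>i<q. c i *\<^sub>R g i x)"
        by (intro exI[of _ "\<lambda>i. if i = j then 1 else 0"]) (simp add: if_distrib[of "\<lambda>t. t *\<^sub>R _"] cong: if_cong)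
    qed
    show "subspace {v. \<exists>c. v = (\<Sum>j<q. c j *\<^sub>R g j x)}"
    proof (rule subspaceI)
      show "0 \<in> {v. \<exists>c. v = (\<Sum>j<q. c j *\<^sub>R g j x)}" by (auto intro!: exI[of _ "\<lambda>_. 0"])
      fix u v assume "u \<in> {v. \<exists>c. v = (\<Sum>j<q. c j *\<^sub>R g j x)}" "v \<in> {v. \<exists>c. v = (\<Sum>j<q. c j *\<^sub>R g j x)}"
      then obtain c d where "u = (\<Sum>j<q. c j *\<^sub>R g j x)" "v = (\<Sum>j<q. d j *\<^sub>R g j x)" by auto
      then have "u + v = (\<Sum>j<q. (c j + d j) *\<^sub>R g j x)" by (simp add: scaleR_add_left sum.distrib)
      then show "u + v \<in> {v. \<exists>c. v = (\<Sum>j<q. c j *\<^sub>R g j x)}" by (auto intro!: exI[of _ "\<lambda>j. c j + d j"])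
    next
      fix a u assume "u \<in> {v. \<exists>c. v = (\<Sum>j<q. c j *\<^sub>R g j x)}"
      then obtain c where "u = (\<Sum>j<q. c j *\<^sub>R g j x)" by auto
      then have "a *\<^sub>R u = (\<Sum>j<q. (a * c j) *\<^sub>R g j x)" by (simp add: scaleR_sum_right)
      then show "a *\<^sub>R u \<in> {v. \<exists>c. v = (\<Sum>j<q. c j *\<^sub>R g j x)}" by (auto intro!: exI[of _ "\<lambda>j. a * c j"])
    qed
  qed
  ultimately show "\<exists>c. v = (\<Sum>j<q. c j *\<^sub>R g j x)" by blast
next
  assume "\<exists>c. v = (\<Sum>j<q. c j *\<^sub>R g j x)"
  then show "v \<in> Pspace g q x"
    unfolding Pspace_def by (auto intro!: span_sum span_scale intro: span_base)
qed

text \<open>At \<open>x0\<close> fixed covectors \<open>\<beta> j\<close> express \<open>P\<close>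
  through the fields, also when these are linearly dependent. With the same covectors at a nearby
  \<open>x\<close>, the horizontal part of the combination is close to the identity on the range of
  \<open>P\<close>; composing with its inverse restores the exact normalisation and keeps the
  coefficients Lipschitz.\<close>

lemma local_coefficients:
  fixes g :: "nat \<Rightarrow> 'a::euclidean_space \<Rightarrow> 'a"
  assumes r1: "r1 > 0" and lip: "\<And>j. j < q \<Longrightarrow> L1-lipschitz_on (cball x0 r1) (g j)" and L1: "L1 \<ge> 0"
    and P: "linear P" "\<And>x. P x \<in> Pspace g q x0" "\<And>x. x \<in> Pspace g q x0 \<Longrightarrow> P x = x"
      "\<And>x. norm (P x) \<le> norm x"
  obtains R a A LA where "0 < R" "R \<le> r1" "A \<ge> 0"
    "\<And>j. j < q \<Longrightarrow> LA-lipschitz_on (cball x0 R) (a j)"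
    "\<And>j x. j < q \<Longrightarrow> x \<in> cball x0 R \<Longrightarrow> norm (a j x :: 'a) \<le> A"
    "\<And>x v. x \<in> cball x0 R \<Longrightarrow> P (\<Sum>j<q. (a j x \<bullet> v) *\<^sub>R g j x) = P v"
    "\<And>j x v. x \<in> cball x0 R \<Longrightarrow> a j x \<bullet> P v = a j x \<bullet> v"
    "\<And>v. (\<Sum>j<q. (a j x0 \<bullet> v) *\<^sub>R g j x0) = P v"
proof -
  have PP: "P (P x) = P x" for x using P(2,3) by blast
  have "\<exists>c. P e = (\<Sum>j<q. c j *\<^sub>R g j x0)" for e using P(2) Pspace_iff_combination by metis
  then obtain c where c: "\<And>e. P e = (\<Sum>j<q. c e j *\<^sub>R g j x0)" by metis
  define \<beta> where "\<beta> j = (\<Sum>e\<in>Basis. c e j *\<^sub>R e)" for j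
  have \<beta>: "(\<Sum>j<q. (\<beta> j \<bullet> v) *\<^sub>R g j x0) = P v" for v
  proof -
    have "(\<Sum>j<q. (\<beta> j \<bullet> v) *\<^sub>R g j x0) = (\<Sum>j<q. \<Sum>e\<in>Basis. (v \<bullet> e) *\<^sub>R (c e j *\<^sub>R g j x0))"
      by (simp add: \<beta>_def inner_sum_left scaleR_sum_left inner_commute[of v] mult.commute)
    also have "\<dots> = (\<Sum>e\<in>Basis. (v \<bullet> e) *\<^sub>R P e)"
      by (subst sum.swap) (simp add: c scaleR_sum_right)
    also have "\<dots> = P (\<Sum>e\<in>Basis. (v \<bullet> e) *\<^sub>R e)" using P(1) by (simp add: linear_sum linear_cmul)
    finally show ?thesis by (simp add: euclidean_representation)
  qed
  define G where "G x w = (\<Sum>j<q. (\<beta> j \<bullet> w) *\<^sub>R g j x)" for x w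
  have linG: "linear (G x)" for x unfolding G_def
    by (rule linearI) (simp_all add: inner_add_right scaleR_add_left sum.distrib scaleR_sum_right)
  define KA where "KA = (\<Sum>j<q. norm (\<beta> j) * L1)"
  have KA: "KA \<ge> 0" unfolding KA_def using L1 by (intro sum_nonneg) auto
  have G_lip: "norm (G x w - G y w) \<le> KA * norm (x - y) * norm w" if xy: "x \<in> cball x0 r1" "y \<in> cball x0 r1" for x y w
  proof -
    have "G x w - G y w = (\<Sum>j<q. (\<beta> j \<bullet> w) *\<^sub>R (g j x - g j y))"
      by (simp add: G_def sum_subtractf scaleR_diff_right)
    also have "norm \<dots> \<le> (\<Sum>j<q. norm (\<beta> j) * norm w * (L1 * norm (x - y)))"
    proof (rule sum_norm_le)
      fix j assume "j \<in> {..<q}"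
      then have "norm (g j x - g j y) \<le> L1 * norm (x - y)" using lipschitz_onD[OF lip xy] by (simp add: dist_norm)
      then show "norm ((\<beta> j \<bullet> w) *\<^sub>R (g j x - g j y)) \<le> norm (\<beta> j) * norm w * (L1 * norm (x - y))"
        using Cauchy_Schwarz_ineq2[of "\<beta> j" w] by (simp add: mult_mono)
    qed
    finally show ?thesis by (simp add: KA_def sum_distrib_left sum_distrib_right mult_ac)
  qed
  \<comment> \<open>The horizontal part of \<open>G x\<close> on the range of \<open>P\<close>,
    extended by the identity on the kernel. It is an endomorphism of the whole space and equals the
    identity at \<open>x0\<close>.\<close>
  define A where "A x w = P (G x (P w)) + (w - P w)" for x w
  have linA: "linear (A x)" for x unfolding A_def
    using P(1) linG[of x] by (auto intro!: linearI simp: linear_add linear_cmul scaleR_add_right scaleR_diff_right)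
  have A0: "A x0 w = w" for w by (simp add: A_def G_def \<beta> PP)
  have A_lip: "norm (A x w - A y w) \<le> KA * norm (x - y) * norm w" if xy: "x \<in> cball x0 r1" "y \<in> cball x0 r1" for x y w
  proof -
    have "A x w - A y w = P (G x (P w) - G y (P w))" by (simp add: A_def linear_diff[OF P(1)])
    then have "norm (A x w - A y w) \<le> norm (G x (P w) - G y (P w))" using P(4) by simp
    also have "\<dots> \<le> KA * norm (x - y) * norm (P w)" by (rule G_lip[OF xy])
    also have "\<dots> \<le> KA * norm (x - y) * norm w" using KA P(4) by (intro mult_left_mono) auto
    finally show ?thesis .
  qed
  \<comment> \<open>Within this radius \<open>A x\<close> differs from the identity by at most one
    half, hence is bounded below and invertible.\<close>
  define R where "R = min r1 (1 / (2 * (KA + 1)))"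
  have R: "0 < R" "R \<le> r1" using r1 KA by (auto simp: R_def)
  have KAR: "KA * R \<le> 1/2"
  proof -
    have "KA * R \<le> KA * (1 / (2 * (KA + 1)))" using KA by (intro mult_left_mono) (auto simp: R_def)
    also have "\<dots> \<le> 1/2" using KA by (simp add: field_simps)
    finally show ?thesis .
  qed
  have sub: "x \<in> cball x0 r1" if "x \<in> cball x0 R" for x using that R by auto
  have A_below: "norm w \<le> 2 * norm (A x w)" if x: "x \<in> cball x0 R" for x w
  proof -
    have "norm (A x w - A x0 w) \<le> KA * norm (x - x0) * norm w" by (rule A_lip) (use sub[OF x] r1 in auto)
    also have "\<dots> \<le> KA * R * norm w"
      using x KA by (intro mult_right_mono mult_left_mono) (auto simp: dist_norm norm_minus_commute)
    also have "\<dots> \<le> 1/2 * norm w" using KAR by (intro mult_right_mono) auto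
    finally have "norm (A x w - w) \<le> norm w / 2" by (simp add: A0)
    then show ?thesis using norm_triangle_ineq4[of "A x w" "A x w - w"] by simp
  qed
  have injA: "inj (A x)" if x: "x \<in> cball x0 R" for x
    unfolding linear_injective_0[OF linA]
  proof (intro allI impI)
    fix w assume "A x w = 0"
    then show "w = 0" using A_below[OF x, of w] by simp
  qed
  define B where "B x = inv (A x)" for x
  have AB: "A x (B x w) = w" if "x \<in> cball x0 R" for x w
    using linear_inj_imp_surj[OF linA injA[OF that]] by (simp add: B_def surj_f_inv_f)
  have BA: "B x (A x w) = w" if "x \<in> cball x0 R" for x w
    using injA[OF that] by (simp add: B_def)
  have linB: "linear (B x)" if x: "x \<in> cball x0 R" for x
    by (rule linearI; rule injD[OF injA[OF x]]) (simp_all add: AB[OF x] linear_add[OF linA] linear_cmul[OF linA])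
  have normB: "norm (B x w) \<le> 2 * norm w" if x: "x \<in> cball x0 R" for x w
    using A_below[OF x, of "B x w"] AB[OF x] by simp
  have B_lip: "norm (B x w - B y w) \<le> 4 * KA * norm (x - y) * norm w" if x: "x \<in> cball x0 R" and y: "y \<in> cball x0 R" for x y w
  proof -
    \<comment> \<open>The resolvent identity turns the Lipschitz bound for \<open>A\<close> into one
      for its inverse.\<close>
    have "B x w - B y w = B x (A y (B y w) - A x (B y w))"
      by (simp add: linear_diff[OF linB[OF x]] AB[OF y] BA[OF x])
    then have "norm (B x w - B y w) \<le> 2 * norm (A y (B y w) - A x (B y w))" using normB[OF x] by simp
    also have "norm (A y (B y w) - A x (B y w)) \<le> KA * norm (y - x) * norm (B y w)"
      by (rule A_lip[OF sub[OF y] sub[OF x]])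
    also have "KA * norm (y - x) * norm (B y w) \<le> KA * norm (y - x) * (2 * norm w)"
      using normB[OF y] KA by (intro mult_left_mono) auto
    finally show ?thesis by (simp add: norm_minus_commute mult_ac)
  qed
  \<comment> \<open>Riesz vector of the functional
    \<open>v \<mapsto> \<beta> j \<bullet> P (B x (P v))\<close>; inserting \<open>B x\<close>
    undoes the distortion by \<open>A x\<close>.\<close>
  define a where "a j x = (\<Sum>e\<in>Basis. (\<beta> j \<bullet> P (B x (P e))) *\<^sub>R e)" for j x
  have a: "a j x \<bullet> v = \<beta> j \<bullet> P (B x (P v))" if x: "x \<in> cball x0 R" for j x v
  proof -
    have lin: "linear (\<lambda>v. \<beta> j \<bullet> P (B x (P v)))"
      using P(1) linB[OF x] by (auto intro!: linearI simp: linear_add linear_cmul inner_add_right)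
    have "\<beta> j \<bullet> P (B x (P v)) = \<beta> j \<bullet> P (B x (P (\<Sum>e\<in>Basis. (v \<bullet> e) *\<^sub>R e)))" by (simp add: euclidean_representation)
    also have "\<dots> = (\<Sum>e\<in>Basis. (v \<bullet> e) *\<^sub>R (\<beta> j \<bullet> P (B x (P e))))"
      by (simp only: linear_sum[OF lin] linear_cmul[OF lin])
    finally show ?thesis by (simp add: a_def inner_sum_left inner_commute[of v] mult.commute)
  qed
  define Ab where "Ab = (\<Sum>j<q. norm (\<beta> j)) * 2"
  define LA where "LA = (\<Sum>j<q. norm (\<beta> j)) * (4 * KA)"
  have \<beta>le: "norm (\<beta> j) \<le> (\<Sum>j<q. norm (\<beta> j))" if "j < q" for j
    using that by (intro member_le_sum) auto
  have \<beta>s: "(\<Sum>j<q. norm (\<beta> j)) \<ge> 0" by (rule sum_nonneg) auto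
  show ?thesis
  proof (rule that[OF R, of Ab LA a])
    show "Ab \<ge> 0" using \<beta>s by (simp add: Ab_def)
    show "LA-lipschitz_on (cball x0 R) (a j)" if j: "j < q" for j
    proof (rule lipschitz_onI)
      fix x y assume x: "x \<in> cball x0 R" and y: "y \<in> cball x0 R"
      have "norm (a j x - a j y) \<le> LA * norm (x - y)"
      proof (rule norm_le_if_inner_le)
        fix v
        have "(a j x - a j y) \<bullet> v = \<beta> j \<bullet> P (B x (P v) - B y (P v))"
          by (simp add: inner_diff_left a[OF x] a[OF y] linear_diff[OF P(1)] inner_diff_right)
        then have "\<bar>(a j x - a j y) \<bullet> v\<bar> \<le> norm (\<beta> j) * norm (P (B x (P v) - B y (P v)))"
          using Cauchy_Schwarz_ineq2 by simp
        also have "\<dots> \<le> (\<Sum>j<q. norm (\<beta> j)) * (4 * KA * norm (x - y) * norm v)"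
        proof (rule mult_mono[OF \<beta>le[OF j] _ \<beta>s])
          have "norm (P (B x (P v) - B y (P v))) \<le> 4 * KA * norm (x - y) * norm (P v)"
            using P(4) B_lip[OF x y, of "P v"] order_trans by blast
          also have "\<dots> \<le> 4 * KA * norm (x - y) * norm v" using KA P(4) by (intro mult_left_mono) auto
          finally show "norm (P (B x (P v) - B y (P v))) \<le> 4 * KA * norm (x - y) * norm v" .
        qed auto
        finally show "\<bar>(a j x - a j y) \<bullet> v\<bar> \<le> LA * norm (x - y) * norm v" by (simp add: LA_def mult_ac)
      qed (use KA \<beta>s in \<open>simp add: LA_def\<close>)
      then show "dist (a j x) (a j y) \<le> LA * dist x y" by (simp add: dist_norm)
    qed (use KA \<beta>s in \<open>simp add: LA_def\<close>)
    show "norm (a j x) \<le> Ab" if j: "j < q" and x: "x \<in> cball x0 R" for j x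
    proof (rule norm_le_if_inner_le)
      fix v
      have "\<bar>a j x \<bullet> v\<bar> \<le> norm (\<beta> j) * norm (P (B x (P v)))" using Cauchy_Schwarz_ineq2 a[OF x] by simp
      also have "\<dots> \<le> (\<Sum>j<q. norm (\<beta> j)) * (2 * norm v)"
      proof (rule mult_mono[OF \<beta>le[OF j] _ \<beta>s])
        have "norm (P (B x (P v))) \<le> 2 * norm (P v)" using P(4) normB[OF x, of "P v"] order_trans by blast
        then show "norm (P (B x (P v))) \<le> 2 * norm v" using P(4)[of v] by linarith
      qed auto
      finally show "\<bar>a j x \<bullet> v\<bar> \<le> Ab * norm v" by (simp add: Ab_def mult_ac)
    qed (use \<beta>s in \<open>simp add: Ab_def\<close>)
    show "a j x \<bullet> P v = a j x \<bullet> v" if "x \<in> cball x0 R" for j x v by (simp add: a[OF that] PP)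
    show "P (\<Sum>j<q. (a j x \<bullet> v) *\<^sub>R g j x) = P v" if x: "x \<in> cball x0 R" for x v
    proof -
      define u where "u = B x (P v)"
      have Au: "P (G x (P u)) + (u - P u) = P v" using AB[OF x, of "P v"] by (simp add: u_def A_def)
      then have "P (P (G x (P u)) + (u - P u)) = P (P v)" by simp
      then have "P (G x (P u)) = P v" using P(1) by (simp add: linear_add linear_diff PP)
      then show ?thesis by (simp add: a[OF x] G_def u_def)
    qed
    have x0: "x0 \<in> cball x0 R" using R by simp
    have B0: "B x0 w = w" for w using BA[OF x0, of w] by (simp add: A0)
    show "(\<Sum>j<q. (a j x0 \<bullet> v) *\<^sub>R g j x0) = P v" for v
      by (simp add: a[OF x0] B0 PP \<beta>)
  qed
qed

text \<open>The retraction to the ball is nonexpansive, so local data extend to the whole space with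
  the same constant.\<close>

lemma lipschitz_on_comp_closest_point:
  fixes f :: "'a::euclidean_space \<Rightarrow> 'b::metric_space"
  assumes "R > 0" "L-lipschitz_on (cball x0 R) f"
  shows "L-lipschitz_on UNIV (\<lambda>x. f (closest_point (cball x0 R) x))"
proof (rule lipschitz_onI)
  fix x y :: 'a
  have mem: "closest_point (cball x0 R) z \<in> cball x0 R" for z using assms(1) by (intro closest_point_in_set) auto
  have "dist (f (closest_point (cball x0 R) x)) (f (closest_point (cball x0 R) y))
      \<le> L * dist (closest_point (cball x0 R) x) (closest_point (cball x0 R) y)"
    by (rule lipschitz_onD[OF assms(2) mem mem])
  also have "\<dots> \<le> L * dist x y"
    using assms lipschitz_on_nonneg[OF assms(2)] by (intro mult_left_mono closest_point_lipschitz) auto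
  finally show "dist (f (closest_point (cball x0 R) x)) (f (closest_point (cball x0 R) y)) \<le> L * dist x y" .
qed (rule lipschitz_on_nonneg[OF assms(2)])

lemma lipschitz_on_sum_inner_scaleR:
  fixes a g :: "nat \<Rightarrow> 'a::euclidean_space \<Rightarrow> 'a"
  assumes a: "\<And>j. j < q \<Longrightarrow> La-lipschitz_on UNIV (a j)" "\<And>j x. j < q \<Longrightarrow> norm (a j x) \<le> A"
    and g: "\<And>j. j < q \<Longrightarrow> Lg-lipschitz_on UNIV (g j)" "\<And>j x. j < q \<Longrightarrow> norm (g j x) \<le> B"
    and nn: "La \<ge> 0" "A \<ge> 0" "Lg \<ge> 0" "B \<ge> 0"
  shows "norm ((\<Sum>j<q. (a j x \<bullet> v) *\<^sub>R g j x) - (\<Sum>j<q. (a j y \<bullet> v) *\<^sub>R g j y))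
     \<le> real q * (La * B + A * Lg) * norm (x - y) * norm v"
    and "norm (\<Sum>j<q. (a j x \<bullet> v) *\<^sub>R g j x) \<le> real q * (A * B) * norm v"
proof -
  have "norm ((\<Sum>j<q. (a j x \<bullet> v) *\<^sub>R g j x) - (\<Sum>j<q. (a j y \<bullet> v) *\<^sub>R g j y))
      = norm (\<Sum>j<q. ((a j x - a j y) \<bullet> v) *\<^sub>R g j x + (a j y \<bullet> v) *\<^sub>R (g j x - g j y))"
    by (simp add: sum_subtractf[symmetric] inner_diff_left algebra_simps)
  also have "\<dots> \<le> (\<Sum>j<q. (La * B + A * Lg) * norm (x - y) * norm v)"
  proof (rule sum_norm_le)
    fix j assume "j \<in> {..<q}"
    then have j: "j < q" by simp
    have "norm (((a j x - a j y) \<bullet> v) *\<^sub>R g j x) \<le> (La * norm (x - y) * norm v) * B"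
    proof -
      have "\<bar>(a j x - a j y) \<bullet> v\<bar> \<le> norm (a j x - a j y) * norm v" by (rule Cauchy_Schwarz_ineq2)
      also have "\<dots> \<le> La * norm (x - y) * norm v"
        using lipschitz_onD[OF a(1)[OF j], of x y] by (intro mult_right_mono) (auto simp: dist_norm)
      finally show ?thesis using g(2)[OF j, of x] nn by (simp add: mult_mono)
    qed
    moreover have "norm ((a j y \<bullet> v) *\<^sub>R (g j x - g j y)) \<le> (A * norm v) * (Lg * norm (x - y))"
    proof -
      have "\<bar>a j y \<bullet> v\<bar> \<le> norm (a j y) * norm v" by (rule Cauchy_Schwarz_ineq2)
      also have "\<dots> \<le> A * norm v" using a(2)[OF j] by (intro mult_right_mono) auto
      finally show ?thesis using lipschitz_onD[OF g(1)[OF j], of x y] nn by (simp add: mult_mono dist_norm)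
    qed
    ultimately show "norm (((a j x - a j y) \<bullet> v) *\<^sub>R g j x + (a j y \<bullet> v) *\<^sub>R (g j x - g j y)) \<le> (La * B + A * Lg) * norm (x - y) * norm v"
      using norm_triangle_ineq[of "((a j x - a j y) \<bullet> v) *\<^sub>R g j x" "(a j y \<bullet> v) *\<^sub>R (g j x - g j y)"]
      by (simp add: algebra_simps)
  qed
  finally show "norm ((\<Sum>j<q. (a j x \<bullet> v) *\<^sub>R g j x) - (\<Sum>j<q. (a j y \<bullet> v) *\<^sub>R g j y))
     \<le> real q * (La * B + A * Lg) * norm (x - y) * norm v" by (simp add: mult_ac)
  have "norm (\<Sum>j<q. (a j x \<bullet> v) *\<^sub>R g j x) \<le> (\<Sum>j<q. A * B * norm v)"
  proof (rule sum_norm_le)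
    fix j assume "j \<in> {..<q}"
    then have j: "j < q" by simp
    have "\<bar>a j x \<bullet> v\<bar> \<le> norm (a j x) * norm v" by (rule Cauchy_Schwarz_ineq2)
    also have "\<dots> \<le> A * norm v" using a(2)[OF j] by (intro mult_right_mono) auto
    finally have "norm ((a j x \<bullet> v) *\<^sub>R g j x) \<le> (A * norm v) * B"
      using g(2)[OF j, of x] nn by (simp add: mult_mono)
    then show "norm ((a j x \<bullet> v) *\<^sub>R g j x) \<le> A * B * norm v" by (simp add: mult_ac)
  qed
  then show "norm (\<Sum>j<q. (a j x \<bullet> v) *\<^sub>R g j x) \<le> real q * (A * B) * norm v" by (simp add: mult_ac)
qed

text \<open>Fields and coefficients are extended by retraction, so that Rademacher's theorem and the
  flows apply. At a good point the Leibniz rule and (H) write \<open>[Z v, Z w]\<close> and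
  \<open>[Z v, W l]\<close> as combinations of the fields with bounded coefficients; both have zero
  horizontal part, hence are bounded by the remainders.\<close>

lemma involutive_frame_exists:
  fixes g :: "nat \<Rightarrow> 'a::euclidean_space \<Rightarrow> 'a" and x0 :: 'a
  assumes lip: "\<forall>j<q. locally_lipschitz (g j)"
    and H: "\<forall>\<Omega>::'a set. bounded \<Omega> \<and> open \<Omega> \<longrightarrow>
              (\<exists>C>0. AE x in lebesgue. x \<in> \<Omega> \<longrightarrow>
                 (\<forall>j<q. \<forall>k<q. lie_bracket g j k x \<in> Pball g q C x))"
  obtains P Z K M W C L R N a A Lg where
    "involutive_frame Z P K M W q C L R x0 N"
    "\<And>v. P v \<in> Pspace g q x0" "\<And>v. v \<in> Pspace g q x0 \<Longrightarrow> P v = v"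
    "\<And>x v. x \<in> ball x0 R \<Longrightarrow> Z x v = (\<Sum>j<q. (a j x \<bullet> v) *\<^sub>R g j x)"
    "\<And>x l. x \<in> ball x0 R \<Longrightarrow> l < q \<Longrightarrow> W l x = g l x - Z x (g l x)"
    "\<And>x v. Z x (P v) = Z x v"
    "\<And>j. j < q \<Longrightarrow> continuous_on (ball x0 R) (a j)"
    "\<And>j x. j < q \<Longrightarrow> x \<in> ball x0 R \<Longrightarrow> norm (a j x) \<le> A" "A \<ge> 0"
    "\<And>j. j < q \<Longrightarrow> Lg-lipschitz_on (ball x0 R) (g j)"
proof -
  obtain r1 Lg where r1: "r1 > 0" and lipg: "\<And>j. j < q \<Longrightarrow> Lg-lipschitz_on (cball x0 r1) (g j)" and Lg: "Lg \<ge> 0"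
    using locally_lipschitz_family[OF lip] by metis
  have "subspace (Pspace g q x0)" by (simp add: Pspace_def)
  then obtain P where P: "linear P" "\<And>x. P x \<in> Pspace g q x0" "\<And>x. x \<in> Pspace g q x0 \<Longrightarrow> P x = x"
      "\<And>x. norm (P x) \<le> norm x" "\<And>x. norm (x - P x) \<le> norm x"
    using orthogonal_projection_exists by blast
  obtain R a A LA where R: "0 < R" "R \<le> r1" and A: "A \<ge> 0"
    and lipa: "\<And>j. j < q \<Longrightarrow> LA-lipschitz_on (cball x0 R) (a j)"
    and norma: "\<And>j x. j < q \<Longrightarrow> x \<in> cball x0 R \<Longrightarrow> norm (a j x :: 'a) \<le> A"
    and Pa: "\<And>x v. x \<in> cball x0 R \<Longrightarrow> P (\<Sum>j<q. (a j x \<bullet> v) *\<^sub>R g j x) = P v"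
    and aP: "\<And>j x v. x \<in> cball x0 R \<Longrightarrow> a j x \<bullet> P v = a j x \<bullet> v"
    and a0: "\<And>v. (\<Sum>j<q. (a j x0 \<bullet> v) *\<^sub>R g j x0) = P v"
    by (rule local_coefficients[OF r1 lipg Lg P(1-4)]; (assumption | (rule that; assumption)))
  \<comment> \<open>For \<open>q = 0\<close> no Lipschitz hypothesis fixes the sign of
    \<open>LA\<close>.\<close>
  define LA' where "LA' = max LA 0"
  have LA: "LA' \<ge> 0" by (simp add: LA'_def)
  have lipa': "LA'-lipschitz_on (cball x0 R) (a j)" if "j < q" for j
    by (rule lipschitz_on_le[OF lipa[OF that]]) (simp add: LA'_def)
  have lipgR: "Lg-lipschitz_on (cball x0 R) (g j)" if "j < q" for j
    by (rule lipschitz_on_subset[OF lipg[OF that]]) (use R in auto)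
  define B where "B = Lg * R + (\<Sum>j<q. norm (g j x0))"
  have B: "B \<ge> 0" unfolding B_def using Lg R by (intro add_nonneg_nonneg sum_nonneg) auto
  have normg: "norm (g j x) \<le> B" if j: "j < q" and x: "x \<in> cball x0 R" for j x
  proof -
    have "norm (g j x - g j x0) \<le> Lg * norm (x - x0)"
      using lipschitz_onD[OF lipgR[OF j] x, of x0] R by (simp add: dist_norm)
    also have "\<dots> \<le> Lg * R" using x Lg by (intro mult_left_mono) (auto simp: dist_norm norm_minus_commute)
    finally have "norm (g j x) \<le> Lg * R + norm (g j x0)" using norm_triangle_ineq2[of "g j x" "g j x0"] by simp
    also have "norm (g j x0) \<le> (\<Sum>j<q. norm (g j x0))" using j by (intro member_le_sum) auto
    finally show ?thesis by (simp add: B_def)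
  qed
  define \<rho> where "\<rho> = closest_point (cball x0 R)"
  have \<rho>in: "\<rho> x \<in> cball x0 R" for x unfolding \<rho>_def using R by (intro closest_point_in_set) auto
  have \<rho>id: "\<rho> x = x" if "x \<in> cball x0 R" for x unfolding \<rho>_def using that by (rule closest_point_self)
  define gt where "gt j x = g j (\<rho> x)" for j x
  define ah where "ah j x = a j (\<rho> x)" for j x
  have lipgt: "Lg-lipschitz_on UNIV (gt j)" if "j < q" for j
    unfolding gt_def \<rho>_def by (rule lipschitz_on_comp_closest_point[OF R(1) lipgR[OF that]])
  have lipah: "LA'-lipschitz_on UNIV (ah j)" if "j < q" for j
    unfolding ah_def \<rho>_def by (rule lipschitz_on_comp_closest_point[OF R(1) lipa'[OF that]])
  have normgt: "norm (gt j x) \<le> B" if "j < q" for j x unfolding gt_def by (rule normg[OF that \<rho>in])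
  have normah: "norm (ah j x) \<le> A" if "j < q" for j x unfolding ah_def by (rule norma[OF that \<rho>in])
  define Z where "Z x v = (\<Sum>j<q. (ah j x \<bullet> v) *\<^sub>R gt j x)" for x v
  define K where "K = real q * (LA' * B + A * Lg)"
  define M where "M = real q * (A * B)"
  have K: "K \<ge> 0" and M: "M \<ge> 0" using LA B A Lg by (auto simp: K_def M_def)
  have lipZ: "norm (Z x v - Z y v) \<le> K * norm (x - y) * norm v" for x y v
    unfolding Z_def K_def by (rule lipschitz_on_sum_inner_scaleR(1)[OF lipah normah lipgt normgt LA A Lg B])
  have normZ: "norm (Z x v) \<le> M * norm v" for x v
    unfolding Z_def M_def by (rule lipschitz_on_sum_inner_scaleR(2)[OF lipah normah lipgt normgt LA A Lg B])
  have linZ: "linear (Z x)" for x unfolding Z_def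
    by (rule linearI) (simp_all add: inner_add_right scaleR_add_left sum.distrib scaleR_sum_right)
  have PZ: "P (Z x v) = P v" for x v unfolding Z_def ah_def gt_def by (rule Pa[OF \<rho>in])
  have ZP: "Z x (P v) = Z x v" for x v unfolding Z_def ah_def by (simp add: aP[OF \<rho>in])
  define W where "W l x = gt l x - Z x (gt l x)" for l x
  define L where "L = Lg + K * B + M * Lg"
  have normW: "norm (W l x) \<le> B + M * B" if l: "l < q" for l x
  proof -
    have "norm (Z x (gt l x)) \<le> M * B"
      using normZ[of x "gt l x"] mult_left_mono[OF normgt[OF l, of x] M] by linarith
    then show ?thesis using norm_triangle_ineq4[of "gt l x" "Z x (gt l x)"] normgt[OF l, of x] by (simp add: W_def)
  qed
  have lipW: "L-lipschitz_on UNIV (W l)" if l: "l < q" for l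
  proof (rule lipschitz_onI)
    fix x y :: 'a
    have lg: "norm (gt l x - gt l y) \<le> Lg * norm (x - y)"
      using lipschitz_onD[OF lipgt[OF l], of x y] by (simp add: dist_norm)
    define T1 where "T1 = gt l x - gt l y"
    define T2 where "T2 = Z x (gt l x) - Z y (gt l x)"
    have "W l x - W l y = T1 - (T2 + Z y T1)"
      by (simp add: W_def T1_def T2_def linear_diff[OF linZ])
    then have "norm (W l x - W l y) \<le> norm T1 + (norm T2 + norm (Z y T1))"
      using norm_triangle_ineq4[of T1 "T2 + Z y T1"] norm_triangle_ineq[of T2 "Z y T1"] by simp
    moreover have "norm T2 \<le> K * norm (x - y) * B"
      using lipZ[of x "gt l x" y] mult_left_mono[OF normgt[OF l, of x], of "K * norm (x - y)"] K by (simp add: T2_def)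
    moreover have "norm (Z y T1) \<le> M * (Lg * norm (x - y))"
      using normZ[of y T1] mult_left_mono[OF lg M] by (simp add: T1_def)
    ultimately show "dist (W l x) (W l y) \<le> L * dist x y"
      using lg by (simp add: T1_def L_def dist_norm algebra_simps)
  qed (use Lg K B M in \<open>simp add: L_def\<close>)
  have W0: "W l x0 = 0" if l: "l < q" for l
  proof -
    have "\<rho> x0 = x0" using R by (intro \<rho>id) auto
    moreover have "g l x0 \<in> Pspace g q x0" unfolding Pspace_def using l by (intro span_base) auto
    ultimately show ?thesis using P(3) a0 by (simp add: W_def Z_def gt_def ah_def)
  qed
  obtain C0 where C0: "C0 > 0" and HC: "AE x in lebesgue. x \<in> ball x0 R \<longrightarrow>
      (\<forall>j<q. \<forall>k<q. lie_bracket g j k x \<in> Pball g q C0 x)"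
    using H[rule_format, of "ball x0 R"] by auto
  define N3 where "N3 = {x \<in> ball x0 R. \<not> (\<forall>j<q. \<forall>k<q. lie_bracket g j k x \<in> Pball g q C0 x)}"
  define N1 where "N1 = (\<Union>j<q. {x. \<not> gt j differentiable (at x)})"
  define N2 where "N2 = (\<Union>j<q. {x. \<not> ah j differentiable (at x)})"
  define N where "N = N1 \<union> N2 \<union> N3"
  have "negligible N3" using HC unfolding N3_def
    by (auto simp: negligible_iff_null_sets eventually_ae_filter intro: null_sets_completion_subset)
  moreover have "negligible N1" unfolding N1_def
    by (intro negligible_Union) (auto intro: Rademacher[OF lipgt])
  moreover have "negligible N2" unfolding N2_def
    by (intro negligible_Union) (auto intro: Rademacher[OF lipah])
  ultimately have negN: "negligible N" by (simp add: N_def)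
  \<comment> \<open>\<open>C1\<close> collects the derivatives of the coefficients of
    \<open>Z v\<close> and \<open>Z w\<close> and the \<open>q\<close> times \<open>q\<close>
    bracket coefficients, each at most \<open>C0\<close>. \<open>C2\<close> is the analogue for
    \<open>Z v\<close> and \<open>W l\<close>, where the coefficients of \<open>W l\<close> are at
    most \<open>1 + A * B\<close>. The summand \<open>K\<close> in \<open>C\<close> pays for
    \<open>DZ v (W l x)\<close>.\<close>
  define C1 where "C1 = 2 * (LA' * M) + real q * (real q * (A * A * C0))"
  define C2 where "C2 = (LA' * B + A * Lg) * M + LA' * (B + M * B) + real q * (real q * (A * (1 + A * B) * C0))"
  define C where "C = C1 + C2 + K"
  have C1: "C1 \<ge> 0" unfolding C1_def using LA M A C0 by auto
  have C2: "C2 \<ge> 0" unfolding C2_def using LA M A C0 B Lg by (intro add_nonneg_nonneg mult_nonneg_nonneg) auto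
  have main: "(\<exists>DZ. (\<forall>v. ((\<lambda>y. Z y v) has_derivative DZ v) (at x)) \<and>
        (\<forall>v w. norm (DZ w (Z x v) - DZ v (Z x w)) \<le> C * (\<Sum>l<q. norm (W l x)) * norm v * norm w)) \<and>
      (\<forall>l<q. \<exists>DW. (W l has_derivative DW) (at x) \<and>
        (\<forall>v. norm (DW (Z x v)) \<le> C * (\<Sum>l<q. norm (W l x)) * norm v))"
    if x: "x \<in> ball x0 R" "x \<notin> N" for x
  proof -
    have xc: "x \<in> cball x0 R" using x by auto
    have gtx: "gt j x = g j x" for j using \<rho>id[OF xc] by (simp add: gt_def)
    define Dg where "Dg j = frechet_derivative (gt j) (at x)" for j
    define Da where "Da j = frechet_derivative (ah j) (at x)" for j
    have Dg: "(gt j has_derivative Dg j) (at x)" if "j < q" for j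
      using x(2) that unfolding N_def N1_def Dg_def by (auto simp: frechet_derivative_works[symmetric])
    have Da: "(ah j has_derivative Da j) (at x)" if "j < q" for j
      using x(2) that unfolding N_def N2_def Da_def by (auto simp: frechet_derivative_works[symmetric])
    have linDg: "linear (Dg j)" if "j < q" for j using has_derivative_linear[OF Dg[OF that]] .
    have normDg: "norm (Dg j h) \<le> Lg * norm h" if "j < q" for j h
      by (rule lipschitz_has_derivative_bound[OF lipgt[OF that] Dg[OF that]])
    have normDa: "norm (Da j h) \<le> LA' * norm h" if "j < q" for j h
      by (rule lipschitz_has_derivative_bound[OF lipah[OF that] Da[OF that]])
    \<comment> \<open>Condition (H) speaks of the original fields; these agree with the extended
      ones near \<open>x\<close>, so the derivatives coincide.\<close>
    have fre: "frechet_derivative (g j) (at x) = Dg j" if "j < q" for j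
    proof -
      have "(g j has_derivative Dg j) (at x)"
        by (rule has_derivative_transform_within_open[OF Dg[OF that] open_ball x(1)]) (use \<rho>id in \<open>auto simp: gt_def\<close>)
      then show ?thesis by (rule frechet_derivative_at[symmetric])
    qed
    have "\<exists>c. Dg k (gt j x) - Dg j (gt k x) = (\<Sum>l<q. c l *\<^sub>R gt l x) \<and> (\<forall>l<q. \<bar>c l\<bar> \<le> C0)" if jk: "j < q" "k < q" for j k
    proof -
      have "lie_bracket g j k x \<in> Pball g q C0 x" using x jk by (auto simp: N_def N3_def)
      then obtain c where c: "lie_bracket g j k x = (\<Sum>l<q. c l *\<^sub>R g l x)" "sqrt (\<Sum>l<q. (c l)\<^sup>2) \<le> C0"
        unfolding Pball_def by blast
      have "\<bar>c l\<bar> \<le> C0" if "l < q" for l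
      proof -
        have "(c l)\<^sup>2 \<le> (\<Sum>l<q. (c l)\<^sup>2)" using that by (intro member_le_sum) auto
        then have "sqrt ((c l)\<^sup>2) \<le> sqrt (\<Sum>l<q. (c l)\<^sup>2)" by (rule real_sqrt_le_mono)
        then show ?thesis using c(2) by simp
      qed
      then show ?thesis using c(1) jk by (intro exI[of _ c]) (simp add: lie_bracket_def fre gtx)
    qed
    then obtain c where c: "\<And>j k. j < q \<Longrightarrow> k < q \<Longrightarrow> Dg k (gt j x) - Dg j (gt k x) = (\<Sum>l<q. c j k l *\<^sub>R gt l x)"
      and cC: "\<And>j k l. j < q \<Longrightarrow> k < q \<Longrightarrow> l < q \<Longrightarrow> \<bar>c j k l\<bar> \<le> C0"
      by metis
    define \<omega> where "\<omega> = (\<Sum>l<q. norm (W l x))"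
    have \<omega>0: "\<omega> \<ge> 0" unfolding \<omega>_def by (intro sum_nonneg) auto
    \<comment> \<open>\<open>Z x u\<close> depends only on \<open>P u\<close>, so it vanishes.
      Subtracting it from \<open>u\<close> replaces every field by its remainder \<open>W l\<close>
      with the same coefficient.\<close>
    have vertical: "norm u \<le> b * \<omega>" if u: "u = (\<Sum>l<q. e l *\<^sub>R gt l x)" and Pu: "P u = 0" and e: "\<And>l. l < q \<Longrightarrow> \<bar>e l\<bar> \<le> b" for u e b
    proof -
      have "Z x u = 0" using ZP[of x u] Pu linear_0[OF linZ] by simp
      then have "u = (\<Sum>l<q. e l *\<^sub>R gt l x) - Z x (\<Sum>l<q. e l *\<^sub>R gt l x)" using u by simp
      also have "\<dots> = (\<Sum>l<q. e l *\<^sub>R W l x)"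
        by (simp add: W_def linear_sum[OF linZ] linear_cmul[OF linZ] sum_subtractf scaleR_diff_right)
      also have "norm \<dots> \<le> (\<Sum>l<q. b * norm (W l x))"
        by (rule sum_norm_le) (use e in \<open>auto intro!: mult_right_mono\<close>)
      finally show ?thesis by (simp add: \<omega>_def sum_distrib_left)
    qed
    have csum: "\<bar>\<Sum>j<q. \<Sum>k<q. \<alpha> j * \<beta> k * c j k l\<bar> \<le> real q * (real q * (a1 * b1 * C0))"
      if l: "l < q" and \<alpha>: "\<And>j. j < q \<Longrightarrow> \<bar>\<alpha> j\<bar> \<le> a1" and \<beta>: "\<And>j. j < q \<Longrightarrow> \<bar>\<beta> j\<bar> \<le> b1" for l \<alpha> \<beta> a1 b1
    proof -
      have "norm (\<Sum>j<q. \<Sum>k<q. \<alpha> j * \<beta> k * c j k l) \<le> (\<Sum>j<q. \<Sum>k<q. a1 * b1 * C0)"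
      proof (intro sum_norm_le)
        fix j k assume "j \<in> {..<q}" "k \<in> {..<q}"
        then have jk: "j < q" "k < q" by auto
        have "a1 \<ge> 0" "b1 \<ge> 0" using \<alpha>[OF jk(1)] \<beta>[OF jk(1)] by linarith+
        then show "norm (\<alpha> j * \<beta> k * c j k l) \<le> a1 * b1 * C0"
          unfolding real_norm_def abs_mult using \<alpha>[OF jk(1)] \<beta>[OF jk(2)] cC[OF jk l] C0
          by (intro mult_mono) auto
      qed
      then show ?thesis by simp
    qed
    have inner_le: "\<bar>u \<bullet> v\<bar> \<le> b * norm v" if "norm u \<le> b" for u v :: 'a and b
      using Cauchy_Schwarz_ineq2[of u v] mult_right_mono[OF that norm_ge_zero[of v]] by linarith
    define DZ where "DZ v h = (\<Sum>j<q. (Da j h \<bullet> v) *\<^sub>R gt j x + (ah j x \<bullet> v) *\<^sub>R Dg j h)" for v h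
    have DZ: "((\<lambda>y. Z y v) has_derivative DZ v) (at x)" for v
    proof -
      have "((\<lambda>y. \<Sum>j<q. (ah j y \<bullet> v) *\<^sub>R gt j y) has_derivative
          (\<lambda>h. \<Sum>j<q. (ah j x \<bullet> v) *\<^sub>R Dg j h + (Da j h \<bullet> v) *\<^sub>R gt j x)) (at x)"
        by (intro has_derivative_sum has_derivative_scaleR has_derivative_inner_left Da Dg) auto
      then show ?thesis unfolding Z_def DZ_def[abs_def] by (simp add: add.commute)
    qed
    \<comment> \<open>A map with constant horizontal part has vertical derivatives; this is applied
      to \<open>Z _ v\<close> and to \<open>W l\<close>.\<close>
    have PD: "P (D h) = 0" if f: "(f has_derivative D) (at x)" and cst: "\<And>y. P (f y) = p" for f D p h
    proof -
      have "((\<lambda>y. P (f y)) has_derivative (\<lambda>h. P (D h))) (at x)"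
        by (rule bounded_linear.has_derivative[OF linear_conv_bounded_linear[THEN iffD1, OF P(1)] f])
      moreover have "((\<lambda>y. P (f y)) has_derivative (\<lambda>h. 0)) (at x)" unfolding cst by simp
      ultimately have "(\<lambda>h. P (D h)) = (\<lambda>h. 0)" by (rule has_derivative_unique)
      then show ?thesis by metis
    qed
    have PDZ: "P (DZ v h) = 0" for v h by (rule PD[OF DZ PZ])
    have normDZ: "norm (DZ v h) \<le> K * norm v * norm h" for v h
    proof (rule lipschitz_has_derivative_bound[OF _ DZ])
      show "(K * norm v)-lipschitz_on UNIV (\<lambda>y. Z y v)"
        using lipZ K by (intro lipschitz_onI) (auto simp: dist_norm mult_ac)
    qed
    have bracketZ: "norm (DZ w (Z x v) - DZ v (Z x w)) \<le> C * \<omega> * norm v * norm w" for v w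
    proof -
      have "DZ w (Z x v) - DZ v (Z x w) = (\<Sum>l<q. (Da l (Z x v) \<bullet> w - Da l (Z x w) \<bullet> v
          + (\<Sum>j<q. \<Sum>k<q. (ah j x \<bullet> v) * (ah k x \<bullet> w) * c j k l)) *\<^sub>R gt l x)"
        unfolding DZ_def by (rule lie_bracket_combination[OF linDg c]) (auto simp: Z_def)
      moreover have "P (DZ w (Z x v) - DZ v (Z x w)) = 0" by (simp add: linear_diff[OF P(1)] PDZ)
      moreover have "\<bar>Da l (Z x v) \<bullet> w - Da l (Z x w) \<bullet> v
          + (\<Sum>j<q. \<Sum>k<q. (ah j x \<bullet> v) * (ah k x \<bullet> w) * c j k l)\<bar> \<le> C1 * norm v * norm w" if l: "l < q" for l
      proof -
        have D: "\<bar>Da l (Z x v) \<bullet> w\<bar> \<le> LA' * M * norm v * norm w" for v w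
        proof (rule inner_le)
          have "norm (Da l (Z x v)) \<le> LA' * (M * norm v)"
            using normDa[OF l, of "Z x v"] mult_left_mono[OF normZ[of x v] LA] by linarith
          then show "norm (Da l (Z x v)) \<le> LA' * M * norm v" by (simp add: mult_ac)
        qed
        have "\<bar>\<Sum>j<q. \<Sum>k<q. (ah j x \<bullet> v) * (ah k x \<bullet> w) * c j k l\<bar> \<le> real q * (real q * ((A * norm v) * (A * norm w) * C0))"
          by (rule csum[OF l]) (auto intro!: inner_le normah)
        also have "\<dots> = real q * (real q * (A * A * C0)) * norm v * norm w" by (simp add: mult_ac)
        finally have S: "\<bar>\<Sum>j<q. \<Sum>k<q. (ah j x \<bullet> v) * (ah k x \<bullet> w) * c j k l\<bar> \<le> real q * (real q * (A * A * C0)) * norm v * norm w" .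
        have "C1 * norm v * norm w = LA' * M * norm v * norm w + LA' * M * norm w * norm v + real q * (real q * (A * A * C0)) * norm v * norm w"
          unfolding C1_def by (simp add: algebra_simps)
        then show ?thesis using D[of v w] D[of w v] S by linarith
      qed
      ultimately have "norm (DZ w (Z x v) - DZ v (Z x w)) \<le> C1 * norm v * norm w * \<omega>" by (rule vertical)
      also have "\<dots> \<le> C * norm v * norm w * \<omega>"
        using C2 K \<omega>0 by (intro mult_right_mono) (auto simp: C_def)
      finally show ?thesis by (simp add: mult_ac)
    qed
    have "\<exists>DW. (W l has_derivative DW) (at x) \<and> (\<forall>v. norm (DW (Z x v)) \<le> C * \<omega> * norm v)" if l: "l < q" for l
    proof -
      \<comment> \<open>Coefficients of \<open>W l\<close> as a combination of the fields;
        \<open>db\<close> are their derivatives, so that \<open>DW\<close> fits the Leibniz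
        rule.\<close>
      define \<beta> where "\<beta> k = (if k = l then 1 else 0) - ah k x \<bullet> gt l x" for k
      define db where "db k h = - (Da k h \<bullet> gt l x + ah k x \<bullet> Dg l h)" for k h
      define DW where "DW h = (\<Sum>k<q. db k h *\<^sub>R gt k x + \<beta> k *\<^sub>R Dg k h)" for h
      have delta: "(\<Sum>k<q. (if k = l then 1 else 0) *\<^sub>R f k) = f l" for f :: "nat \<Rightarrow> 'a"
        using l by (simp add: if_distrib[of "\<lambda>t. t *\<^sub>R _"] cong: if_cong)
      have DWeq: "DW h = Dg l h - (\<Sum>j<q. (Da j h \<bullet> gt l x + ah j x \<bullet> Dg l h) *\<^sub>R gt j x + (ah j x \<bullet> gt l x) *\<^sub>R Dg j h)" for h
      proof -
        have "DW h = (\<Sum>k<q. (if k = l then 1 else 0) *\<^sub>R Dg k h - ((Da k h \<bullet> gt l x + ah k x \<bullet> Dg l h) *\<^sub>R gt k x + (ah k x \<bullet> gt l x) *\<^sub>R Dg k h))"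
          unfolding DW_def db_def \<beta>_def by (intro sum.cong) (auto simp: algebra_simps)
        then show ?thesis by (simp only: sum_subtractf delta)
      qed
      have dW: "(W l has_derivative DW) (at x)"
      proof -
        have "((\<lambda>y. gt l y - (\<Sum>j<q. (ah j y \<bullet> gt l y) *\<^sub>R gt j y)) has_derivative
            (\<lambda>h. Dg l h - (\<Sum>j<q. (ah j x \<bullet> gt l x) *\<^sub>R Dg j h + (ah j x \<bullet> Dg l h + Da j h \<bullet> gt l x) *\<^sub>R gt j x))) (at x)"
          by (intro has_derivative_diff has_derivative_sum has_derivative_scaleR has_derivative_inner Da Dg l) auto
        moreover have "DW = (\<lambda>h. Dg l h - (\<Sum>j<q. (ah j x \<bullet> gt l x) *\<^sub>R Dg j h + (ah j x \<bullet> Dg l h + Da j h \<bullet> gt l x) *\<^sub>R gt j x))"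
          unfolding DWeq[abs_def] by (simp add: add.commute)
        moreover have "W l = (\<lambda>y. gt l y - (\<Sum>j<q. (ah j y \<bullet> gt l y) *\<^sub>R gt j y))"
          by (simp add: W_def[abs_def] Z_def)
        ultimately show ?thesis by simp
      qed
      have Wx: "W l x = (\<Sum>k<q. \<beta> k *\<^sub>R gt k x)"
        unfolding W_def Z_def \<beta>_def by (simp only: scaleR_diff_left sum_subtractf delta)
      have PW: "P (DW h) = 0" for h
        by (rule PD[OF dW, of 0]) (simp add: W_def linear_diff[OF P(1)] PZ)
      have "norm (DW (Z x v)) \<le> C * \<omega> * norm v" for v
      proof -
        \<comment> \<open>The bracket of \<open>Z v\<close> and \<open>W l\<close>. Its second term
          is directly proportional to a remainder, with factor \<open>K * norm v\<close>, which
          isolates the derivative of \<open>W l\<close> along \<open>Z v\<close>.\<close>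
        have "DW (Z x v) - DZ v (W l x) = (\<Sum>i<q. (db i (Z x v) - Da i (W l x) \<bullet> v
          + (\<Sum>j<q. \<Sum>k<q. (ah j x \<bullet> v) * \<beta> k * c j k i)) *\<^sub>R gt i x)"
          unfolding DZ_def DW_def by (rule lie_bracket_combination[OF linDg c _ Wx]) (auto simp: Z_def)
        moreover have "P (DW (Z x v) - DZ v (W l x)) = 0" by (simp add: linear_diff[OF P(1)] PDZ PW)
        moreover have "\<bar>db i (Z x v) - Da i (W l x) \<bullet> v + (\<Sum>j<q. \<Sum>k<q. (ah j x \<bullet> v) * \<beta> k * c j k i)\<bar> \<le> C2 * norm v"
          if i: "i < q" for i
        proof -
          have 1: "\<bar>Da i (Z x v) \<bullet> gt l x\<bar> \<le> LA' * B * M * norm v"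
          proof -
            have "\<bar>Da i (Z x v) \<bullet> gt l x\<bar> \<le> (LA' * (M * norm v)) * norm (gt l x)"
              by (rule inner_le) (use normDa[OF i, of "Z x v"] mult_left_mono[OF normZ[of x v] LA] in linarith)
            also have "\<dots> \<le> (LA' * (M * norm v)) * B" using normgt[OF l] LA M by (intro mult_left_mono) auto
            finally show ?thesis by (simp add: mult_ac)
          qed
          have 2: "\<bar>ah i x \<bullet> Dg l (Z x v)\<bar> \<le> A * Lg * M * norm v"
          proof -
            have "\<bar>ah i x \<bullet> Dg l (Z x v)\<bar> \<le> A * norm (Dg l (Z x v))" by (rule inner_le[OF normah[OF i]])
            also have "\<dots> \<le> A * (Lg * (M * norm v))"
              using normDg[OF l, of "Z x v"] mult_left_mono[OF normZ[of x v] Lg] A by (intro mult_left_mono) linarith+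
            finally show ?thesis by (simp add: mult_ac)
          qed
          have 3: "\<bar>Da i (W l x) \<bullet> v\<bar> \<le> LA' * (B + M * B) * norm v"
            by (rule inner_le) (use normDa[OF i, of "W l x"] mult_left_mono[OF normW[OF l, of x] LA] in linarith)
          have "\<bar>\<Sum>j<q. \<Sum>k<q. (ah j x \<bullet> v) * \<beta> k * c j k i\<bar> \<le> real q * (real q * ((A * norm v) * (1 + A * B) * C0))"
          proof (rule csum[OF i])
            show "\<bar>ah j x \<bullet> v\<bar> \<le> A * norm v" if "j < q" for j by (rule inner_le[OF normah[OF that]])
            show "\<bar>\<beta> k\<bar> \<le> 1 + A * B" if "k < q" for k
            proof -
              have "\<bar>ah k x \<bullet> gt l x\<bar> \<le> A * B"
                using inner_le[OF normah[OF that], of x "gt l x"] mult_left_mono[OF normgt[OF l, of x] A] by linarith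
              then show ?thesis unfolding \<beta>_def by (auto split: if_splits)
            qed
          qed
          also have "\<dots> = real q * (real q * (A * (1 + A * B) * C0)) * norm v" by (simp add: mult_ac)
          finally have 4: "\<bar>\<Sum>j<q. \<Sum>k<q. (ah j x \<bullet> v) * \<beta> k * c j k i\<bar> \<le> real q * (real q * (A * (1 + A * B) * C0)) * norm v" .
          have "C2 * norm v = LA' * B * M * norm v + A * Lg * M * norm v + LA' * (B + M * B) * norm v + real q * (real q * (A * (1 + A * B) * C0)) * norm v"
            unfolding C2_def by (simp add: algebra_simps)
          then show ?thesis using 1 2 3 4 unfolding db_def by linarith
        qed
        ultimately have "norm (DW (Z x v) - DZ v (W l x)) \<le> C2 * norm v * \<omega>" by (rule vertical)
        moreover have "norm (DZ v (W l x)) \<le> K * norm v * \<omega>"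
        proof -
          have "norm (W l x) \<le> \<omega>" unfolding \<omega>_def using l by (intro member_le_sum) auto
          then have "K * norm v * norm (W l x) \<le> K * norm v * \<omega>" using K by (intro mult_left_mono) auto
          then show ?thesis using normDZ[of v "W l x"] by linarith
        qed
        moreover have "norm (DW (Z x v)) \<le> norm (DW (Z x v) - DZ v (W l x)) + norm (DZ v (W l x))"
          using norm_triangle_ineq[of "DW (Z x v) - DZ v (W l x)" "DZ v (W l x)"] by simp
        moreover have "C1 * norm v * \<omega> \<ge> 0" using C1 \<omega>0 by simp
        moreover have "C * \<omega> * norm v = C1 * norm v * \<omega> + C2 * norm v * \<omega> + K * norm v * \<omega>"
          unfolding C_def by (simp add: algebra_simps)
        ultimately show ?thesis by linarith
      qed
      then show ?thesis using dW by blast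
    qed
    then show ?thesis using DZ bracketZ unfolding \<omega>_def by blast
  qed
  have frame: "horizontal_frame Z P K M"
    by (rule horizontal_frame.intro) (rule linZ normZ lipZ K M P PZ P(3)[OF P(2)])+
  have C: "C \<ge> 0" using C1 C2 K by (simp add: C_def)
  have "involutive_frame_axioms Z W q C L R x0 N"
    by (rule involutive_frame_axioms.intro) (use negN R C lipW W0 main in blast)+
  with frame have f1: "involutive_frame Z P K M W q C L R x0 N" by (rule involutive_frame.intro)
  have f2: "Z x v = (\<Sum>j<q. (a j x \<bullet> v) *\<^sub>R g j x)" if "x \<in> ball x0 R" for x v
    using \<rho>id[of x] that by (simp add: Z_def ah_def gt_def)
  have f3: "W l x = g l x - Z x (g l x)" if "x \<in> ball x0 R" "l < q" for l x
    using \<rho>id[of x] that by (simp add: W_def gt_def)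
  have f4: "continuous_on (ball x0 R) (a j)" if "j < q" for j
    using lipschitz_on_continuous_on[OF lipa[OF that]] continuous_on_subset ball_subset_cball by blast
  have f5: "Lg-lipschitz_on (ball x0 R) (g j)" if "j < q" for j
    using lipschitz_on_subset[OF lipgR[OF that] ball_subset_cball] .
  have f6: "norm (a j x) \<le> A" if "j < q" "x \<in> ball x0 R" for j x using norma that by auto
  show ?thesis by (rule that[OF f1 P(2) P(3) f2 f3 ZP f4 f6 A f5])
qed

section \<open>Subunit paths and the orbit topology\<close>

lemma AE_lebesgue_iff_negligible: "(AE x in lebesgue. Q x) \<longleftrightarrow> negligible {x. \<not> Q x}"
  by (auto simp: negligible_iff_null_sets eventually_ae_filter intro: null_sets_completion_subset)

text \<open>Controls may be taken Borel measurable on the whole line, which makes them easy to translate and glue.\<close>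

definition control :: "(nat \<Rightarrow> 'a::euclidean_space \<Rightarrow> 'a) \<Rightarrow> nat \<Rightarrow> real \<Rightarrow> (real \<Rightarrow> 'a) \<Rightarrow>
    (real \<Rightarrow> nat \<Rightarrow> real) \<Rightarrow> real set \<Rightarrow> bool" where
  "control g q T \<gamma> u N \<longleftrightarrow> (\<forall>j<q. (\<lambda>t. u t j) \<in> borel_measurable borel) \<and> negligible N \<and>
     (\<forall>t\<in>{0<..<T} - N. (\<Sum>j<q. (u t j)\<^sup>2) \<le> 1 \<and>
        (\<gamma> has_vector_derivative (\<Sum>j<q. u t j *\<^sub>R g j (\<gamma> t))) (at t))"

text \<open>A Lebesgue measurable control agrees almost everywhere with a Borel one. The points of
  disagreement, like those where the equation fails, go into the null set \<open>N\<close>.\<close>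

lemma subunit_iff:
  "subunit g q T \<gamma> \<longleftrightarrow> T \<ge> 0 \<and> (\<exists>K. K-lipschitz_on {0..T} \<gamma>) \<and> (\<exists>u N. control g q T \<gamma> u N)"
proof -
  have "(\<exists>u :: real \<Rightarrow> nat \<Rightarrow> real.
        (\<forall>j<q. (\<lambda>t. u t j) \<in> borel_measurable (lebesgue_on {0..T})) \<and>
        (AE t in lebesgue_on {0..T}.
            sqrt (\<Sum>j<q. (u t j)\<^sup>2) \<le> 1 \<and>
            (\<gamma> has_vector_derivative (\<Sum>j<q. u t j *\<^sub>R g j (\<gamma> t))) (at t)))
     \<longleftrightarrow> (\<exists>u N. control g q T \<gamma> u N)" (is "?A \<longleftrightarrow> ?B")
  proof
    assume ?A
    then obtain u where u: "\<And>j. j < q \<Longrightarrow> (\<lambda>t. u t j) \<in> borel_measurable (lebesgue_on {0..T})"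
      and ae: "AE t in lebesgue_on {0..T}. sqrt (\<Sum>j<q. (u t j)\<^sup>2) \<le> 1 \<and>
            (\<gamma> has_vector_derivative (\<Sum>j<q. u t j *\<^sub>R g j (\<gamma> t))) (at t)" by blast
    define U where "U j t = (if t \<in> {0..T} then u t j else 0)" for j t
    have "\<exists>v. v \<in> borel_measurable lborel \<and> (AE t in lborel. U j t = v t)" if "j < q" for j
    proof -
      have "{0..T} \<in> sets lebesgue" by auto
      from completion_ex_borel_measurable_real[OF borel_measurable_if_I[OF u[OF that] this]] show ?thesis
        unfolding U_def by blast
    qed
    then obtain v where v: "\<And>j. j < q \<Longrightarrow> v j \<in> borel_measurable lborel"
      "\<And>j. j < q \<Longrightarrow> AE t in lborel. U j t = v j t" by metis
    define N1 where "N1 = {t. \<not> (t \<in> {0..T} \<longrightarrow> sqrt (\<Sum>j<q. (u t j)\<^sup>2) \<le> 1 \<and>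
            (\<gamma> has_vector_derivative (\<Sum>j<q. u t j *\<^sub>R g j (\<gamma> t))) (at t))}"
    define N2 where "N2 = (\<Union>j<q. {t. U j t \<noteq> v j t})"
    have "{0..T} \<inter> space lebesgue \<in> sets lebesgue" by simp
    from ae[unfolded AE_restrict_space_iff[OF this]] have "negligible N1"
      unfolding N1_def AE_lebesgue_iff_negligible[symmetric] .
    moreover have "negligible N2"
      unfolding N2_def using AE_completion[OF v(2)]
      by (intro negligible_Union) (auto simp: AE_lebesgue_iff_negligible)
    ultimately have "negligible (N1 \<union> N2)" by simp
    moreover have "(\<Sum>j<q. (v j t)\<^sup>2) \<le> 1 \<and> (\<gamma> has_vector_derivative (\<Sum>j<q. v j t *\<^sub>R g j (\<gamma> t))) (at t)"
      if t: "t \<in> {0<..<T} - (N1 \<union> N2)" for t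
    proof -
      have t01: "t \<in> {0..T}" using t by auto
      have "t \<notin> N2" using t by blast
      then have eq: "v j t = u t j" if "j < q" for j using that t01 unfolding N2_def U_def by fastforce
      have "t \<notin> N1" using t by blast
      then have N: "sqrt (\<Sum>j<q. (u t j)\<^sup>2) \<le> 1 \<and> (\<gamma> has_vector_derivative (\<Sum>j<q. u t j *\<^sub>R g j (\<gamma> t))) (at t)"
        using t01 unfolding N1_def by blast
      have "(\<Sum>j<q. (v j t)\<^sup>2) = (\<Sum>j<q. (u t j)\<^sup>2)" "(\<Sum>j<q. v j t *\<^sub>R g j (\<gamma> t)) = (\<Sum>j<q. u t j *\<^sub>R g j (\<gamma> t))"
        using eq by (auto intro!: sum.cong)
      then show ?thesis using N by simp
    qed
    ultimately have "control g q T \<gamma> (\<lambda>t j. v j t) (N1 \<union> N2)" unfolding control_def using v(1) by auto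
    then show ?B by blast
  next
    assume ?B
    then obtain u N where uN: "control g q T \<gamma> u N" by blast
    then have "negligible (N \<union> {0, T})" by (simp add: control_def)
    then have "negligible {t. \<not> (t \<in> {0..T} \<longrightarrow> sqrt (\<Sum>j<q. (u t j)\<^sup>2) \<le> 1 \<and>
            (\<gamma> has_vector_derivative (\<Sum>j<q. u t j *\<^sub>R g j (\<gamma> t))) (at t))}"
      by (rule negligible_subset) (use uN in \<open>force simp: control_def\<close>)
    then have "AE t in lebesgue_on {0..T}. sqrt (\<Sum>j<q. (u t j)\<^sup>2) \<le> 1 \<and>
            (\<gamma> has_vector_derivative (\<Sum>j<q. u t j *\<^sub>R g j (\<gamma> t))) (at t)"
      by (subst AE_restrict_space_iff) (auto simp: AE_lebesgue_iff_negligible)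
    moreover have "(\<lambda>t. u t j) \<in> borel_measurable (lebesgue_on {0..T})" if "j < q" for j
      using uN that by (auto simp: control_def intro!: measurable_restrict_space1 measurable_completion)
    ultimately show ?A by blast
  qed
  then show ?thesis unfolding subunit_def by blast
qed

lemma abs_le_one_if_sum_squares:
  fixes u :: "nat \<Rightarrow> real"
  assumes "(\<Sum>j<q. (u j)\<^sup>2) \<le> 1" "j < q"
  shows "\<bar>u j\<bar> \<le> 1"
proof -
  have "(u j)\<^sup>2 \<le> (\<Sum>j<q. (u j)\<^sup>2)" using assms(2) by (intro member_le_sum) auto
  then have "(u j)\<^sup>2 \<le> 1" using assms(1) by linarith
  then show ?thesis by (simp add: abs_square_le_1)
qed

lemma subunit_refl: "subunit g q 0 (\<lambda>_. x)"
  unfolding subunit_iff control_def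
  by (auto intro!: exI[of _ "\<lambda>_ _. 0"] exI[of _ "{}"] exI[of _ "0::real"] lipschitz_onI)

section \<open>Restricting, reversing and joining paths\<close>

lemma has_vector_derivative_translate:
  assumes "(f has_vector_derivative D) (at (c + t))"
  shows "((\<lambda>t. f (c + t)) has_vector_derivative D) (at (t::real))"
proof -
  have "((\<lambda>t. c + t) has_vector_derivative 1) (at t)" by (auto intro!: derivative_eq_intros)
  from vector_diff_chain_at[OF this assms] show ?thesis by (simp add: o_def)
qed

lemma has_vector_derivative_reflect:
  assumes "(f has_vector_derivative D) (at (c - t))"
  shows "((\<lambda>t. f (c - t)) has_vector_derivative - D) (at (t::real))"
proof -
  have "((\<lambda>t. c - t) has_vector_derivative - 1) (at t)" by (auto intro!: derivative_eq_intros)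
  from vector_diff_chain_at[OF this assms] show ?thesis by (simp add: o_def)
qed

lemma lipschitz_on_isometry_compose:
  fixes \<gamma> :: "'b::metric_space \<Rightarrow> 'c::metric_space"
  assumes K: "K-lipschitz_on A \<gamma>"
    and \<sigma>: "\<And>s. s \<in> B \<Longrightarrow> \<sigma> s \<in> A" "\<And>s t. dist (\<sigma> s) (\<sigma> t) = dist s t"
  shows "K-lipschitz_on B (\<lambda>s. \<gamma> (\<sigma> s))"
proof (rule lipschitz_onI)
  fix s t assume "s \<in> B" "t \<in> B"
  then show "dist (\<gamma> (\<sigma> s)) (\<gamma> (\<sigma> t)) \<le> K * dist s t"
    using lipschitz_onD[OF K, of "\<sigma> s" "\<sigma> t"] \<sigma> by simp
qed (rule lipschitz_on_nonneg[OF K])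

lemma subunit_subpath:
  assumes "subunit g q T \<gamma>" and st: "0 \<le> s" "s \<le> t" "t \<le> T"
  shows "subunit g q (t - s) (\<lambda>\<tau>. \<gamma> (s + \<tau>))"
proof -
  obtain K u N where K: "K-lipschitz_on {0..T} \<gamma>" and c: "control g q T \<gamma> u N"
    using assms(1) unfolding subunit_iff by blast
  have "K-lipschitz_on {0..t - s} (\<lambda>\<tau>. \<gamma> (s + \<tau>))"
    by (rule lipschitz_on_isometry_compose[OF K]) (use st in \<open>auto simp: dist_real_def\<close>)
  moreover have "control g q (t - s) (\<lambda>\<tau>. \<gamma> (s + \<tau>)) (\<lambda>\<tau>. u (s + \<tau>)) ((+) (- s) ` N)"
    unfolding control_def
  proof (intro conjI allI impI ballI)
    show "(\<lambda>\<tau>. u (s + \<tau>) j) \<in> borel_measurable borel" if "j < q" for j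
    proof -
      have "(\<lambda>t. u t j) \<in> borel_measurable borel" using c that by (simp add: control_def)
      from measurable_compose[OF _ this, of "\<lambda>\<tau>. s + \<tau>" borel] show ?thesis by simp
    qed
    have "negligible N" using c by (simp add: control_def)
    then show "negligible ((+) (- s) ` N)" by (rule negligible_translation)
    fix \<tau> assume \<tau>: "\<tau> \<in> {0<..<t - s} - (+) (- s) ` N"
    have "s + \<tau> \<notin> N"
    proof
      assume "s + \<tau> \<in> N"
      then have "- s + (s + \<tau>) \<in> (+) (- s) ` N" by blast
      then show False using \<tau> by simp
    qed
    then have "s + \<tau> \<in> {0<..<T} - N" using \<tau> st by auto
    then have *: "(\<Sum>j<q. (u (s + \<tau>) j)\<^sup>2) \<le> 1"
      "(\<gamma> has_vector_derivative (\<Sum>j<q. u (s + \<tau>) j *\<^sub>R g j (\<gamma> (s + \<tau>)))) (at (s + \<tau>))"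
      using c by (auto simp: control_def)
    show "(\<Sum>j<q. (u (s + \<tau>) j)\<^sup>2) \<le> 1" by (rule *)
    show "((\<lambda>\<tau>. \<gamma> (s + \<tau>)) has_vector_derivative (\<Sum>j<q. u (s + \<tau>) j *\<^sub>R g j (\<gamma> (s + \<tau>)))) (at \<tau>)"
      by (rule has_vector_derivative_translate[OF *(2)])
  qed
  ultimately show ?thesis unfolding subunit_iff using st by auto
qed

lemma subunit_reverse:
  assumes "subunit g q T \<gamma>"
  shows "subunit g q T (\<lambda>t. \<gamma> (T - t))"
proof -
  obtain K u N where T: "T \<ge> 0" and K: "K-lipschitz_on {0..T} \<gamma>" and c: "control g q T \<gamma> u N"
    using assms(1) unfolding subunit_iff by blast
  have "K-lipschitz_on {0..T} (\<lambda>t. \<gamma> (T - t))"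
    by (rule lipschitz_on_isometry_compose[OF K]) (auto simp: dist_real_def)
  moreover have "control g q T (\<lambda>t. \<gamma> (T - t)) (\<lambda>t j. - u (T - t) j) ((\<lambda>t. T - t) ` N)"
    unfolding control_def
  proof (intro conjI allI impI ballI)
    show "(\<lambda>t. - u (T - t) j) \<in> borel_measurable borel" if "j < q" for j
    proof -
      have "(\<lambda>t. u t j) \<in> borel_measurable borel" using c that by (simp add: control_def)
      from measurable_compose[OF _ this, of "\<lambda>t. T - t" borel] show ?thesis by simp
    qed
    show "negligible ((\<lambda>t. T - t) ` N)"
    proof (rule negligible_lipschitz_image)
      show "1-lipschitz_on N (\<lambda>t. T - t)" by (rule lipschitz_onI) (auto simp: dist_real_def)
    qed (use c in \<open>simp add: control_def\<close>)
    fix t assume t: "t \<in> {0<..<T} - (\<lambda>t. T - t) ` N"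
    have "T - t \<notin> N"
    proof
      assume "T - t \<in> N"
      then have "T - (T - t) \<in> (\<lambda>t. T - t) ` N" by blast
      then show False using t by simp
    qed
    then have "T - t \<in> {0<..<T} - N" using t by auto
    then have *: "(\<Sum>j<q. (u (T - t) j)\<^sup>2) \<le> 1"
      "(\<gamma> has_vector_derivative (\<Sum>j<q. u (T - t) j *\<^sub>R g j (\<gamma> (T - t)))) (at (T - t))"
      using c by (auto simp: control_def)
    show "(\<Sum>j<q. (- u (T - t) j)\<^sup>2) \<le> 1" using * by simp
    show "((\<lambda>t. \<gamma> (T - t)) has_vector_derivative (\<Sum>j<q. - u (T - t) j *\<^sub>R g j (\<gamma> (T - t)))) (at t)"
      using has_vector_derivative_reflect[OF *(2)] by (simp add: sum_negf)
  qed
  ultimately show ?thesis unfolding subunit_iff using T by auto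
qed

lemma subunit_concat:
  assumes "subunit g q T1 \<gamma>1" "subunit g q T2 \<gamma>2" and eq: "\<gamma>1 T1 = \<gamma>2 0"
  shows "subunit g q (T1 + T2) (\<lambda>t. if t \<le> T1 then \<gamma>1 t else \<gamma>2 (t - T1))"
proof -
  obtain K1 u1 N1 where 1: "T1 \<ge> 0" "K1-lipschitz_on {0..T1} \<gamma>1" and c1: "control g q T1 \<gamma>1 u1 N1"
    using assms(1) unfolding subunit_iff by blast
  obtain K2 u2 N2 where 2: "T2 \<ge> 0" "K2-lipschitz_on {0..T2} \<gamma>2" and c2: "control g q T2 \<gamma>2 u2 N2"
    using assms(2) unfolding subunit_iff by blast
  define \<gamma> where "\<gamma> t = (if t \<le> T1 then \<gamma>1 t else \<gamma>2 (t - T1))" for t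
  define u where "u t j = (if t \<le> T1 then u1 t j else u2 (t - T1) j)" for t j
  have "K2-lipschitz_on {T1..T1 + T2} (\<lambda>t. \<gamma>2 (t - T1))"
    by (rule lipschitz_on_isometry_compose[OF 2(2)]) (auto simp: dist_real_def)
  then have "(max K1 K2)-lipschitz_on {0..T1 + T2} \<gamma>"
    unfolding \<gamma>_def using 1 eq by (intro lipschitz_on_concat_max) auto
  moreover have "control g q (T1 + T2) \<gamma> u (N1 \<union> (+) T1 ` N2 \<union> {T1})"
    unfolding control_def
  proof (intro conjI allI impI ballI)
    show "(\<lambda>t. u t j) \<in> borel_measurable borel" if "j < q" for j
    proof -
      have a: "(\<lambda>t. u1 t j) \<in> borel_measurable borel" "(\<lambda>t. u2 t j) \<in> borel_measurable borel"
        using c1 c2 that by (simp_all add: control_def)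
      have "(\<lambda>t. u2 (t - T1) j) \<in> borel_measurable borel"
        using measurable_compose[OF _ a(2), of "\<lambda>t. t - T1" borel] by simp
      then show ?thesis unfolding u_def using a(1) by (intro measurable_If) auto
    qed
    show "negligible (N1 \<union> (+) T1 ` N2 \<union> {T1})"
      using c1 c2 by (auto simp: control_def intro: negligible_translation)
    fix t assume t: "t \<in> {0<..<T1 + T2} - (N1 \<union> (+) T1 ` N2 \<union> {T1})"
    have "(\<Sum>j<q. (u t j)\<^sup>2) \<le> 1 \<and> (\<gamma> has_vector_derivative (\<Sum>j<q. u t j *\<^sub>R g j (\<gamma> t))) (at t)"
    proof (cases "t < T1")
      case True
      then have *: "(\<Sum>j<q. (u1 t j)\<^sup>2) \<le> 1" "(\<gamma>1 has_vector_derivative (\<Sum>j<q. u1 t j *\<^sub>R g j (\<gamma>1 t))) (at t)"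
        using c1 t by (auto simp: control_def)
      have "(\<gamma> has_vector_derivative (\<Sum>j<q. u1 t j *\<^sub>R g j (\<gamma>1 t))) (at t)"
        by (rule has_vector_derivative_transform_within_open[OF *(2), of "{..<T1}"]) (use True in \<open>auto simp: \<gamma>_def\<close>)
      then show ?thesis using * True by (simp add: u_def \<gamma>_def)
    next
      case False
      then have t1: "t > T1" using t by auto
      have "t - T1 \<notin> N2"
      proof
        assume "t - T1 \<in> N2"
        then have "T1 + (t - T1) \<in> (+) T1 ` N2" by blast
        then show False using t by simp
      qed
      then have "t - T1 \<in> {0<..<T2} - N2" using t t1 by auto
      then have *: "(\<Sum>j<q. (u2 (t - T1) j)\<^sup>2) \<le> 1" "(\<gamma>2 has_vector_derivative (\<Sum>j<q. u2 (t - T1) j *\<^sub>R g j (\<gamma>2 (t - T1)))) (at (- T1 + t))"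
        using c2 by (auto simp: control_def)
      have "(\<gamma> has_vector_derivative (\<Sum>j<q. u2 (t - T1) j *\<^sub>R g j (\<gamma>2 (t - T1)))) (at t)"
        by (rule has_vector_derivative_transform_within_open[OF has_vector_derivative_translate[OF *(2)], of "{T1<..}"])
           (use t1 in \<open>auto simp: \<gamma>_def\<close>)
      then show ?thesis using * t1 by (simp add: u_def \<gamma>_def)
    qed
    then show "(\<Sum>j<q. (u t j)\<^sup>2) \<le> 1" "(\<gamma> has_vector_derivative (\<Sum>j<q. u t j *\<^sub>R g j (\<gamma> t))) (at t)" by auto
  qed
  ultimately show ?thesis unfolding subunit_iff \<gamma>_def[symmetric] using 1 2 by auto
qed

section \<open>The distance, the orbit and its topology\<close>

lemma cc_dist_le: "subunit g q T \<gamma> \<Longrightarrow> \<gamma> 0 = x \<Longrightarrow> \<gamma> T = y \<Longrightarrow> cc_dist g q x y \<le> ereal T"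
  unfolding cc_dist_def by (rule Inf_lower) blast

lemma cc_dist_lessD:
  assumes "cc_dist g q x y < ereal r"
  obtains T \<gamma> where "subunit g q T \<gamma>" "\<gamma> 0 = x" "\<gamma> T = y" "T < r"
  using assms unfolding cc_dist_def Inf_less_iff by auto

lemma orbit_iff: "y \<in> orbit g q x \<longleftrightarrow> (\<exists>T \<gamma>. subunit g q T \<gamma> \<and> \<gamma> 0 = x \<and> \<gamma> T = y)"
proof
  assume "y \<in> orbit g q x"
  then show "\<exists>T \<gamma>. subunit g q T \<gamma> \<and> \<gamma> 0 = x \<and> \<gamma> T = y"
    unfolding orbit_def cc_dist_def mem_Collect_eq Inf_less_iff by blast
next
  assume "\<exists>T \<gamma>. subunit g q T \<gamma> \<and> \<gamma> 0 = x \<and> \<gamma> T = y"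
  then obtain T where "cc_dist g q x y \<le> ereal T" using cc_dist_le by blast
  also have "\<dots> < \<infinity>" by simp
  finally show "y \<in> orbit g q x" by (simp add: orbit_def)
qed

lemma orbit_refl: "x \<in> orbit g q x"
  unfolding orbit_iff using subunit_refl by fastforce

lemma orbit_trans:
  assumes "y \<in> orbit g q x" "z \<in> orbit g q y"
  shows "z \<in> orbit g q x"
proof -
  obtain T1 \<gamma>1 where 1: "subunit g q T1 \<gamma>1" "\<gamma>1 0 = x" "\<gamma>1 T1 = y" using assms(1) unfolding orbit_iff by blast
  obtain T2 \<gamma>2 where 2: "subunit g q T2 \<gamma>2" "\<gamma>2 0 = y" "\<gamma>2 T2 = z" using assms(2) unfolding orbit_iff by blast
  have "T1 \<ge> 0" "T2 \<ge> 0" using 1 2 by (auto simp: subunit_def)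
  then show ?thesis unfolding orbit_iff
    using subunit_concat[OF 1(1) 2(1)] 1 2
    by (intro exI[of _ "T1 + T2"] exI[of _ "\<lambda>t. if t \<le> T1 then \<gamma>1 t else \<gamma>2 (t - T1)"]) auto
qed

lemma openin_cc_topology:
  "openin (cc_topology g q x) U \<longleftrightarrow> U \<subseteq> orbit g q x \<and>
     (\<forall>y\<in>U. \<exists>r>0. {z \<in> orbit g q x. cc_dist g q y z < ereal r} \<subseteq> U)"
proof -
  have "istopology (\<lambda>U. U \<subseteq> orbit g q x \<and>
      (\<forall>y\<in>U. \<exists>r>0. {z \<in> orbit g q x. cc_dist g q y z < ereal r} \<subseteq> U))"
    unfolding istopology_def
  proof (rule conjI; intro allI impI)
    fix S T
    assume S: "S \<subseteq> orbit g q x \<and> (\<forall>y\<in>S. \<exists>r>0. {z \<in> orbit g q x. cc_dist g q y z < ereal r} \<subseteq> S)"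
      and T: "T \<subseteq> orbit g q x \<and> (\<forall>y\<in>T. \<exists>r>0. {z \<in> orbit g q x. cc_dist g q y z < ereal r} \<subseteq> T)"
    show "S \<inter> T \<subseteq> orbit g q x \<and> (\<forall>y\<in>S \<inter> T. \<exists>r>0. {z \<in> orbit g q x. cc_dist g q y z < ereal r} \<subseteq> S \<inter> T)"
    proof (intro conjI ballI)
      fix y assume y: "y \<in> S \<inter> T"
      then obtain r1 r2 where r: "r1 > 0" "{z \<in> orbit g q x. cc_dist g q y z < ereal r1} \<subseteq> S"
        "r2 > 0" "{z \<in> orbit g q x. cc_dist g q y z < ereal r2} \<subseteq> T" using S T by blast
      have "{z \<in> orbit g q x. cc_dist g q y z < ereal (min r1 r2)} \<subseteq> S \<inter> T"
      proof
        fix z assume "z \<in> {z \<in> orbit g q x. cc_dist g q y z < ereal (min r1 r2)}"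
        then have z: "z \<in> orbit g q x" "cc_dist g q y z < ereal (min r1 r2)" by auto
        have "ereal (min r1 r2) \<le> ereal r1" "ereal (min r1 r2) \<le> ereal r2" by auto
        then have "cc_dist g q y z < ereal r1" "cc_dist g q y z < ereal r2" using z(2) less_le_trans by blast+
        then show "z \<in> S \<inter> T" using r z(1) by blast
      qed
      then show "\<exists>r>0. {z \<in> orbit g q x. cc_dist g q y z < ereal r} \<subseteq> S \<inter> T"
        using r by (intro exI[of _ "min r1 r2"]) auto
    qed (use S in blast)
  next
    fix \<K>
    assume K: "\<forall>S\<in>\<K>. S \<subseteq> orbit g q x \<and> (\<forall>y\<in>S. \<exists>r>0. {z \<in> orbit g q x. cc_dist g q y z < ereal r} \<subseteq> S)"
    show "\<Union>\<K> \<subseteq> orbit g q x \<and> (\<forall>y\<in>\<Union>\<K>. \<exists>r>0. {z \<in> orbit g q x. cc_dist g q y z < ereal r} \<subseteq> \<Union>\<K>)"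
    proof (intro conjI ballI)
      fix y assume "y \<in> \<Union>\<K>"
      then obtain S where S: "S \<in> \<K>" "y \<in> S" by blast
      then obtain r where "r > 0" "{z \<in> orbit g q x. cc_dist g q y z < ereal r} \<subseteq> S" using K by blast
      then show "\<exists>r>0. {z \<in> orbit g q x. cc_dist g q y z < ereal r} \<subseteq> \<Union>\<K>" using S by blast
    qed (use K in blast)
  qed
  then show ?thesis unfolding cc_topology_def by (simp add: topology_inverse')
qed

lemma topspace_cc_topology: "topspace (cc_topology g q x) = orbit g q x"
proof -
  have "openin (cc_topology g q x) (orbit g q x)"
    unfolding openin_cc_topology by (auto intro!: exI[of _ 1])
  then have "orbit g q x \<subseteq> topspace (cc_topology g q x)" by (rule openin_subset)
  moreover have "topspace (cc_topology g q x) \<subseteq> orbit g q x"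
    using openin_topspace[of "cc_topology g q x"] unfolding openin_cc_topology by blast
  ultimately show ?thesis by blast
qed

text \<open>Restricting the path, and reversing it if necessary, shows that the distance between two
  of its points is at most the elapsed time.\<close>

lemma subunit_path_continuous:
  assumes "subunit g q T \<gamma>"
  shows "continuous_map (top_of_set {0..T}) (cc_topology g q (\<gamma> 0)) \<gamma>"
proof -
  have dist: "cc_dist g q (\<gamma> s) (\<gamma> t) \<le> ereal \<bar>s - t\<bar>" if st: "s \<in> {0..T}" "t \<in> {0..T}" for s t
  proof (cases "s \<le> t")
    case True
    have "subunit g q (t - s) (\<lambda>\<tau>. \<gamma> (s + \<tau>))" by (rule subunit_subpath[OF assms]) (use st True in auto)
    then show ?thesis using cc_dist_le[of g q "t - s" "\<lambda>\<tau>. \<gamma> (s + \<tau>)"] True by simp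
  next
    case False
    have "subunit g q (s - t) (\<lambda>\<tau>. \<gamma> (t + \<tau>))" by (rule subunit_subpath[OF assms]) (use st False in auto)
    then have "subunit g q (s - t) (\<lambda>\<tau>. \<gamma> (t + (s - t - \<tau>)))" by (rule subunit_reverse)
    then show ?thesis using cc_dist_le[of g q "s - t" "\<lambda>\<tau>. \<gamma> (t + (s - t - \<tau>))"] False by simp
  qed
  have orb: "\<gamma> t \<in> orbit g q (\<gamma> 0)" if t: "t \<in> {0..T}" for t
  proof -
    have "cc_dist g q (\<gamma> 0) (\<gamma> t) \<le> ereal \<bar>0 - t\<bar>" by (rule dist) (use t in auto)
    also have "\<dots> < \<infinity>" by simp
    finally show ?thesis by (simp add: orbit_def)
  qed
  show ?thesis
    unfolding continuous_map_def topspace_cc_topology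
  proof (intro conjI allI impI)
    show "\<gamma> \<in> topspace (top_of_set {0..T}) \<rightarrow> orbit g q (\<gamma> 0)" using orb by auto
    fix U assume U: "openin (cc_topology g q (\<gamma> 0)) U"
    have "\<exists>e>0. \<forall>t\<in>{0..T}. dist t s < e \<longrightarrow> t \<in> {t \<in> {0..T}. \<gamma> t \<in> U}" if s: "s \<in> {t \<in> {0..T}. \<gamma> t \<in> U}" for s
    proof -
      obtain r where r: "r > 0" "{z \<in> orbit g q (\<gamma> 0). cc_dist g q (\<gamma> s) z < ereal r} \<subseteq> U"
        using U s unfolding openin_cc_topology by blast
      have "\<gamma> t \<in> U" if t: "t \<in> {0..T}" "dist t s < r" for t
      proof -
        have "cc_dist g q (\<gamma> s) (\<gamma> t) \<le> ereal \<bar>s - t\<bar>" by (rule dist) (use s t in auto)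
        also have "\<dots> < ereal r" using t by (simp add: dist_real_def abs_minus_commute)
        finally show ?thesis using r orb[OF t(1)] by blast
      qed
      then show ?thesis using r(1) by blast
    qed
    then show "openin (top_of_set {0..T}) {t \<in> topspace (top_of_set {0..T}). \<gamma> t \<in> U}"
      unfolding openin_euclidean_subtopology_iff by auto
  qed
qed

lemma connected_cc_topology: "connected_space (cc_topology g q x)"
proof -
  have conn: "\<exists>S. connectedin (cc_topology g q x) S \<and> x \<in> S \<and> y \<in> S" if y: "y \<in> orbit g q x" for y
  proof -
    obtain T \<gamma> where \<gamma>: "subunit g q T \<gamma>" "\<gamma> 0 = x" "\<gamma> T = y" using orbit_iff[THEN iffD1, OF y] by blast
    have T: "T \<ge> 0" using \<gamma>(1) by (simp add: subunit_def)
    have "connectedin (top_of_set {0..T}) {0..T}"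
      by (simp add: connectedin_subtopology)
    then have "connectedin (cc_topology g q x) (\<gamma> ` {0..T})"
      using connectedin_continuous_map_image[OF subunit_path_continuous[OF \<gamma>(1)]] \<gamma>(2) by simp
    then show ?thesis using \<gamma> T by (intro exI[of _ "\<gamma> ` {0..T}"]) force
  qed
  show ?thesis
    unfolding connected_space_subconnected topspace_cc_topology
  proof (intro ballI)
    fix y z assume "y \<in> orbit g q x" "z \<in> orbit g q x"
    then obtain S T where S: "connectedin (cc_topology g q x) S" "x \<in> S" "y \<in> S"
      and T: "connectedin (cc_topology g q x) T" "x \<in> T" "z \<in> T" using conn by metis
    have "connectedin (cc_topology g q x) (S \<union> T)" using S T by (intro connectedin_Un) auto
    then show "\<exists>S. connectedin (cc_topology g q x) S \<and> y \<in> S \<and> z \<in> S" using S T by blast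
  qed
qed

text \<open>Before the first exit time the speed is at most \<open>real q * B\<close>, since each
  component of the control is at most one; the time is too short to reach the sphere.\<close>

lemma subunit_stays_in_ball:
  assumes "subunit g q T \<gamma>" and B: "\<And>j y. j < q \<Longrightarrow> y \<in> ball p s \<Longrightarrow> norm (g j y) \<le> B" and "B \<ge> 0"
    and p: "\<gamma> 0 = p" and T: "real q * B * T < s" and t: "t \<in> {0..T}"
  shows "\<gamma> t \<in> ball p s"
proof (rule ccontr)
  assume out: "\<gamma> t \<notin> ball p s"
  obtain K u N where K: "K-lipschitz_on {0..T} \<gamma>" and c: "control g q T \<gamma> u N"
    using assms(1) unfolding subunit_iff by blast
  define S where "S = {0..T} \<inter> \<gamma> -` (- ball p s)"
  have "closed S" unfolding S_def
    by (rule continuous_closed_preimage[OF lipschitz_on_continuous_on[OF K]]) auto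
  moreover have "bounded S" unfolding S_def by (rule bounded_subset[of "{0..T}"]) auto
  ultimately have "compact S" by (simp add: compact_eq_bounded_closed)
  moreover have "t \<in> S" using t out by (simp add: S_def)
  then have "S \<noteq> {}" by blast
  ultimately have "\<exists>m\<in>S. \<forall>r\<in>S. m \<le> r" by (rule compact_attains_inf)
  then obtain m where m: "m \<in> S" "\<And>r. r \<in> S \<Longrightarrow> m \<le> r" by blast
  have mT: "m \<in> {0..T}" "\<gamma> m \<notin> ball p s" using m by (auto simp: S_def)
  have "norm (\<gamma> m - \<gamma> 0) \<le> (real q * B) * (m - 0)"
  proof (rule lipschitz_AE_deriv_bound)
    show "K-lipschitz_on {0..m} \<gamma>" by (rule lipschitz_on_subset[OF K]) (use mT in auto)
    show "negligible N" using c by (simp add: control_def)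
    fix r assume r: "r \<in> {0<..<m}" "r \<notin> N"
    then have rT: "r \<in> {0<..<T} - N" using mT by auto
    have "r \<notin> S" using r m(2)[of r] by auto
    then have ball: "\<gamma> r \<in> ball p s" using rT by (auto simp: S_def)
    have u: "(\<Sum>j<q. (u r j)\<^sup>2) \<le> 1" "(\<gamma> has_vector_derivative (\<Sum>j<q. u r j *\<^sub>R g j (\<gamma> r))) (at r)"
      using c rT by (auto simp: control_def)
    have "norm (\<Sum>j<q. u r j *\<^sub>R g j (\<gamma> r)) \<le> (\<Sum>j<q. 1 * B)"
    proof (rule sum_norm_le)
      fix j assume "j \<in> {..<q}"
      then show "norm (u r j *\<^sub>R g j (\<gamma> r)) \<le> 1 * B"
        using abs_le_one_if_sum_squares[OF u(1), of j] B[OF _ ball, of j] \<open>B \<ge> 0\<close>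
        unfolding norm_scaleR by (intro mult_mono) auto
    qed
    then show "\<exists>D. (\<gamma> has_vector_derivative D) (at r) \<and> norm D \<le> real q * B" using u(2) by auto
  qed (use mT in auto)
  also have "\<dots> \<le> real q * B * T" using mT \<open>B \<ge> 0\<close> by (intro mult_left_mono) auto
  also have "\<dots> < s" by (rule T)
  finally show False using mT(2) p by (simp add: dist_norm norm_minus_commute)
qed

text \<open>The fields are locally bounded, so a short subunit path makes a small Euclidean
  displacement. The comparison yields the Hausdorff property and the continuity of the inverse
  charts.\<close>

lemma cc_topology_finer:
  assumes lip: "\<forall>j<q. locally_lipschitz (g j)" and "open U"
  shows "openin (cc_topology g q x) (U \<inter> orbit g q x)"
  unfolding openin_cc_topology
proof (intro conjI ballI)
  fix y assume y: "y \<in> U \<inter> orbit g q x"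
  obtain r L where r: "r > 0" and L: "\<And>j. j < q \<Longrightarrow> L-lipschitz_on (cball y r) (g j)" "L \<ge> 0"
    using locally_lipschitz_family[OF lip] by metis
  obtain e where e: "e > 0" "ball y e \<subseteq> U" using y \<open>open U\<close> open_contains_ball by blast
  define s where "s = min r e"
  have s: "s > 0" "s \<le> r" "ball y s \<subseteq> U" using r e by (auto simp: s_def)
  define B where "B = L * r + (\<Sum>j<q. norm (g j y))"
  have B: "B \<ge> 0" unfolding B_def using L r by (intro add_nonneg_nonneg sum_nonneg) auto
  have bound: "norm (g j z) \<le> B" if j: "j < q" and z: "z \<in> ball y s" for j z
  proof -
    have "norm (g j z - g j y) \<le> L * norm (z - y)"
      using lipschitz_onD[OF L(1)[OF j], of z y] z s r by (simp add: dist_norm)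
    also have "\<dots> \<le> L * r" using z s L by (intro mult_left_mono) (auto simp: dist_norm norm_minus_commute)
    finally have "norm (g j z) \<le> L * r + norm (g j y)" using norm_triangle_ineq2[of "g j z" "g j y"] by simp
    also have "norm (g j y) \<le> (\<Sum>j<q. norm (g j y))" using j by (intro member_le_sum) auto
    finally show ?thesis by (simp add: B_def)
  qed
  define d where "d = s / (real q * B + 1)"
  have qB: "real q * B \<ge> 0" using B by simp
  have d: "d > 0" using s qB by (simp add: d_def add_nonneg_pos)
  have "{z \<in> orbit g q x. cc_dist g q y z < ereal d} \<subseteq> U \<inter> orbit g q x"
  proof (rule subsetI)
    fix z assume "z \<in> {z \<in> orbit g q x. cc_dist g q y z < ereal d}"
    then have z: "z \<in> orbit g q x" "cc_dist g q y z < ereal d" by auto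
    obtain T \<gamma> where \<gamma>: "subunit g q T \<gamma>" "\<gamma> 0 = y" "\<gamma> T = z" "T < d" using cc_dist_lessD[OF z(2)] .
    have T: "T \<ge> 0" using \<gamma>(1) by (simp add: subunit_def)
    have "real q * B * T \<le> real q * B * d" using \<gamma>(4) qB by (intro mult_left_mono) auto
    also have "\<dots> < (real q * B + 1) * d" using d by (simp add: algebra_simps)
    also have "\<dots> = s" using qB by (simp add: d_def)
    finally have "\<gamma> T \<in> ball y s"
      using subunit_stays_in_ball[OF \<gamma>(1) bound B \<gamma>(2)] T by auto
    then show "z \<in> U \<inter> orbit g q x" using \<gamma> s z by auto
  qed
  then show "\<exists>r>0. {z \<in> orbit g q x. cc_dist g q y z < ereal r} \<subseteq> U \<inter> orbit g q x" using d by blast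
qed auto

lemma Hausdorff_cc_topology:
  assumes lip: "\<forall>j<q. locally_lipschitz (g j)"
  shows "Hausdorff_space (cc_topology g q x)"
  unfolding Hausdorff_space_def topspace_cc_topology
proof (intro allI impI)
  fix y z assume yz: "y \<in> orbit g q x \<and> z \<in> orbit g q x \<and> y \<noteq> z"
  then obtain U V where "open U" "open V" "y \<in> U" "z \<in> V" "U \<inter> V = {}" using hausdorff[of y z] by blast
  then show "\<exists>U V. openin (cc_topology g q x) U \<and> openin (cc_topology g q x) V \<and> y \<in> U \<and> z \<in> V \<and> disjnt U V"
    using cc_topology_finer[OF lip] yz
    by (intro exI[of _ "U \<inter> orbit g q x"] exI[of _ "V \<inter> orbit g q x"]) (auto simp: disjnt_def)
qed

section \<open>Charts of the orbit\<close>

text \<open>What is kept of the frame once the surface is built: \<open>D v\<close> is the frame at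
  \<open>\<phi> v\<close>, \<open>b j v\<close> are its coefficients, and \<open>D_g\<close> records
  that the remainders vanish on the surface. \<open>D v\<close> acts on the whole space but factors
  through \<open>P\<close>. All data are locale parameters because transition maps involve two
  charts with different data.\<close>

locale integral_chart =
  fixes g :: "nat \<Rightarrow> 'a::euclidean_space \<Rightarrow> 'a" and q :: nat and x0 :: 'a and P \<phi> :: "'a \<Rightarrow> 'a"
    and D :: "'a \<Rightarrow> 'a \<Rightarrow> 'a" and b :: "nat \<Rightarrow> 'a \<Rightarrow> 'a" and V :: "'a set"
    and \<rho> A M K1 K2 K3 R Lg :: real
  assumes V_def: "V = {v \<in> Pspace g q x0. norm v < \<rho>}"
    and linear_P: "linear P" and P_in: "P v \<in> Pspace g q x0"
    and P_id: "v \<in> Pspace g q x0 \<Longrightarrow> P v = v" and norm_P: "norm (P v) \<le> norm v"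
    and nonneg: "\<rho> > 0" "R > 0" "A \<ge> 0" "M \<ge> 0" "K1 \<ge> 0" "K2 \<ge> 0" "K3 \<ge> 0" "Lg \<ge> 0"
    and \<phi>_0: "\<phi> 0 = x0"
    and P_\<phi>: "v \<in> V \<Longrightarrow> P (\<phi> v - x0) = v"
    and \<phi>_in_ball: "v \<in> V \<Longrightarrow> \<phi> v \<in> ball x0 R"
    and \<phi>_lipschitz: "v \<in> V \<Longrightarrow> w \<in> V \<Longrightarrow> norm (\<phi> w - \<phi> v) \<le> K1 * norm (w - v)"
    and \<phi>_first_order: "v \<in> V \<Longrightarrow> w \<in> V \<Longrightarrow> norm (\<phi> w - \<phi> v - D v (w - v)) \<le> K2 * (norm (w - v))\<^sup>2"
    and linear_D: "linear (D v)" and norm_D: "norm (D v h) \<le> M * norm h"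
    and P_D: "P (D v h) = P h" and D_P: "D v (P h) = D v h"
    and D_lipschitz: "v \<in> V \<Longrightarrow> w \<in> V \<Longrightarrow> norm (D v h - D w h) \<le> K3 * norm (v - w) * norm h"
    and D_horizontal: "v \<in> V \<Longrightarrow> D v h = (\<Sum>j<q. (b j v \<bullet> h) *\<^sub>R g j (\<phi> v))"
    and continuous_b: "j < q \<Longrightarrow> continuous_on V (b j)"
    and norm_b: "j < q \<Longrightarrow> v \<in> V \<Longrightarrow> norm (b j v) \<le> A"
    and D_g: "v \<in> V \<Longrightarrow> l < q \<Longrightarrow> D v (g l (\<phi> v)) = g l (\<phi> v)"
    and lipschitz_g: "j < q \<Longrightarrow> Lg-lipschitz_on (ball x0 R) (g j)"

lemma integral_chart_exists:
  fixes g :: "nat \<Rightarrow> 'a::euclidean_space \<Rightarrow> 'a" and x0 :: 'a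
  assumes lip: "\<forall>j<q. locally_lipschitz (g j)"
    and H: "\<forall>\<Omega>::'a set. bounded \<Omega> \<and> open \<Omega> \<longrightarrow>
              (\<exists>C>0. AE x in lebesgue. x \<in> \<Omega> \<longrightarrow>
                 (\<forall>j<q. \<forall>k<q. lie_bracket g j k x \<in> Pball g q C x))"
  obtains P \<phi> D b V \<rho> A M K1 K2 K3 R Lg where "integral_chart g q x0 P \<phi> D b V \<rho> A M K1 K2 K3 R Lg"
proof -
  obtain P Z K M W C L R N a A Lg where
    frame: "involutive_frame Z P K M W q C L R x0 N" and
    P: "\<And>v. P v \<in> Pspace g q x0" "\<And>v. v \<in> Pspace g q x0 \<Longrightarrow> P v = v" and
    Z: "\<And>x v. x \<in> ball x0 R \<Longrightarrow> Z x v = (\<Sum>j<q. (a j x \<bullet> v) *\<^sub>R g j x)" and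
    W: "\<And>x l. x \<in> ball x0 R \<Longrightarrow> l < q \<Longrightarrow> W l x = g l x - Z x (g l x)" and
    ZP: "\<And>x v. Z x (P v) = Z x v" and
    conta: "\<And>j. j < q \<Longrightarrow> continuous_on (ball x0 R) (a j)" and
    norma: "\<And>j x. j < q \<Longrightarrow> x \<in> ball x0 R \<Longrightarrow> norm (a j x) \<le> A" and A: "A \<ge> 0" and
    lipg: "\<And>j. j < q \<Longrightarrow> Lg-lipschitz_on (ball x0 R) (g j)"
    by (rule involutive_frame_exists[OF lip H]) (rule that; assumption)
  interpret involutive_frame Z P K M W q C L R x0 N by (rule frame)
  obtain \<phi> \<rho> where \<phi>: "\<rho> > 0" "\<phi> 0 = x0"
    "\<And>v. P v = v \<Longrightarrow> norm v < \<rho> \<Longrightarrow> P (\<phi> v - x0) = v"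
    "\<And>v w. P v = v \<Longrightarrow> norm v < \<rho> \<Longrightarrow> P w = w \<Longrightarrow> norm w < \<rho> \<Longrightarrow> norm (\<phi> w - \<phi> v) \<le> 2 * M * norm (w - v)"
    "\<And>v w. P v = v \<Longrightarrow> norm v < \<rho> \<Longrightarrow> P w = w \<Longrightarrow> norm w < \<rho> \<Longrightarrow>
       norm (\<phi> w - \<phi> v - Z (\<phi> v) (w - v)) \<le> 2 * K * M * (norm (w - v))\<^sup>2"
    "\<And>v l. P v = v \<Longrightarrow> norm v < \<rho> \<Longrightarrow> l < q \<Longrightarrow> W l (\<phi> v) = 0"
    by (rule integral_surface_exists) (rule that; assumption)
  \<comment> \<open>As \<open>\<phi>\<close> has Lipschitz constant \<open>2 * M\<close>, the second
    bound keeps the surface in the ball where the frame is known to be a combination of the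
    fields.\<close>
  define \<rho>' where "\<rho>' = min \<rho> (R / (2 * M + 1))"
  have \<rho>': "\<rho>' > 0" using \<phi>(1) R_pos M_nonneg by (simp add: \<rho>'_def)
  define V where "V = {v \<in> Pspace g q x0. norm v < \<rho>'}"
  have V: "P v = v" "norm v < \<rho>" if "v \<in> V" for v using that P(2) by (auto simp: V_def \<rho>'_def)
  have V0: "0 \<in> V" using \<rho>' by (auto simp: V_def Pspace_def span_zero)
  have ball: "\<phi> v \<in> ball x0 R" if v: "v \<in> V" for v
  proof -
    have "norm (\<phi> v - \<phi> 0) \<le> 2 * M * norm (v - 0)" using \<phi>(4) V[OF v] V[OF V0] by blast
    also have "\<dots> \<le> (2 * M + 1) * norm v" by (simp add: algebra_simps)
    also have "\<dots> < (2 * M + 1) * (R / (2 * M + 1))"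
      using v M_nonneg by (intro mult_strict_left_mono) (auto simp: V_def \<rho>'_def)
    also have "\<dots> = R" using M_nonneg by simp
    finally show ?thesis using \<phi>(2) by (simp add: dist_norm norm_minus_commute)
  qed
  have lipg': "(max Lg 0)-lipschitz_on (ball x0 R) (g j)" if "j < q" for j
    by (rule lipschitz_on_le[OF lipg[OF that]]) simp
  have cont\<phi>: "continuous_on V \<phi>"
  proof (rule lipschitz_on_continuous_on)
    show "(2 * M)-lipschitz_on V \<phi>" using \<phi>(4) V M_nonneg by (intro lipschitz_onI) (auto simp: dist_norm)
  qed
  have "integral_chart g q x0 P \<phi> (\<lambda>v. Z (\<phi> v)) (\<lambda>j v. a j (\<phi> v)) V \<rho>' A M (2 * M) (2 * K * M) (K * (2 * M)) R (max Lg 0)"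
  proof (rule integral_chart.intro)
    show "V = {v \<in> Pspace g q x0. norm v < \<rho>'}" by (rule V_def)
    show "norm (Z (\<phi> v) h - Z (\<phi> w) h) \<le> K * (2 * M) * norm (v - w) * norm h" if "v \<in> V" "w \<in> V" for v w h
    proof -
      have "norm (Z (\<phi> v) h - Z (\<phi> w) h) \<le> K * norm (\<phi> v - \<phi> w) * norm h" by (rule lipschitz_Z)
      also have "\<dots> \<le> K * (2 * M * norm (v - w)) * norm h"
        using \<phi>(4)[OF V[OF that(2)] V[OF that(1)]] K_nonneg by (intro mult_right_mono mult_left_mono) auto
      finally show ?thesis by (simp add: mult_ac)
    qed
    show "norm (\<phi> w - \<phi> v - Z (\<phi> v) (w - v)) \<le> 2 * K * M * (norm (w - v))\<^sup>2" if "v \<in> V" "w \<in> V" for v w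
      by (rule \<phi>(5)[OF V[OF that(1)] V[OF that(2)]])
    show "continuous_on V (\<lambda>v. a j (\<phi> v))" if "j < q" for j
      by (rule continuous_on_compose2[OF conta[OF that] cont\<phi>]) (use ball in auto)
    show "Z (\<phi> v) (g l (\<phi> v)) = g l (\<phi> v)" if "v \<in> V" "l < q" for v l
      using W[OF ball[OF that(1)] that(2)] \<phi>(6)[OF V[OF that(1)] that(2)] by simp
  qed (use linear_P P norm_P \<rho>' R_pos A M_nonneg K_nonneg \<phi>(2,3) \<phi>(4,5) V ball linear_Z norm_Z P_Z ZP Z norma lipg' in auto)
  then show ?thesis by (rule that)
qed

context integral_chart
begin

lemma zero_in_V: "0 \<in> V" using nonneg by (auto simp: V_def Pspace_def span_zero)

lemma convex_V: "convex V"
proof -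
  have "V = Pspace g q x0 \<inter> ball 0 \<rho>" by (auto simp: V_def)
  then show ?thesis by (simp add: convex_Int Pspace_def subspace_imp_convex)
qed

lemma \<phi>_deriv: "v \<in> V \<Longrightarrow> (\<phi> has_derivative D v) (at v within V)"
  unfolding has_derivative_within_alt
proof (intro conjI allI impI)
  assume v: "v \<in> V"
  show "bounded_linear (D v)" using linear_D by (simp add: linear_conv_bounded_linear)
  fix e :: real assume e: "e > 0"
  show "\<exists>d>0. \<forall>w\<in>V. norm (w - v) < d \<longrightarrow> norm (\<phi> w - \<phi> v - D v (w - v)) \<le> e * norm (w - v)"
  proof (intro exI conjI ballI impI)
    show "e / (K2 + 1) > 0" using e nonneg by simp
    fix w assume w: "w \<in> V" "norm (w - v) < e / (K2 + 1)"
    have "K2 * norm (w - v) \<le> (K2 + 1) * norm (w - v)" by (simp add: algebra_simps)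
    also have "\<dots> \<le> e" using w(2) nonneg by (simp add: pos_less_divide_eq mult.commute)
    finally have "K2 * norm (w - v) * norm (w - v) \<le> e * norm (w - v)" by (intro mult_right_mono) auto
    then show "norm (\<phi> w - \<phi> v - D v (w - v)) \<le> e * norm (w - v)"
      using \<phi>_first_order[OF v w(1)] by (simp add: power2_eq_square mult_ac)
  qed
qed

text \<open>The deviation \<open>\<delta> r\<close> of the path from the surface point above its
  projection starts at zero. Since \<open>D v\<close> fixes the fields on the surface, the part of
  the velocity that it misses is proportional to \<open>\<delta>\<close>; over a short time the
  maximum of \<open>norm (\<delta> r)\<close> is at most a proper fraction of itself.\<close>

lemma path_stays_in_chart:
  assumes v0: "v0 \<in> V"
  shows "\<exists>\<epsilon>>0. \<forall>T \<gamma> t. subunit g q T \<gamma> \<longrightarrow> \<gamma> 0 = \<phi> v0 \<longrightarrow> T < \<epsilon> \<longrightarrow> t \<in> {0..T} \<longrightarrow> \<gamma> t \<in> \<phi> ` V"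
proof -
  define B where "B = Lg * R + (\<Sum>j<q. norm (g j x0))"
  have B: "B \<ge> 0" unfolding B_def using nonneg by (intro add_nonneg_nonneg sum_nonneg) auto
  have normg: "norm (g j y) \<le> B" if j: "j < q" and y: "y \<in> ball x0 R" for j y
  proof -
    have "norm (g j y - g j x0) \<le> Lg * norm (y - x0)"
      using lipschitz_onD[OF lipschitz_g[OF j] y, of x0] nonneg by (simp add: dist_norm)
    also have "\<dots> \<le> Lg * R" using y nonneg by (intro mult_left_mono) (auto simp: dist_norm norm_minus_commute)
    finally have "norm (g j y) \<le> Lg * R + norm (g j x0)" using norm_triangle_ineq2[of "g j y" "g j x0"] by simp
    also have "norm (g j x0) \<le> (\<Sum>j<q. norm (g j x0))" using j by (intro member_le_sum) auto
    finally show ?thesis by (simp add: B_def)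
  qed
  obtain s0 where s0: "s0 > 0" "ball (\<phi> v0) s0 \<subseteq> ball x0 R"
    using \<phi>_in_ball[OF v0] open_ball open_contains_ball by metis
  \<comment> \<open>In this ball the fields are Lipschitz and the projection of the path stays in
    \<open>V\<close>.\<close>
  define s where "s = min s0 (\<rho> - norm v0)"
  have s: "s > 0" "ball (\<phi> v0) s \<subseteq> ball x0 R" "s \<le> \<rho> - norm v0" using s0 v0 by (auto simp: s_def V_def)
  define c where "c = real q * ((1 + M) * Lg)"
  have c: "c \<ge> 0" using nonneg by (simp add: c_def)
  \<comment> \<open>The first bound keeps the path in the ball of radius \<open>s\<close>; the
    second gives \<open>c * T < 1\<close>, which makes the absorption possible.\<close>
  define \<epsilon> where "\<epsilon> = min (s / (real q * B + 1)) (1 / (c + 1))"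
  have qB: "real q * B \<ge> 0" using B by simp
  have \<epsilon>: "\<epsilon> > 0" using s qB c by (simp add: \<epsilon>_def add_nonneg_pos)
  have "\<gamma> t \<in> \<phi> ` V" if sub: "subunit g q T \<gamma>" and 0: "\<gamma> 0 = \<phi> v0" and T\<epsilon>: "T < \<epsilon>" and t: "t \<in> {0..T}" for T \<gamma> t
  proof -
    obtain K u N where T: "T \<ge> 0" and K: "K-lipschitz_on {0..T} \<gamma>" and ctrl: "control g q T \<gamma> u N"
      using sub unfolding subunit_iff by blast
    have "real q * B * T < s"
    proof -
      have "real q * B * T \<le> (real q * B + 1) * T" using T by (simp add: algebra_simps)
      also have "\<dots> < (real q * B + 1) * (s / (real q * B + 1))"
        using T\<epsilon> qB by (intro mult_strict_left_mono) (auto simp: \<epsilon>_def)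
      also have "\<dots> = s" using qB by simp
      finally show ?thesis .
    qed
    then have ball: "\<gamma> r \<in> ball (\<phi> v0) s" if "r \<in> {0..T}" for r
      using subunit_stays_in_ball[OF sub _ B 0 _ that] normg s(2) by blast
    define v where "v r = P (\<gamma> r - x0)" for r
    have vV: "v r \<in> V" if r: "r \<in> {0..T}" for r
    proof -
      have "v r = P (\<gamma> r - \<phi> v0) + v0"
        using P_\<phi>[OF v0] by (simp add: v_def linear_diff[OF linear_P] algebra_simps)
      then have "norm (v r) \<le> norm (\<gamma> r - \<phi> v0) + norm v0"
        using norm_triangle_ineq[of "P (\<gamma> r - \<phi> v0)" v0] norm_P[of "\<gamma> r - \<phi> v0"] by simp
      also have "\<dots> < \<rho>" using ball[OF r] s(3) by (simp add: dist_norm norm_minus_commute)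
      finally show ?thesis using P_in by (simp add: V_def v_def)
    qed
    define \<delta> where "\<delta> r = \<gamma> r - \<phi> (v r)" for r
    have lip\<delta>: "(K + K1 * K)-lipschitz_on {0..T} \<delta>"
    proof (rule lipschitz_onI)
      fix r r' assume r: "r \<in> {0..T}" "r' \<in> {0..T}"
      have \<gamma>: "norm (\<gamma> r - \<gamma> r') \<le> K * \<bar>r - r'\<bar>" using lipschitz_onD[OF K r] by (simp add: dist_norm)
      have "v r - v r' = P (\<gamma> r - \<gamma> r')" by (simp add: v_def linear_diff[OF linear_P])
      then have "norm (v r - v r') \<le> K * \<bar>r - r'\<bar>" using norm_P[of "\<gamma> r - \<gamma> r'"] \<gamma> by simp
      then have "K1 * norm (v r - v r') \<le> K1 * (K * \<bar>r - r'\<bar>)" using nonneg by (intro mult_left_mono)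
      then have "norm (\<phi> (v r) - \<phi> (v r')) \<le> K1 * (K * \<bar>r - r'\<bar>)" using \<phi>_lipschitz[OF vV[OF r(2)] vV[OF r(1)]] by linarith
      moreover have "\<delta> r - \<delta> r' = (\<gamma> r - \<gamma> r') - (\<phi> (v r) - \<phi> (v r'))" by (simp add: \<delta>_def)
      then have "norm (\<delta> r - \<delta> r') \<le> norm (\<gamma> r - \<gamma> r') + norm (\<phi> (v r) - \<phi> (v r'))"
        using norm_triangle_ineq4[of "\<gamma> r - \<gamma> r'" "\<phi> (v r) - \<phi> (v r')"] by simp
      ultimately show "dist (\<delta> r) (\<delta> r') \<le> (K + K1 * K) * dist r r'"
        using \<gamma> unfolding dist_norm distrib_right real_norm_def by linarith
    qed (use nonneg lipschitz_on_nonneg[OF K] in simp)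
    have "continuous_on {0..T} (\<lambda>r. norm (\<delta> r))"
      using lipschitz_on_continuous_on[OF lip\<delta>] by (rule continuous_on_norm)
    then have "\<exists>m\<in>{0..T}. \<forall>r\<in>{0..T}. norm (\<delta> r) \<le> norm (\<delta> m)"
      using T by (intro continuous_attains_sup) auto
    then obtain m where m: "m \<in> {0..T}" "\<And>r. r \<in> {0..T} \<Longrightarrow> norm (\<delta> r) \<le> norm (\<delta> m)" by blast
    have "norm (\<delta> m - \<delta> 0) \<le> (c * norm (\<delta> m)) * (m - 0)"
    proof (rule lipschitz_AE_deriv_bound)
      show "(K + K1 * K)-lipschitz_on {0..m} \<delta>" by (rule lipschitz_on_subset[OF lip\<delta>]) (use m in auto)
      show "negligible N" using ctrl by (simp add: control_def)
      fix r assume r: "r \<in> {0<..<m}" "r \<notin> N"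
      then have rT: "r \<in> {0<..<T} - N" "r \<in> {0..T}" using m by auto
      define \<xi> where "\<xi> = (\<Sum>j<q. u r j *\<^sub>R g j (\<gamma> r))"
      have u: "(\<Sum>j<q. (u r j)\<^sup>2) \<le> 1" and \<gamma>': "(\<gamma> has_vector_derivative \<xi>) (at r)"
        using ctrl rT(1) by (auto simp: control_def \<xi>_def)
      have "(v has_vector_derivative P (\<xi> - 0)) (at r)"
        unfolding v_def by (rule bounded_linear.has_vector_derivative[OF linear_conv_bounded_linear[THEN iffD1, OF linear_P]])
          (intro has_vector_derivative_diff \<gamma>' has_vector_derivative_const)
      then have "(v has_vector_derivative P \<xi>) (at r within {0..T})" by (simp add: has_vector_derivative_at_within)
      moreover have "(\<phi> has_derivative D (v r)) (at (v r) within v ` {0..T})"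
        by (rule has_derivative_subset[OF \<phi>_deriv[OF vV[OF rT(2)]]]) (use vV in auto)
      ultimately have "((\<phi> \<circ> v) has_vector_derivative D (v r) (P \<xi>)) (at r within {0..T})"
        by (rule vector_derivative_diff_chain_within)
      then have "((\<lambda>r. \<phi> (v r)) has_vector_derivative D (v r) (P \<xi>)) (at r)"
        using rT(1) by (simp add: o_def at_within_Icc_at)
      then have "(\<delta> has_vector_derivative \<xi> - D (v r) (P \<xi>)) (at r)"
        unfolding \<delta>_def by (intro has_vector_derivative_diff \<gamma>')
      moreover have "norm (\<xi> - D (v r) (P \<xi>)) \<le> c * norm (\<delta> m)"
      proof -
        have "\<xi> - D (v r) (P \<xi>) = (\<Sum>j<q. u r j *\<^sub>R (g j (\<gamma> r) - D (v r) (g j (\<gamma> r))))"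
          by (simp add: D_P \<xi>_def linear_sum[OF linear_D] linear_cmul[OF linear_D] sum_subtractf scaleR_diff_right)
        also have "norm \<dots> \<le> (\<Sum>j<q. 1 * ((1 + M) * (Lg * norm (\<delta> r))))"
        proof (rule sum_norm_le)
          fix j assume "j \<in> {..<q}"
          then have j: "j < q" by simp
          define y where "y = \<phi> (v r)"
          have gy: "D (v r) (g j y) = g j y" unfolding y_def by (rule D_g[OF vV[OF rT(2)] j])
          \<comment> \<open>As \<open>D (v r)\<close> fixes the field at the surface point
            \<open>y\<close>, only the difference of the field between \<open>\<gamma> r\<close> and
            \<open>y\<close> survives.\<close>
          have eq: "g j (\<gamma> r) - D (v r) (g j (\<gamma> r)) = (g j (\<gamma> r) - g j y) - D (v r) (g j (\<gamma> r) - g j y)"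
            by (simp add: linear_diff[OF linear_D] gy)
          have "norm (g j (\<gamma> r) - D (v r) (g j (\<gamma> r))) \<le> norm (g j (\<gamma> r) - g j y) + M * norm (g j (\<gamma> r) - g j y)"
            unfolding eq using norm_triangle_ineq4[of "g j (\<gamma> r) - g j y" "D (v r) (g j (\<gamma> r) - g j y)"] norm_D[of "v r" "g j (\<gamma> r) - g j y"] by linarith
          also have "\<dots> = (1 + M) * norm (g j (\<gamma> r) - g j y)" by (simp add: algebra_simps)
          also have "\<dots> \<le> (1 + M) * (Lg * norm (\<delta> r))"
          proof (rule mult_left_mono)
            have "\<gamma> r \<in> ball x0 R" "y \<in> ball x0 R" using ball[OF rT(2)] s(2) \<phi>_in_ball[OF vV[OF rT(2)]] by (auto simp: y_def)
            then show "norm (g j (\<gamma> r) - g j y) \<le> Lg * norm (\<delta> r)"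
              using lipschitz_onD[OF lipschitz_g[OF j]] by (simp add: dist_norm \<delta>_def y_def)
          qed (use nonneg in simp)
          finally show "norm (u r j *\<^sub>R (g j (\<gamma> r) - D (v r) (g j (\<gamma> r)))) \<le> 1 * ((1 + M) * (Lg * norm (\<delta> r)))"
            using abs_le_one_if_sum_squares[OF u j] unfolding norm_scaleR by (intro mult_mono) auto
        qed
        also have "\<dots> = c * norm (\<delta> r)" by (simp add: c_def mult_ac)
        also have "\<dots> \<le> c * norm (\<delta> m)" using m(2)[OF rT(2)] c by (intro mult_left_mono)
        finally show ?thesis .
      qed
      ultimately show "\<exists>D. (\<delta> has_vector_derivative D) (at r) \<and> norm D \<le> c * norm (\<delta> m)" by blast
    qed (use m in auto)
    moreover have "\<delta> 0 = 0" using 0 P_\<phi>[OF v0] by (simp add: \<delta>_def v_def)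
    ultimately have le: "norm (\<delta> m) \<le> (c * m) * norm (\<delta> m)" by (simp add: mult_ac)
    have "c * m < 1"
    proof -
      have "c * m \<le> (c + 1) * T" using m(1) c by (intro mult_mono) auto
      also have "\<dots> < (c + 1) * (1 / (c + 1))" using T\<epsilon> c by (intro mult_strict_left_mono) (auto simp: \<epsilon>_def)
      finally show ?thesis using c by simp
    qed
    have "norm (\<delta> m) = 0"
    proof (rule ccontr)
      assume "norm (\<delta> m) \<noteq> 0"
      then have "(c * m) * norm (\<delta> m) < 1 * norm (\<delta> m)" using \<open>c * m < 1\<close> by (intro mult_strict_right_mono) auto
      then show False using le by simp
    qed
    then have "\<delta> t = 0" using m(2)[OF t] by simp
    then have "\<gamma> t = \<phi> (v t)" by (simp add: \<delta>_def)
    then show ?thesis using vV[OF t] by blast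
  qed
  then show ?thesis using \<epsilon> by blast
qed

text \<open>By \<open>D_horizontal\<close> the image of the segment from \<open>v\<close> to
  \<open>w\<close> solves the control equation with controls
  \<open>b j (l t) \<bullet> (w - v) / T\<close>; the time \<open>T\<close> is long enough to make
  them subunit. The \<open>+ 1\<close> keeps \<open>T\<close> positive.\<close>

lemma cc_dist_\<phi>_le:
  assumes v: "v \<in> V" and w: "w \<in> V"
  shows "cc_dist g q (\<phi> v) (\<phi> w) \<le> ereal ((real q * A + 1) * norm (w - v))"
proof (cases "v = w")
  case True
  then show ?thesis using cc_dist_le[OF subunit_refl[of g q "\<phi> v"], of "\<phi> v" "\<phi> w"] by simp
next
  case False
  define T where "T = (real q * A + 1) * norm (w - v)"
  have qA: "real q * A \<ge> 0" using nonneg by simp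
  have T: "T > 0" using False qA by (simp add: T_def add_nonneg_pos)
  \<comment> \<open>The clamped segment stays in \<open>V\<close> at all real times, so the controls
    are continuous on the whole line.\<close>
  define l where "l t = v + max 0 (min 1 (t / T)) *\<^sub>R (w - v)" for t
  have lV: "l t \<in> V" for t
  proof -
    have "l t = (1 - max 0 (min 1 (t / T))) *\<^sub>R v + max 0 (min 1 (t / T)) *\<^sub>R w" by (simp add: l_def algebra_simps)
    then show ?thesis using convexD[OF convex_V v w, of "1 - max 0 (min 1 (t / T))" "max 0 (min 1 (t / T))"] by simp
  qed
  have contl: "continuous_on UNIV l" unfolding l_def using T by (intro continuous_intros) auto
  define \<gamma> where "\<gamma> t = \<phi> (l t)" for t
  define u where "u t j = (b j (l t) \<bullet> (w - v)) / T" for t j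
  have liple: "\<bar>max 0 (min 1 (s / T)) - max 0 (min 1 (t / T))\<bar> \<le> \<bar>s - t\<bar> / T" for s t
  proof -
    have "\<bar>max 0 (min 1 x) - max 0 (min 1 y)\<bar> \<le> \<bar>x - y\<bar>" for x y :: real by (auto simp: max_def min_def)
    from this[of "s / T" "t / T"] show ?thesis using T by (simp add: diff_divide_distrib[symmetric] abs_divide)
  qed
  have "(K1 * (norm (w - v) / T))-lipschitz_on {0..T} \<gamma>"
  proof (rule lipschitz_onI)
    fix s t
    have "norm (\<gamma> s - \<gamma> t) \<le> K1 * norm (l s - l t)" unfolding \<gamma>_def by (rule \<phi>_lipschitz[OF lV lV])
    also have "l s - l t = (max 0 (min 1 (s / T)) - max 0 (min 1 (t / T))) *\<^sub>R (w - v)"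
      by (simp add: l_def scaleR_left_diff_distrib)
    also have "K1 * norm \<dots> \<le> K1 * (\<bar>s - t\<bar> / T * norm (w - v))"
      unfolding norm_scaleR using liple[of s t] nonneg by (intro mult_left_mono mult_right_mono) auto
    finally show "dist (\<gamma> s) (\<gamma> t) \<le> K1 * (norm (w - v) / T) * dist s t" by (simp add: dist_norm mult_ac)
  qed (use nonneg T in simp)
  moreover have "control g q T \<gamma> u {}"
    unfolding control_def
  proof (intro conjI allI impI ballI)
    show "(\<lambda>t. u t j) \<in> borel_measurable borel" if "j < q" for j
    proof -
      have "continuous_on UNIV (\<lambda>t. b j (l t))"
        by (rule continuous_on_compose2[OF continuous_b[OF that] contl]) (use lV in auto)
      then have "continuous_on UNIV (\<lambda>t. u t j)" unfolding u_def using T by (intro continuous_intros) auto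
      then show ?thesis by (rule borel_measurable_continuous_onI)
    qed
    show "negligible {}" by simp
    fix t assume t: "t \<in> {0<..<T} - {}"
    define a where "a = A * norm (w - v) / T"
    have a: "a \<ge> 0" "real q * a \<le> 1"
    proof -
      show "a \<ge> 0" using nonneg T by (simp add: a_def)
      have "real q * A * norm (w - v) \<le> T" by (simp add: T_def algebra_simps)
      then show "real q * a \<le> 1" using T by (simp add: a_def)
    qed
    have "\<bar>u t j\<bar> \<le> a" if "j < q" for j
    proof -
      have "\<bar>b j (l t) \<bullet> (w - v)\<bar> \<le> norm (b j (l t)) * norm (w - v)" by (rule Cauchy_Schwarz_ineq2)
      also have "\<dots> \<le> A * norm (w - v)" using norm_b[OF that lV] by (intro mult_right_mono) auto
      finally show ?thesis using T by (simp add: u_def a_def abs_divide divide_right_mono)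
    qed
    then have "(\<Sum>j<q. (u t j)\<^sup>2) \<le> (\<Sum>j<q. a\<^sup>2)" using a by (intro sum_mono) (auto simp: abs_le_square_iff[symmetric])
    also have "\<dots> = real q * a\<^sup>2" by simp
    also have "\<dots> \<le> (real q * a)\<^sup>2"
    proof -
      have "real q \<le> (real q)\<^sup>2" by (cases q) (auto simp: power2_eq_square)
      then show ?thesis by (simp add: power_mult_distrib mult_right_mono)
    qed
    also have "\<dots> \<le> 1" using a by (simp add: abs_square_le_1 power_le_one)
    finally show "(\<Sum>j<q. (u t j)\<^sup>2) \<le> 1" .
    have lin: "((\<lambda>t. v + (t / T) *\<^sub>R (w - v)) has_vector_derivative (1 / T) *\<^sub>R (w - v)) (at t)"
      using T by (auto intro!: derivative_eq_intros simp: has_vector_derivative_def divide_inverse)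
    have "(l has_vector_derivative (1 / T) *\<^sub>R (w - v)) (at t)"
      by (rule has_vector_derivative_transform_within_open[OF lin, of "{0<..<T}"]) (use t T in \<open>auto simp: l_def\<close>)
    moreover have "(\<phi> has_derivative D (l t)) (at (l t) within range l)"
      by (rule has_derivative_subset[OF \<phi>_deriv[OF lV]]) (use lV in auto)
    ultimately have "((\<phi> \<circ> l) has_vector_derivative D (l t) ((1 / T) *\<^sub>R (w - v))) (at t)"
      by (rule vector_derivative_diff_chain_within)
    moreover have "D (l t) ((1 / T) *\<^sub>R (w - v)) = (\<Sum>j<q. u t j *\<^sub>R g j (\<gamma> t))"
      unfolding D_horizontal[OF lV] by (simp add: u_def \<gamma>_def)
    ultimately show "(\<gamma> has_vector_derivative (\<Sum>j<q. u t j *\<^sub>R g j (\<gamma> t))) (at t)"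
      by (simp add: \<gamma>_def[abs_def] o_def)
  qed
  ultimately have "subunit g q T \<gamma>" unfolding subunit_iff using T by auto
  moreover have "\<gamma> 0 = \<phi> v" "\<gamma> T = \<phi> w" using T by (auto simp: \<gamma>_def l_def)
  ultimately show ?thesis using cc_dist_le unfolding T_def by blast
qed

text \<open>\<open>P\<close> is a left inverse of \<open>D v\<close> on the parameter space, and by
  \<open>D_g\<close> every field at \<open>\<phi> v\<close> is the image of its own
  projection.\<close>

lemma D_image:
  assumes v: "v \<in> V"
  shows "inj_on (D v) (Pspace g q x0)" "D v ` Pspace g q x0 = Pspace g q (\<phi> v)"
proof -
  show "inj_on (D v) (Pspace g q x0)"
    by (rule inj_on_inverseI[of _ P]) (simp add: P_D P_id)
  show "D v ` Pspace g q x0 = Pspace g q (\<phi> v)"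
  proof
    show "D v ` Pspace g q x0 \<subseteq> Pspace g q (\<phi> v)"
      unfolding Pspace_iff_combination subset_iff by (auto simp: D_horizontal[OF v])
    show "Pspace g q (\<phi> v) \<subseteq> D v ` Pspace g q x0"
    proof
      fix y assume "y \<in> Pspace g q (\<phi> v)"
      then obtain c where c: "y = (\<Sum>j<q. c j *\<^sub>R g j (\<phi> v))" unfolding Pspace_iff_combination by blast
      have "D v (P y) = y"
        unfolding D_P c by (simp add: linear_sum[OF linear_D] linear_cmul[OF linear_D] D_g[OF v])
      then show "y \<in> D v ` Pspace g q x0" using P_in by (metis imageI)
    qed
  qed
qed

section \<open>The surfaces as charts for the orbit topology\<close>

lemma dim_Pspace_\<phi>: "v \<in> V \<Longrightarrow> dim (Pspace g q (\<phi> v)) = dim (Pspace g q x0)"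
  using dim_image_eq[OF linear_D[of v], of "Pspace g q x0"] D_image[of v] by (simp add: Pspace_def span_span)

lemma \<phi>_in_orbit: "x0 \<in> orbit g q x \<Longrightarrow> v \<in> V \<Longrightarrow> \<phi> v \<in> orbit g q x"
proof -
  assume x: "x0 \<in> orbit g q x" and v: "v \<in> V"
  have "cc_dist g q x0 (\<phi> v) < \<infinity>"
    using cc_dist_\<phi>_le[OF zero_in_V v] \<phi>_0 by (auto simp: less_top[symmetric])
  then have "\<phi> v \<in> orbit g q x0" by (simp add: orbit_def)
  then show ?thesis using x orbit_trans by blast
qed

lemma openin_chart_image:
  assumes "x0 \<in> orbit g q x"
  shows "openin (cc_topology g q x) (\<phi> ` V)"
  unfolding openin_cc_topology
proof (intro conjI ballI)
  show "\<phi> ` V \<subseteq> orbit g q x" using \<phi>_in_orbit[OF assms] by blast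
  fix y assume "y \<in> \<phi> ` V"
  then obtain v0 where v0: "v0 \<in> V" "y = \<phi> v0" by blast
  obtain \<epsilon> where \<epsilon>: "\<epsilon> > 0"
    "\<And>T \<gamma> t. subunit g q T \<gamma> \<Longrightarrow> \<gamma> 0 = \<phi> v0 \<Longrightarrow> T < \<epsilon> \<Longrightarrow> t \<in> {0..T} \<Longrightarrow> \<gamma> t \<in> \<phi> ` V"
    using path_stays_in_chart[OF v0(1)] by blast
  have "{z \<in> orbit g q x. cc_dist g q y z < ereal \<epsilon>} \<subseteq> \<phi> ` V"
  proof (rule subsetI)
    fix z assume "z \<in> {z \<in> orbit g q x. cc_dist g q y z < ereal \<epsilon>}"
    then have "cc_dist g q y z < ereal \<epsilon>" by simp
    then obtain T \<gamma> where \<gamma>: "subunit g q T \<gamma>" "\<gamma> 0 = y" "\<gamma> T = z" "T < \<epsilon>" by (rule cc_dist_lessD)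
    have "T \<in> {0..T}" using \<gamma>(1) by (simp add: subunit_def)
    then show "z \<in> \<phi> ` V" using \<epsilon>(2)[OF \<gamma>(1) _ \<gamma>(4)] \<gamma>(2,3) v0(2) by blast
  qed
  then show "\<exists>r>0. {z \<in> orbit g q x. cc_dist g q y z < ereal r} \<subseteq> \<phi> ` V" using \<epsilon>(1) by blast
qed

text \<open>The inverse is the restriction of \<open>y \<mapsto> P (y - x0)\<close>, which is
  continuous for the Euclidean topology and hence for the finer one. In the other direction,
  \<open>\<phi>\<close> is continuous because segments in \<open>V\<close> map to short subunit
  paths.\<close>

lemma homeomorphic_chart:
  assumes lip: "\<forall>j<q. locally_lipschitz (g j)" and x: "x0 \<in> orbit g q x"
  shows "homeomorphic_map (top_of_set V) (subtopology (cc_topology g q x) (\<phi> ` V)) \<phi>"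
proof -
  define \<psi> where "\<psi> y = P (y - x0)" for y
  have cont\<psi>: "continuous_on UNIV \<psi>"
    unfolding \<psi>_def using linear_P
    by (intro continuous_on_compose2[OF linear_continuous_on[of P UNIV]]) (auto simp: linear_conv_bounded_linear intro!: continuous_intros)
  have cm\<phi>: "continuous_map (top_of_set V) (cc_topology g q x) \<phi>"
    unfolding continuous_map_def topspace_cc_topology
  proof (intro conjI allI impI)
    show "\<phi> \<in> topspace (top_of_set V) \<rightarrow> orbit g q x" using \<phi>_in_orbit[OF x] by auto
    fix U assume U: "openin (cc_topology g q x) U"
    have "\<exists>e>0. \<forall>w\<in>V. dist w v < e \<longrightarrow> w \<in> {v \<in> V. \<phi> v \<in> U}" if v: "v \<in> {v \<in> V. \<phi> v \<in> U}" for v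
    proof -
      obtain r where r: "r > 0" "{z \<in> orbit g q x. cc_dist g q (\<phi> v) z < ereal r} \<subseteq> U"
        using U v unfolding openin_cc_topology by blast
      have qA: "real q * A + 1 > 0" using nonneg by (simp add: add_nonneg_pos)
      have "\<phi> w \<in> U" if w: "w \<in> V" "dist w v < r / (real q * A + 1)" for w
      proof -
        have "cc_dist g q (\<phi> v) (\<phi> w) \<le> ereal ((real q * A + 1) * norm (w - v))" by (rule cc_dist_\<phi>_le) (use v w in auto)
        also have "\<dots> < ereal r" using w(2) qA by (simp add: dist_norm pos_less_divide_eq mult.commute)
        finally show ?thesis using r(2) \<phi>_in_orbit[OF x w(1)] by blast
      qed
      then show ?thesis using r(1) qA by (intro exI[of _ "r / (real q * A + 1)"]) auto
    qed
    then show "openin (top_of_set V) {v \<in> topspace (top_of_set V). \<phi> v \<in> U}"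
      unfolding openin_euclidean_subtopology_iff by auto
  qed
  have "homeomorphic_maps (top_of_set V) (subtopology (cc_topology g q x) (\<phi> ` V)) \<phi> \<psi>"
    unfolding homeomorphic_maps_def
  proof (intro conjI ballI)
    show "continuous_map (top_of_set V) (subtopology (cc_topology g q x) (\<phi> ` V)) \<phi>"
      unfolding continuous_map_in_subtopology using cm\<phi> by auto
    show "continuous_map (subtopology (cc_topology g q x) (\<phi> ` V)) (top_of_set V) \<psi>"
      unfolding continuous_map_in_subtopology
    proof
      show "continuous_map (subtopology (cc_topology g q x) (\<phi> ` V)) euclidean \<psi>"
        unfolding continuous_map_def
      proof (intro conjI allI impI)
        fix U :: "'a set" assume "openin euclidean U"
        then have "open (\<psi> -` U)" using cont\<psi> by (simp add: continuous_on_open_vimage[OF open_UNIV])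
        then have "openin (cc_topology g q x) (\<psi> -` U \<inter> orbit g q x)" by (rule cc_topology_finer[OF lip])
        moreover have "{y \<in> topspace (subtopology (cc_topology g q x) (\<phi> ` V)). \<psi> y \<in> U} = (\<psi> -` U \<inter> orbit g q x) \<inter> \<phi> ` V"
          by (auto simp: topspace_subtopology topspace_cc_topology)
        ultimately show "openin (subtopology (cc_topology g q x) (\<phi> ` V)) {y \<in> topspace (subtopology (cc_topology g q x) (\<phi> ` V)). \<psi> y \<in> U}"
          unfolding openin_subtopology by blast
      qed auto
      show "\<psi> \<in> topspace (subtopology (cc_topology g q x) (\<phi> ` V)) \<rightarrow> V"
        by (auto simp: \<psi>_def P_\<phi>)
    qed
    show "\<psi> (\<phi> v) = v" if "v \<in> topspace (top_of_set V)" for v using that by (simp add: \<psi>_def P_\<phi>)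
    show "\<phi> (\<psi> y) = y" if "y \<in> topspace (subtopology (cc_topology g q x) (\<phi> ` V))" for y
      using that by (auto simp: \<psi>_def P_\<phi>)
  qed
  then show ?thesis by (rule homeomorphic_maps_imp_map)
qed

text \<open>One statement for two uses: \<open>Q\<close> the identity gives the chart itself,
  \<open>Q\<close> the projection of another chart gives the transition map. The derivative inherits
  the Lipschitz constant \<open>K3\<close> because \<open>Q\<close> does not increase norms.\<close>

lemma C11_deriv_\<phi>:
  assumes "linear Q" "\<And>y. norm (Q y) \<le> norm y" "U \<subseteq> V"
  shows "C11_deriv_on (Pspace g q x0) U (\<lambda>v. Q (\<phi> v - c)) (\<lambda>v h. Q (D v h))"
  unfolding C11_deriv_on_def
proof (intro conjI ballI)
  fix v assume v: "v \<in> U"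
  then have vV: "v \<in> V" using assms(3) by blast
  have "(\<phi> has_derivative D v) (at v within U)" by (rule has_derivative_subset[OF \<phi>_deriv[OF vV] assms(3)])
  then have "((\<lambda>v. \<phi> v - c) has_derivative (\<lambda>h. D v h - 0)) (at v within U)" by (intro has_derivative_diff has_derivative_const)
  then show "((\<lambda>v. Q (\<phi> v - c)) has_derivative (\<lambda>h. Q (D v h))) (at v within U)"
    using bounded_linear.has_derivative[OF linear_conv_bounded_linear[THEN iffD1, OF assms(1)]] by simp
  have "norm (Q (D a h) - Q (D w h)) \<le> K3 * dist a w * norm h" if "a \<in> V" "w \<in> V" for a w h
  proof -
    have "norm (Q (D a h) - Q (D w h)) \<le> norm (D a h - D w h)"
      using assms(2)[of "D a h - D w h"] by (simp add: linear_diff[OF assms(1)])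
    then show ?thesis using D_lipschitz[OF that, of h] by (simp add: dist_norm)
  qed
  then show "\<exists>r>0. \<exists>K. \<forall>a\<in>U \<inter> ball v r. \<forall>w\<in>U \<inter> ball v r. \<forall>h\<in>Pspace g q x0.
         norm (Q (D a h) - Q (D w h)) \<le> K * dist a w * norm h"
    using assms(3) by (intro exI[of _ 1] conjI exI[of _ K3]) auto
qed

lemma C11_chart_\<phi>:
  assumes lip: "\<forall>j<q. locally_lipschitz (g j)" and x: "x0 \<in> orbit g q x"
  shows "C11_chart (cc_topology g q x) (Pspace g q) (Pspace g q x0) V \<phi>"
  unfolding C11_chart_def
proof (intro conjI)
  show "subspace (Pspace g q x0)" by (simp add: Pspace_def)
  have "V = Pspace g q x0 \<inter> ball 0 \<rho>" by (auto simp: V_def)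
  then show "openin (top_of_set (Pspace g q x0)) V" by (simp add: openin_open_Int)
  show "openin (cc_topology g q x) (\<phi> ` V)" by (rule openin_chart_image[OF x])
  show "homeomorphic_map (top_of_set V) (subtopology (cc_topology g q x) (\<phi> ` V)) \<phi>"
    by (rule homeomorphic_chart[OF lip x])
  have "C11_deriv_on (Pspace g q x0) V \<phi> D" using C11_deriv_\<phi>[of "\<lambda>y. y" V 0] by (simp add: linear_ident)
  then show "\<exists>Df. C11_deriv_on (Pspace g q x0) V \<phi> Df \<and>
      (\<forall>v\<in>V. inj_on (Df v) (Pspace g q x0) \<and> Df v ` Pspace g q x0 = Pspace g q (\<phi> v))"
    using D_image by blast
qed

text \<open>The inverse of the second chart is the restriction of the affine map
  \<open>y \<mapsto> Q (y - c)\<close>, defined on the whole space. The transition map is thus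
  \<open>\<phi>\<close> followed by an affine map and has the regularity of
  \<open>\<phi>\<close>.\<close>

lemma C11_compatible_\<phi>:
  assumes "linear Q" "\<And>y. norm (Q y) \<le> norm y" and Q: "\<And>v. v \<in> V2 \<Longrightarrow> Q (\<phi>2 v - c) = v"
  shows "C11_compatible (Pspace g q x0, V, \<phi>) (L2, V2, \<phi>2)"
proof -
  define U where "U = {v \<in> V. \<phi> v \<in> \<phi>2 ` V2}"
  have inv: "inv_into V2 \<phi>2 (\<phi> v) = Q (\<phi> v - c)" if v: "v \<in> U" for v
  proof -
    obtain w where w: "w \<in> V2" "\<phi> v = \<phi>2 w" using v by (auto simp: U_def)
    have "inj_on \<phi>2 V2" by (rule inj_on_inverseI[of _ "\<lambda>y. Q (y - c)"]) (rule Q)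
    then show ?thesis using w Q by (simp add: inv_into_f_f)
  qed
  have *: "C11_deriv_on (Pspace g q x0) U (\<lambda>v. Q (\<phi> v - c)) (\<lambda>v h. Q (D v h))"
    by (rule C11_deriv_\<phi>[OF assms(1,2)]) (auto simp: U_def)
  have "C11_deriv_on (Pspace g q x0) U (inv_into V2 \<phi>2 \<circ> \<phi>) (\<lambda>v h. Q (D v h))"
    unfolding C11_deriv_on_def
  proof (intro conjI ballI)
    fix v assume v: "v \<in> U"
    have "((\<lambda>v. Q (\<phi> v - c)) has_derivative (\<lambda>h. Q (D v h))) (at v within U)"
      using * v by (simp add: C11_deriv_on_def)
    then show "((inv_into V2 \<phi>2 \<circ> \<phi>) has_derivative (\<lambda>h. Q (D v h))) (at v within U)"
      by (rule has_derivative_transform[OF v, rotated]) (simp add: inv)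
  qed (use * in \<open>simp add: C11_deriv_on_def\<close>)
  then show ?thesis unfolding C11_compatible_def C11_on_def U_def by auto
qed

end

theorem theorem1p1:
  fixes g :: "nat \<Rightarrow> 'a::euclidean_space \<Rightarrow> 'a" and q :: nat
  assumes lip: "\<forall>j<q. locally_lipschitz (g j)"
    and H: "\<forall>\<Omega>::'a set. bounded \<Omega> \<and> open \<Omega> \<longrightarrow>
              (\<exists>C>0. AE x in lebesgue. x \<in> \<Omega> \<longrightarrow>
                 (\<forall>j<q. \<forall>k<q. lie_bracket g j k x \<in> Pball g q C x))"
  shows "\<forall>x. topspace (cc_topology g q x) = orbit g q x \<and>
             connected_space (cc_topology g q x) \<and>
             C11_immersed_submanifold (cc_topology g q x) (Pspace g q)"
proof (intro allI conjI)
  fix x :: 'a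
  let ?X = "cc_topology g q x"
  show "topspace ?X = orbit g q x" by (rule topspace_cc_topology)
  show conn: "connected_space ?X" by (rule connected_cc_topology)
  \<comment> \<open>Everything except subspace, domain and map is quantified away. The atlas then
    consists of all charts centred at points of the orbit, without a choice of one chart per
    point.\<close>
  define chart where "chart y c \<longleftrightarrow> (\<exists>P D b \<rho> A M K1 K2 K3 R Lg. fst c = Pspace g q y \<and>
      integral_chart g q y P (snd (snd c)) D b (fst (snd c)) \<rho> A M K1 K2 K3 R Lg)" for y c
  have ex: "\<exists>c. chart y c" for y
  proof -
    obtain P \<phi> D b V \<rho> A M K1 K2 K3 R Lg where "integral_chart g q y P \<phi> D b V \<rho> A M K1 K2 K3 R Lg"
      by (rule integral_chart_exists[OF lip H])
    then have "chart y (Pspace g q y, V, \<phi>)" unfolding chart_def fst_conv snd_conv by blast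
    then show ?thesis by blast
  qed
  define \<A> where "\<A> = {c. \<exists>y\<in>orbit g q x. chart y c}"
  define m where "m = dim (Pspace g q x)"
  have loc: "\<exists>U. openin ?X U \<and> y \<in> U \<and> (\<forall>z\<in>U. dim (Pspace g q z) = dim (Pspace g q y))" if y: "y \<in> orbit g q x" for y
  proof -
    obtain P \<phi> D b V \<rho> A M K1 K2 K3 R Lg where "integral_chart g q y P \<phi> D b V \<rho> A M K1 K2 K3 R Lg"
      by (rule integral_chart_exists[OF lip H])
    then interpret integral_chart g q y P \<phi> D b V \<rho> A M K1 K2 K3 R Lg .
    have "y \<in> \<phi> ` V" using imageI[OF zero_in_V, of \<phi>] \<phi>_0 by simp
    moreover have "\<forall>z\<in>\<phi> ` V. dim (Pspace g q z) = dim (Pspace g q y)" using dim_Pspace_\<phi> by auto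
    ultimately show ?thesis using openin_chart_image[OF y] by blast
  qed
  \<comment> \<open>The rank is locally constant by the charts, hence constant since the orbit is connected.\<close>
  have dim: "dim (Pspace g q y) = m" if y: "y \<in> orbit g q x" for y
  proof (rule ccontr)
    assume ne: "dim (Pspace g q y) \<noteq> m"
    define E1 where "E1 = {z \<in> orbit g q x. dim (Pspace g q z) = m}"
    define E2 where "E2 = {z \<in> orbit g q x. dim (Pspace g q z) \<noteq> m}"
    have open_if: "openin ?X {z \<in> orbit g q x. Q (dim (Pspace g q z))}" for Q
    proof (subst openin_subopen, intro ballI)
      fix z assume z: "z \<in> {z \<in> orbit g q x. Q (dim (Pspace g q z))}"
      then obtain U where U: "openin ?X U" "z \<in> U" "\<forall>w\<in>U. dim (Pspace g q w) = dim (Pspace g q z)" using loc by blast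
      have sub: "U \<subseteq> orbit g q x" using openin_subset[OF U(1)] by (simp add: topspace_cc_topology)
      have "U \<subseteq> {z \<in> orbit g q x. Q (dim (Pspace g q z))}"
      proof
        fix w assume w: "w \<in> U"
        then have "dim (Pspace g q w) = dim (Pspace g q z)" using U(3) by blast
        then have "Q (dim (Pspace g q w))" using z by simp
        then show "w \<in> {z \<in> orbit g q x. Q (dim (Pspace g q z))}" using sub w by blast
      qed
      then show "\<exists>T. openin ?X T \<and> z \<in> T \<and> T \<subseteq> {z \<in> orbit g q x. Q (dim (Pspace g q z))}"
        using U(1,2) by blast
    qed
    have "openin ?X E1" "openin ?X E2" unfolding E1_def E2_def by (rule open_if)+
    moreover have "topspace ?X \<subseteq> E1 \<union> E2" "E1 \<inter> E2 = {}" by (auto simp: E1_def E2_def topspace_cc_topology)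
    moreover have "x \<in> E1" "y \<in> E2" using orbit_refl y ne by (auto simp: E1_def E2_def m_def)
    ultimately show False using conn unfolding connected_space_def by blast
  qed
  show "C11_immersed_submanifold ?X (Pspace g q)"
    unfolding C11_immersed_submanifold_def
  proof (intro conjI exI[of _ m] exI[of _ \<A>])
    show "Hausdorff_space ?X" by (rule Hausdorff_cc_topology[OF lip])
    show "\<forall>(L, V, \<phi>)\<in>\<A>. C11_chart ?X (Pspace g q) L V \<phi> \<and> dim L = m"
    proof (intro ballI, clarify)
      fix L V \<phi> assume "(L, V, \<phi>) \<in> \<A>"
      then obtain y P D b \<rho> A M K1 K2 K3 R Lg where y: "y \<in> orbit g q x" and L: "L = Pspace g q y"
        and ch: "integral_chart g q y P \<phi> D b V \<rho> A M K1 K2 K3 R Lg"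
        unfolding \<A>_def chart_def by auto
      show "C11_chart ?X (Pspace g q) L V \<phi> \<and> dim L = m"
        unfolding L using integral_chart.C11_chart_\<phi>[OF ch lip y] dim[OF y] by simp
    qed
    show "topspace ?X = (\<Union>(L, V, \<phi>)\<in>\<A>. \<phi> ` V)"
    proof
      show "topspace ?X \<subseteq> (\<Union>(L, V, \<phi>)\<in>\<A>. \<phi> ` V)"
      proof
        fix y assume "y \<in> topspace ?X"
        then have y: "y \<in> orbit g q x" by (simp add: topspace_cc_topology)
        obtain L V \<phi> where c: "chart y (L, V, \<phi>)" using ex[of y] by (metis prod_cases3)
        then have "(L, V, \<phi>) \<in> \<A>" using y by (auto simp: \<A>_def)
        moreover have "y \<in> \<phi> ` V"
        proof -
          obtain P D b \<rho> A M K1 K2 K3 R Lg where ch: "integral_chart g q y P \<phi> D b V \<rho> A M K1 K2 K3 R Lg"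
            using c unfolding chart_def by auto
          show ?thesis using imageI[OF integral_chart.zero_in_V[OF ch], of \<phi>] integral_chart.\<phi>_0[OF ch] by simp
        qed
        ultimately show "y \<in> (\<Union>(L, V, \<phi>)\<in>\<A>. \<phi> ` V)" by force
      qed
      show "(\<Union>(L, V, \<phi>)\<in>\<A>. \<phi> ` V) \<subseteq> topspace ?X"
      proof clarify
        fix L V \<phi> v assume "(L, V, \<phi>) \<in> \<A>" and v: "v \<in> V"
        then obtain y P D b \<rho> A M K1 K2 K3 R Lg where y: "y \<in> orbit g q x"
          and ch: "integral_chart g q y P \<phi> D b V \<rho> A M K1 K2 K3 R Lg"
          unfolding \<A>_def chart_def by auto
        show "\<phi> v \<in> topspace ?X"
          unfolding topspace_cc_topology by (rule integral_chart.\<phi>_in_orbit[OF ch y v])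
      qed
    qed
    show "\<forall>c1\<in>\<A>. \<forall>c2\<in>\<A>. C11_compatible c1 c2"
    proof (intro ballI)
      fix c1 c2 assume c: "c1 \<in> \<A>" "c2 \<in> \<A>"
      obtain L1 V1 \<phi>1 where c1: "c1 = (L1, V1, \<phi>1)" by (metis prod_cases3)
      obtain L2 V2 \<phi>2 where c2: "c2 = (L2, V2, \<phi>2)" by (metis prod_cases3)
      obtain y P D b \<rho> A M K1 K2 K3 R Lg where L1: "L1 = Pspace g q y"
        and ch1: "integral_chart g q y P \<phi>1 D b V1 \<rho> A M K1 K2 K3 R Lg"
        using c(1) unfolding \<A>_def chart_def c1 by auto
      obtain y' P' D' b' \<rho>' A' M' K1' K2' K3' R' Lg' where
        ch2: "integral_chart g q y' P' \<phi>2 D' b' V2 \<rho>' A' M' K1' K2' K3' R' Lg'"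
        using c(2) unfolding \<A>_def chart_def c2 by auto
      show "C11_compatible c1 c2"
        unfolding c1 c2 L1
        by (rule integral_chart.C11_compatible_\<phi>[OF ch1 integral_chart.linear_P[OF ch2]
              integral_chart.norm_P[OF ch2] integral_chart.P_\<phi>[OF ch2]])
    qed
  qed
qed

end
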